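(* For each positive integer $n$, the group $U(n)$ of $n\times n$ upper triangular integral matrices with $1$'s on the diagonal is a parallel poly-pushdown ($\mathcal P$) group. In particular, the class of $\mathcal P$ groups contains nilpotent groups of every nilpotency class, and every finitely generated torsion-free nilpotent group embeds in a $\mathcal P$ group.
   Context: **Languages.** For a finite alphabet $A$, $A^*$ is the free monoid on $A$ (words), $\epsilon$ is the empty word, and a language is a subset of $A^*$. **Deterministic pushdown automata.** A deterministic pushdown automaton is a 7-tuple $M=(S,A,B,\tau,s_0,Z_0,Y)$ with $S$ a finite set of states, $A$ a finite input alphabet, $B$ a finite stack alphabet, $s_0\in S$ the start state, $Z_0\in B$ the start symbol, $Y\subseteq S$ the final states, and $\tau:\Sigma\to S\times B^*$ a map with $\Sigma\subseteq (A\cup\{\epsilon\})\times B\times S$ such that for every $(b,s)\in B\times S$ either $(\epsilon,b,s)\in\Sigma$ and $(a,b,s)\notin\Sigma$ for all $a\in A$, or $(\epsilon,b,s)\notin\Sigma$ and $(a,b,s)\in\Sigma$ for all $a\in A$. An instantaneous description is a triple $(u,z,s)\in A^*\times B^*\times S$ (unread input, stack with top at the right end, state). $M$ makes the transition $(av,yb,s)\to(v,y\alpha,t)$ if $a\in A\cup\{\epsilon\}$, $b\in B$, $(a,b,s)\in \Sigma$ and $\tau(a,b,s)=(t,\alpha)$; $\to^*$ is the reflexive transitive closure. $M$ accepts $w$ by final state if $(w,Z_0,s_0)\to^*(\epsilon,z,s)$ for some $z\in B^*$, $s\in Y$; it accepts $w$ by empty stack if $(w,Z_0,s_0)\to^*(\epsilon,\epsilon,s)$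 for some $s\in S$. A language is the language of a deterministic pushdown automaton if it is the set of words accepted by some such $M$ in either one of these two modes. **$\mathcal P$ languages.** $L\subseteq A^*$ is parallel poly-pushdown ($\mathcal P$) if it is an intersection of finitely many languages over $A$ of deterministic pushdown automata. **Two-tape version.** Let $\$$ be a symbol not in $A$, and let $(A\cup\{\$\})^\sharp$, $(A\cup\{\$\})^\flat$ be two disjoint copies of $A\cup\{\$\}$, with induced maps on words $u\mapsto u^\sharp$, $v\mapsto v^\flat$. A shuffle $\sigma(u,v)$ of words $u,v$ is a word $u_1^\sharp v_1^\flat\cdots u_k^\sharp v_k^\flat$ with $u=u_1\cdots u_k$, $v=v_1\cdots v_k$, $u_i\ne\epsilon$ for $i>1$, $v_j\neq\epsilon$ for $j<k$. An asynchronous two-tape pushdown automaton over $A$ is a deterministic pushdown automaton $T$ with input alphabet $(A\cup\{\$\})^\sharp\sqcup (A\cup\{\$\})^\flat$ whose states are partitioned into two sets $S_\sharp,S_\flat$. A pair $(u,v)\in A^*\times A^*$ is accepted by $T$ if some shuffle $\sigma(u\$,v\$)$ is accepted by $T$ and, while reading it, $T$ reads letters of $(A\cup\{\$\})^\sharp$ only in states of $S_\sharp$ and letters of $(A\cup\{\$\})^\flat$ only in states of $S_\flat$. The language of $T$ is the set of accepted pairs. A subset of $A^*\times A^*$ is AT$\mathcal P$ (asynchronous two-tape parallel poly-pushdown) if it is the intersection of the languages of finitely many asynchronous two-tape pushdown automata over $A$. **$\mathcal P$ groups.** Let $G$ be a group and $A$ a finite set with a map $A\to G$ such that the induced monoid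 homomorphism $A^*\to G$, $w\mapsto\overline w$, is surjective. A language $L\subseteq A^*$ is a parallel poly-pushdown structure for $G$ if (1) $w\mapsto \overline w$ restricts to a bijection $L\to G$; (2) $L$ is $\mathcal P$; (3) for each $a\in A$ the set $\{(w,w')\in L\times L: \overline{w'}=\overline{wa}\}$ is AT$\mathcal P$. $G$ is parallel poly-pushdown (a $\mathcal P$ group) if it has such a structure for some such $A$. *)

theory Defs
  imports "HOL-Algebra.Algebra" "Jordan_Normal_Form.Matrix"
begin

section \<open>Deterministic pushdown automata\<close>

text \<open>The partial map \<open>delta M\<close> has the domain written \<open>\<Sigma>\<close> in the literature;
  \<^const>\<open>None\<close> in the first component of an argument stands for the empty word.\<close>

record ('a, 'b, 's) dpda =
  states :: "'s set"
  inputs :: "'a set"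
  stack_syms :: "'b set"
  delta :: "'a option \<times> 'b \<times> 's \<Rightarrow> ('s \<times> 'b list) option"
  start :: 's
  start_sym :: 'b
  finals :: "'s set"

definition is_dpda :: "('a, 'b, 's, 'm) dpda_scheme \<Rightarrow> bool" where
  "is_dpda M \<longleftrightarrow>
     finite (states M) \<and> finite (inputs M) \<and> finite (stack_syms M) \<and>
     start M \<in> states M \<and> start_sym M \<in> stack_syms M \<and> finals M \<subseteq> states M \<and>
     dom (delta M) \<subseteq> insert None (Some ` inputs M) \<times> stack_syms M \<times> states M \<and>
     ran (delta M) \<subseteq> states M \<times> lists (stack_syms M) \<and>
     (\<forall>b \<in> stack_syms M. \<forall>s \<in> states M.
        ((None, b, s) \<in> dom (delta M) \<and>
           (\<forall>a \<in> inputs M. (Some a, b, s) \<notin> dom (delta M))) \<or>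
        ((None, b, s) \<notin> dom (delta M) \<and>
           (\<forall>a \<in> inputs M. (Some a, b, s) \<in> dom (delta M))))"

text \<open>Instantaneous descriptions: unread input, stack (top at the right end), state.\<close>

type_synonym ('a, 'b, 's) config = "'a list \<times> 'b list \<times> 's"

inductive dpda_step ::
  "('a, 'b, 's, 'm) dpda_scheme \<Rightarrow> ('a, 'b, 's) config \<Rightarrow> ('a, 'b, 's) config \<Rightarrow> bool"
  for M where
  eps: "delta M (None, b, s) = Some (t, \<alpha>) \<Longrightarrow> dpda_step M (v, y @ [b], s) (v, y @ \<alpha>, t)"
| read: "delta M (Some a, b, s) = Some (t, \<alpha>) \<Longrightarrow> dpda_step M (a # v, y @ [b], s) (v, y @ \<alpha>, t)"

definition final_state_language :: "('a, 'b, 's, 'm) dpda_scheme \<Rightarrow> 'a list set" where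
  "final_state_language M =
     {w \<in> lists (inputs M). \<exists>z. \<exists>s \<in> finals M.
        (dpda_step M)\<^sup>*\<^sup>* (w, [start_sym M], start M) ([], z, s)}"

definition empty_stack_language :: "('a, 'b, 's, 'm) dpda_scheme \<Rightarrow> 'a list set" where
  "empty_stack_language M =
     {w \<in> lists (inputs M). \<exists>s \<in> states M.
        (dpda_step M)\<^sup>*\<^sup>* (w, [start_sym M], start M) ([], [], s)}"

text \<open>States and stack symbols form finite sets, so taking them to be natural numbers is no
  restriction (and avoids quantifying over types).\<close>

definition dpda_language :: "'a set \<Rightarrow> 'a list set \<Rightarrow> bool" where
  "dpda_language A L \<longleftrightarrow>
     (\<exists>M :: ('a, nat, nat) dpda. is_dpda M \<and> inputs M = A \<and>
        (L = final_state_language M \<or> L = empty_stack_language M))"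

definition poly_pushdown :: "'a set \<Rightarrow> 'a list set \<Rightarrow> bool" where
  "poly_pushdown A L \<longleftrightarrow>
     (\<exists>F. finite F \<and> F \<noteq> {} \<and> (\<forall>K \<in> F. dpda_language A K) \<and> L = \<Inter>F)"


section \<open>Asynchronous two-tape pushdown automata\<close>

text \<open>The alphabet with the extra symbol \<open>$\<close>, here \<open>Endmark\<close>. The two disjoint copies of it
  are the summands of a sum type: \<^const>\<open>Inl\<close> is the sharp copy (first tape), \<^const>\<open>Inr\<close> the
  flat copy (second tape).\<close>

datatype 'a marked = Letter 'a | Endmark

type_synonym 'a tape_letter = "'a marked + 'a marked"

definition marked_set :: "'a set \<Rightarrow> 'a marked set" where
  "marked_set A = insert Endmark (Letter ` A)"

definition end_marked :: "'a list \<Rightarrow> 'a marked list" where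
  "end_marked w = map Letter w @ [Endmark]"

definition tape_shuffles :: "'a list \<Rightarrow> 'a list \<Rightarrow> 'a tape_letter list set" where
  "tape_shuffles u v = shuffles (map Inl (end_marked u)) (map Inr (end_marked v))"

record ('a, 'b, 's) two_tape_pda = "('a tape_letter, 'b, 's) dpda" +
  sharp_states :: "'s set"
  flat_states :: "'s set"

definition is_two_tape_pda :: "'a set \<Rightarrow> ('a, 'b, 's) two_tape_pda \<Rightarrow> bool" where
  "is_two_tape_pda A T \<longleftrightarrow>
     is_dpda T \<and> inputs T = marked_set A <+> marked_set A \<and>
     sharp_states T \<union> flat_states T = states T \<and> sharp_states T \<inter> flat_states T = {}"

text \<open>A step from \<open>c\<close> to \<open>d\<close> reads the letter \<open>a\<close> iff the unread input of \<open>c\<close> is \<open>a\<close> followed by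
  that of \<open>d\<close>; steps on the empty word are unrestricted.\<close>

definition two_tape_step ::
  "('a, 'b, 's) two_tape_pda \<Rightarrow> ('a tape_letter, 'b, 's) config
     \<Rightarrow> ('a tape_letter, 'b, 's) config \<Rightarrow> bool" where
  "two_tape_step T c d \<longleftrightarrow>
     dpda_step T c d \<and>
     (\<forall>x. fst c = Inl x # fst d \<longrightarrow> snd (snd c) \<in> sharp_states T) \<and>
     (\<forall>x. fst c = Inr x # fst d \<longrightarrow> snd (snd c) \<in> flat_states T)"

definition two_tape_final_state_language ::
  "'a set \<Rightarrow> ('a, 'b, 's) two_tape_pda \<Rightarrow> ('a list \<times> 'a list) set" where
  "two_tape_final_state_language A T =
     {(u, v) \<in> lists A \<times> lists A. \<exists>w \<in> tape_shuffles u v. \<exists>z. \<exists>s \<in> finals T.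
        (two_tape_step T)\<^sup>*\<^sup>* (w, [start_sym T], start T) ([], z, s)}"

definition two_tape_empty_stack_language ::
  "'a set \<Rightarrow> ('a, 'b, 's) two_tape_pda \<Rightarrow> ('a list \<times> 'a list) set" where
  "two_tape_empty_stack_language A T =
     {(u, v) \<in> lists A \<times> lists A. \<exists>w \<in> tape_shuffles u v. \<exists>s \<in> states T.
        (two_tape_step T)\<^sup>*\<^sup>* (w, [start_sym T], start T) ([], [], s)}"

definition two_tape_language :: "'a set \<Rightarrow> ('a list \<times> 'a list) set \<Rightarrow> bool" where
  "two_tape_language A R \<longleftrightarrow>
     (\<exists>T :: ('a, nat, nat) two_tape_pda. is_two_tape_pda A T \<and>
        (R = two_tape_final_state_language A T \<or> R = two_tape_empty_stack_language A T))"

definition at_poly_pushdown :: "'a set \<Rightarrow> ('a list \<times> 'a list) set \<Rightarrow> bool" where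
  "at_poly_pushdown A R \<longleftrightarrow>
     (\<exists>F. finite F \<and> F \<noteq> {} \<and> (\<forall>K \<in> F. two_tape_language A K) \<and> R = \<Inter>F)"


section \<open>Parallel poly-pushdown groups\<close>

definition word_value :: "('g, 'm) monoid_scheme \<Rightarrow> ('a \<Rightarrow> 'g) \<Rightarrow> 'a list \<Rightarrow> 'g" where
  "word_value G \<phi> w = foldr (\<lambda>a g. \<phi> a \<otimes>\<^bsub>G\<^esub> g) w \<one>\<^bsub>G\<^esub>"

definition poly_pushdown_structure ::
  "('g, 'm) monoid_scheme \<Rightarrow> 'a set \<Rightarrow> ('a \<Rightarrow> 'g) \<Rightarrow> 'a list set \<Rightarrow> bool" where
  "poly_pushdown_structure G A \<phi> L \<longleftrightarrow>
     L \<subseteq> lists A \<and>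
     bij_betw (word_value G \<phi>) L (carrier G) \<and>
     poly_pushdown A L \<and>
     (\<forall>a \<in> A. at_poly_pushdown A
        {(w, w') \<in> L \<times> L. word_value G \<phi> w' = word_value G \<phi> (w @ [a])})"

text \<open>Since alphabets are finite, it suffices to consider finite sets of natural numbers.\<close>

definition poly_pushdown_group :: "('g, 'm) monoid_scheme \<Rightarrow> bool" where
  "poly_pushdown_group G \<longleftrightarrow>
     group G \<and>
     (\<exists>(A :: nat set) \<phi> L. finite A \<and> \<phi> \<in> A \<rightarrow> carrier G \<and>
        word_value G \<phi> ` lists A = carrier G \<and> poly_pushdown_structure G A \<phi> L)"


section \<open>Groups\<close>

definition unitriangular_group :: "nat \<Rightarrow> int mat monoid" where
  "unitriangular_group n =
     \<lparr>carrier = {M \<in> carrier_mat n n. upper_triangular M \<and> (\<forall>i<n. M $$ (i, i) = 1)},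
      monoid.mult = (*), one = 1\<^sub>m n\<rparr>"

primrec lower_central :: "('g, 'm) monoid_scheme \<Rightarrow> nat \<Rightarrow> 'g set" where
  "lower_central G 0 = carrier G"
| "lower_central G (Suc i) = generate G
     {x \<otimes>\<^bsub>G\<^esub> y \<otimes>\<^bsub>G\<^esub> inv\<^bsub>G\<^esub> x \<otimes>\<^bsub>G\<^esub> inv\<^bsub>G\<^esub> y | x y. x \<in> lower_central G i \<and> y \<in> carrier G}"

definition nilpotent_group :: "('g, 'm) monoid_scheme \<Rightarrow> bool" where
  "nilpotent_group G \<longleftrightarrow> group G \<and> (\<exists>c. lower_central G c = {\<one>\<^bsub>G\<^esub>})"

definition nilpotency_class :: "('g, 'm) monoid_scheme \<Rightarrow> nat" where
  "nilpotency_class G = (LEAST c. lower_central G c = {\<one>\<^bsub>G\<^esub>})"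

definition finitely_generated_group :: "('g, 'm) monoid_scheme \<Rightarrow> bool" where
  "finitely_generated_group G \<longleftrightarrow>
     group G \<and> (\<exists>S. finite S \<and> S \<subseteq> carrier G \<and> generate G S = carrier G)"

definition torsion_free_group :: "('g, 'm) monoid_scheme \<Rightarrow> bool" where
  "torsion_free_group G \<longleftrightarrow>
     group G \<and> (\<forall>x \<in> carrier G. \<forall>k::nat. k > 0 \<and> x [^]\<^bsub>G\<^esub> k = \<one>\<^bsub>G\<^esub> \<longrightarrow> x = \<one>\<^bsub>G\<^esub>)"

end

theory Submission
  imports Defs
begin

text \<open>Transvections and their inverses generate \<open>U(n)\<close>. In a product of powers of transvections
  ordered by decreasing row the exponents are the matrix entries, so the ordered words without
  cancellation form a regular set of normal forms. Right multiplication by a transvection adds a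
  multiple of one column to another. On normal forms this is a system of linear conditions on signed
  letter counts of the two words, and each condition is checked by one integer counter, hence by a
  pushdown automaton that reads one tape after the other. The group \<open>U(n)\<close> has class \<open>n - 1\<close> because
  commutators move the nonzero entries away from the diagonal.

  A finitely generated torsion-free nilpotent group is built from the trivial group by successive
  infinite cyclic extensions, from \<open>K\<close> to \<open>K\<langle>x\<rangle>\<close>. Call an integer valued function polynomial if
  sufficiently many differences annihilate it. A polynomial function on \<open>K\<close>, extended to \<open>K\<langle>x\<rangle>\<close> by
  ignoring the power of \<open>x\<close>, stays polynomial, because conjugation by \<open>x\<close> acts unipotently on
  polynomial functions. Hence polynomial functions of some bounded degree separate the elements of the
  group. They form a lattice of finite rank with a flag on whose factors all translations are trivial,
  so the translations give a faithful representation by integral unitriangular matrices.\<close>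

text \<open>Plain degree is the wrong measure for extending a function from K to K<x>: differences
  of the extension involve f(t y t^-1) - f(y) with t a power of x, and conjugation alters y by a
  commutator. If a difference by an element deep in the lower central series counts as a larger
  drop, this expression loses weight. Nilpotency bounds the drops, so one plain degree can be paid
  for with a bounded number of weights. The factors must be infinite cyclic for the exponent of x to
  be an integer valued function, yet a quotient of a torsion-free nilpotent group may have torsion.
  Hence the series runs through subgroups closed under roots: the quotient is then torsion-free, the
  preimage of its centre is again closed under roots, and a maximal cyclic subgroup of that centre
  yields the next term. Integrality is the last obstacle: differences of integer valued polynomial
  functions are at first only rational combinations of the functions already chosen. Clearing
  denominators for finitely many generators and their inverses suffices, because differences obey a
  cocycle rule.\<close>

section \<open>Finite control with an integer counter\<close>

text \<open>A counter value \<open>k\<close> is kept on the stack in unary. The bottom symbol is \<open>0\<close>, \<open>1\<close> or \<open>2\<close>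
  according to the sign of \<open>k\<close> (so a return to zero is noticed without a further step), above it
  the symbols are \<open>3\<close> for positive and \<open>4\<close> for negative \<open>k\<close>.\<close>

definition counter_stack :: "int \<Rightarrow> nat list" where
  "counter_stack k =
     (if k = 0 then [0] else if k > 0 then 1 # replicate (nat k - 1) 3
      else 2 # replicate (nat (- k) - 1) 4)"

text \<open>The word replacing the top symbol \<open>b\<close> when \<open>w\<close> is added. Only
  -1, 0 and 1 are intended for \<open>w\<close>, so the last branch is the decrement. A step towards
  zero pops \<open>3\<close> or \<open>4\<close>; at the bottom it leaves \<open>0\<close>.\<close>

definition counter_push :: "int \<Rightarrow> nat \<Rightarrow> nat list" where
  "counter_push w b =
     (if w = 0 then [b]
      else if w = 1 then
        (if b = 0 then [1] else if b = 1 then [1, 3] else if b = 3 then [3, 3]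
         else if b = 2 then [0] else [])
      else
        (if b = 0 then [2] else if b = 2 then [2, 4] else if b = 4 then [4, 4]
         else if b = 1 then [0] else []))"

text \<open>Whether the new value is zero can be read off the top symbol: \<open>1\<close> and
  \<open>2\<close> are visible on top only for the values 1 and -1.\<close>

definition counter_zero :: "int \<Rightarrow> nat \<Rightarrow> bool" where
  "counter_zero w b \<longleftrightarrow> b = 0 \<and> w = 0 \<or> b = 2 \<and> w = 1 \<or> b = 1 \<and> w = - 1"

lemma counter_stack_simps [simp]:
  "counter_stack 0 = [0]"
  "counter_stack (int (Suc m)) = 1 # replicate m 3"
  "counter_stack (- int (Suc m)) = 2 # replicate m 4"
proof -
  have "nat (int (Suc m)) - 1 = m" "nat (- (- int (Suc m))) - 1 = m" by simp_all
  moreover have "int (Suc m) > 0" "\<not> - int (Suc m) > 0" "- int (Suc m) \<noteq> 0" by simp_all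
  ultimately show "counter_stack 0 = [0]"
    "counter_stack (int (Suc m)) = 1 # replicate m 3"
    "counter_stack (- int (Suc m)) = 2 # replicate m 4"
    unfolding counter_stack_def by presburger+
qed

text \<open>The bottom symbol is on top exactly when the absolute value of \<open>k\<close> is at
  most 1. The top symbol alone therefore decides how the stack changes and whether the counter
  becomes zero.\<close>

lemma counter_stack_top:
  assumes "w \<in> {- 1, 0, 1}"
  obtains y b where "counter_stack k = y @ [b]" "b < 5"
    "counter_stack (k + w) = y @ counter_push w b" "counter_zero w b \<longleftrightarrow> k + w = 0"
proof -
  note defs = counter_push_def counter_zero_def
  have one: "counter_stack 1 = [1]" "counter_stack (- 1) = [2]"
    using counter_stack_simps(2,3)[of 0] by simp_all
  consider "k = 0" | "k = 1" | "k = - 1" | m where "k = int (Suc (Suc m))"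
    | m where "k = - int (Suc (Suc m))"
  proof -
    have "k = 0 \<or> k = 1 \<or> k = - 1 \<or> k \<ge> 2 \<or> k \<le> - 2" by arith
    moreover have "k = int (Suc (Suc (nat (k - 2))))" if "k \<ge> 2" using that by simp
    moreover have "k = - int (Suc (Suc (nat (- k - 2))))" if "k \<le> - 2" using that by simp
    ultimately show ?thesis using that by blast
  qed
  then show ?thesis
  proof cases
    case 1
    then show ?thesis using assms one by (intro that[of "[]" 0]) (auto simp: defs)
  next
    case 2
    moreover have "counter_stack 2 = [1, 3]" using counter_stack_simps(2)[of 1] by simp
    ultimately show ?thesis using assms one by (intro that[of "[]" 1]) (auto simp: defs)
  next
    case 3
    moreover have "counter_stack (- 2) = [2, 4]" using counter_stack_simps(3)[of 1] by simp
    ultimately show ?thesis using assms one by (intro that[of "[]" 2]) (auto simp: defs)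
  next
    case (4 m)
    have r: "replicate m (3::nat) @ [3, 3] = 3 # 3 # replicate m 3" by (induction m) auto
    have "k + 1 = int (Suc (Suc (Suc m)))" "k + - 1 = int (Suc m)" "k + w \<noteq> 0"
      using 4 assms by auto
    moreover from this have "counter_stack (k + 1) = 1 # 3 # 3 # replicate m 3" "counter_stack (k + - 1) = 1 # replicate m 3"
      "counter_stack k = 1 # 3 # replicate m 3" 
      by (simp_all only: 4 counter_stack_simps replicate_Suc)
    ultimately show ?thesis using assms
      by (intro that[of "1 # replicate m 3" 3]) (auto simp: defs replicate_append_same r)
  next
    case (5 m)
    have r: "replicate m (4::nat) @ [4, 4] = 4 # 4 # replicate m 4" by (induction m) auto
    have "k + - 1 = - int (Suc (Suc (Suc m)))" "k + 1 = - int (Suc m)" "k + w \<noteq> 0"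
      using 5 assms by auto
    moreover from this have "counter_stack (k + 1) = 2 # replicate m 4" "counter_stack (k + - 1) = 2 # 4 # 4 # replicate m 4"
      "counter_stack k = 2 # 4 # replicate m 4" 
      by (simp_all only: 5 counter_stack_simps replicate_Suc)
    ultimately show ?thesis using assms
      by (intro that[of "2 # replicate m 4" 4]) (auto simp: defs replicate_append_same r)
  qed
qed

text \<open>States carry, besides the finite control \<open>q\<close>, the information whether the counter is zero.\<close>

definition with_flag :: "nat \<Rightarrow> bool \<Rightarrow> nat" where
  "with_flag q z = 2 * q + of_bool z"

lemma with_flag_eq_iff [simp]: "with_flag q z = with_flag q' z' \<longleftrightarrow> q = q' \<and> z = z'"
  unfolding with_flag_def by (cases z; cases z') (simp_all, presburger+)

lemma with_flag_div [simp]: "with_flag q z div 2 = q"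
  unfolding with_flag_def by (cases z) simp_all

lemma with_flag_less [simp]: "with_flag q z < 2 * n \<longleftrightarrow> q < n"
  unfolding with_flag_def by (cases z) (simp_all, presburger)

text \<open>There are no moves on the empty word, so every pair of state and stack symbol falls
  under the reading alternative of \<open>is_dpda\<close>, even those that never occur in a run. A
  zero test after the last letter is then impossible, which is why the state itself has to record
  it.\<close>

definition counter_delta ::
  "'a set \<Rightarrow> nat \<Rightarrow> (nat \<Rightarrow> 'a \<Rightarrow> nat) \<Rightarrow> ('a \<Rightarrow> int) \<Rightarrow> 'a option \<times> nat \<times> nat \<Rightarrow> (nat \<times> nat list) option"
where
  "counter_delta A n \<delta> \<omega> = (\<lambda>(x, b, s). case x of None \<Rightarrow> None | Some a \<Rightarrow>
     if a \<in> A \<and> b < 5 \<and> s < 2 * n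
     then Some (with_flag (\<delta> (s div 2) a) (counter_zero (\<omega> a) b), counter_push (\<omega> a) b)
     else None)"

definition counter_config :: "'a list \<Rightarrow> int \<Rightarrow> nat \<Rightarrow> ('a, nat, nat) config" where
  "counter_config w k q = (w, counter_stack k, with_flag q (k = 0))"

lemma is_dpda_counter:
  fixes n :: nat
  assumes "finite A" "d < n" "F \<subseteq> {..<n}" "\<And>q a. q < n \<Longrightarrow> a \<in> A \<Longrightarrow> \<delta> q a < n"
    and M: "states M = {..<2 * n}" "inputs M = A" "stack_syms M = {..<5}"
      "delta M = counter_delta A n \<delta> \<omega>" "start M = with_flag d True" "start_sym M = 0"
      "finals M = (\<lambda>q. with_flag q True) ` F"
  shows "is_dpda M"
proof -
  have push: "set (counter_push w b) \<subseteq> {..<5}" if "b < 5" for w b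
    using that by (auto simp: counter_push_def)
  have \<delta>: "\<delta> (s div 2) a < n" if "s < 2 * n" "a \<in> A" for s a
    using that assms(4) by (simp add: less_mult_imp_div_less mult.commute)
  have ran: "ran (delta M) \<subseteq> states M \<times> lists (stack_syms M)"
  proof
    fix p assume "p \<in> ran (delta M)"
    then obtain x b s where "counter_delta A n \<delta> \<omega> (x, b, s) = Some p"
      by (auto simp: ran_def M)
    then obtain a where "a \<in> A" "b < 5" "s < 2 * n"
      "p = (with_flag (\<delta> (s div 2) a) (counter_zero (\<omega> a) b), counter_push (\<omega> a) b)"
      by (cases x) (auto simp: counter_delta_def split: if_splits)
    then show "p \<in> states M \<times> lists (stack_syms M)"
      using push[of b "\<omega> a"] \<delta> by (simp add: M in_lists_conv_set subset_iff)
  qed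
  have dom: "dom (delta M) = Some ` A \<times> {..<5} \<times> {..<2 * n}"
    unfolding M by (auto simp: dom_def counter_delta_def split: option.splits if_splits)
  have "finals M \<subseteq> states M" using assms(3) by (auto simp: M)
  with ran dom show ?thesis
    using assms(1,2) unfolding is_dpda_def M(1-3,5,6) by auto
qed

lemma counter_step_iff:
  assumes "q < n" "\<And>a. \<omega> a \<in> {- 1, 0, 1}" "delta M = counter_delta A n \<delta> \<omega>"
  shows "dpda_step M (counter_config w k q) c \<longleftrightarrow>
    (\<exists>a v. w = a # v \<and> a \<in> A \<and> c = counter_config v (k + \<omega> a) (\<delta> q a))"
proof
  assume "dpda_step M (counter_config w k q) c"
  then show "\<exists>a v. w = a # v \<and> a \<in> A \<and> c = counter_config v (k + \<omega> a) (\<delta> q a)"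
  proof cases
    case (eps b s t \<alpha> v y)
    then show ?thesis by (simp add: assms(3) counter_delta_def)
  next
    case (read a b s t \<alpha> v y)
    obtain y' b' where y': "counter_stack k = y' @ [b']" "b' < 5"
      "counter_stack (k + \<omega> a) = y' @ counter_push (\<omega> a) b'" "counter_zero (\<omega> a) b' \<longleftrightarrow> k + \<omega> a = 0"
      using counter_stack_top[OF assms(2)] by metis
    have *: "w = a # v" "counter_stack k = y @ [b]" "s = with_flag q (k = 0)"
      using read(1) by (auto simp: counter_config_def)
    with y'(1) have "y = y'" "b = b'" by auto
    then show ?thesis using read(2,3) * y'
      by (auto simp: assms(3) counter_delta_def counter_config_def split: if_splits)
  qed
next
  assume "\<exists>a v. w = a # v \<and> a \<in> A \<and> c = counter_config v (k + \<omega> a) (\<delta> q a)"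
  then obtain a v where *: "w = a # v" "a \<in> A" "c = counter_config v (k + \<omega> a) (\<delta> q a)" by blast
  obtain y b where y: "counter_stack k = y @ [b]" "b < 5"
    "counter_stack (k + \<omega> a) = y @ counter_push (\<omega> a) b" "counter_zero (\<omega> a) b \<longleftrightarrow> k + \<omega> a = 0"
    using counter_stack_top[OF assms(2)] by metis
  have "delta M (Some a, b, with_flag q (k = 0)) =
    Some (with_flag (\<delta> q a) (k + \<omega> a = 0), counter_push (\<omega> a) b)"
    using * y assms(1) by (simp add: assms(3) counter_delta_def)
  from dpda_step.read[of M a b, OF this] show "dpda_step M (counter_config w k q) c"
    by (simp add: counter_config_def * y)
qed

text \<open>One run lemma serves both machine models: \<open>P\<close> is constantly true for one
  tape and expresses the tape discipline for two.\<close>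

primrec reads_allowed :: "(nat \<Rightarrow> 'a \<Rightarrow> bool) \<Rightarrow> (nat \<Rightarrow> 'a \<Rightarrow> nat) \<Rightarrow> nat \<Rightarrow> 'a list \<Rightarrow> bool" where
  "reads_allowed P \<delta> q [] \<longleftrightarrow> True"
| "reads_allowed P \<delta> q (a # w) \<longleftrightarrow> P q a \<and> reads_allowed P \<delta> (\<delta> q a) w"

text \<open>\<open>R\<close> is instantiated by \<open>dpda_step\<close> and by
  \<open>two_tape_step\<close>. As each step reads exactly one letter, a run is determined by its
  input and stops when the input is exhausted.\<close>

lemma counter_run_iff:
  fixes n :: nat
  assumes step: "\<And>w k q c. q < n \<Longrightarrow> R (counter_config w k q) c \<longleftrightarrow>
      (\<exists>a v. w = a # v \<and> a \<in> A \<and> P q a \<and> c = counter_config v (k + \<omega> a) (\<delta> q a))"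
    and \<delta>: "\<And>q a. q < n \<Longrightarrow> a \<in> A \<Longrightarrow> \<delta> q a < n" and "q < n" "w \<in> lists A"
  shows "R\<^sup>*\<^sup>* (counter_config w k q) ([], z, s) \<longleftrightarrow>
    reads_allowed P \<delta> q w \<and> z = counter_stack (k + (\<Sum>a\<leftarrow>w. \<omega> a)) \<and>
    s = with_flag (foldl \<delta> q w) (k + (\<Sum>a\<leftarrow>w. \<omega> a) = 0)"
  using assms(3,4)
proof (induction w arbitrary: k q)
  case Nil
  have "\<not> R (counter_config [] k q) c" for c using step Nil by simp
  then have "R\<^sup>*\<^sup>* (counter_config [] k q) c \<longleftrightarrow> c = counter_config [] k q" for c
    by (metis converse_rtranclpE rtranclp.rtrancl_refl)
  from this[of "([], z, s)"] show ?case by (auto simp: counter_config_def)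
next
  case (Cons a w)
  have a: "a \<in> A" "\<delta> q a < n" using Cons \<delta> by auto
  have s: "R (counter_config (a # w) k q) c \<longleftrightarrow> P q a \<and> c = counter_config w (k + \<omega> a) (\<delta> q a)" for c
    using step[OF Cons.prems(1)] a by auto
  have "R\<^sup>*\<^sup>* (counter_config (a # w) k q) ([], z, s) \<longleftrightarrow>
    (\<exists>c. R (counter_config (a # w) k q) c \<and> R\<^sup>*\<^sup>* c ([], z, s))"
    (is "?l \<longleftrightarrow> ?r")
  proof
    assume ?l
    then show ?r by (cases rule: converse_rtranclpE) (auto simp: counter_config_def)
  qed (blast intro: converse_rtranclp_into_rtranclp)
  also have "\<dots> \<longleftrightarrow> P q a \<and> R\<^sup>*\<^sup>* (counter_config w (k + \<omega> a) (\<delta> q a)) ([], z, s)"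
    unfolding s by blast
  also have "\<dots> \<longleftrightarrow> reads_allowed P \<delta> q (a # w) \<and>
      z = counter_stack (k + (\<Sum>a\<leftarrow>a # w. \<omega> a)) \<and>
      s = with_flag (foldl \<delta> q (a # w)) (k + (\<Sum>a\<leftarrow>a # w. \<omega> a) = 0)"
    using Cons.prems a by (subst Cons.IH) (auto simp: add.assoc)
  finally show ?case .
qed

lemma dpda_language_counter:
  fixes n :: nat and \<omega> :: "'a \<Rightarrow> int"
  assumes "finite A" "d < n" "F \<subseteq> {..<n}" "\<And>q a. q < n \<Longrightarrow> a \<in> A \<Longrightarrow> \<delta> q a < n"
    and \<omega>: "\<And>a. \<omega> a \<in> {- 1, 0, 1}"
  shows "dpda_language A {w \<in> lists A. foldl \<delta> d w \<in> F \<and> (\<Sum>a\<leftarrow>w. \<omega> a) = 0}"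
proof -
  define M :: "('a, nat, nat) dpda" where
    "M = \<lparr>states = {..<2 * n}, inputs = A, stack_syms = {..<5}, delta = counter_delta A n \<delta> \<omega>,
      start = with_flag d True, start_sym = 0, finals = (\<lambda>q. with_flag q True) ` F\<rparr>"
  have "is_dpda M" by (rule is_dpda_counter[OF assms(1-4)]) (simp_all add: M_def)
  moreover have "final_state_language M = {w \<in> lists A. foldl \<delta> d w \<in> F \<and> (\<Sum>a\<leftarrow>w. \<omega> a) = 0}"
  proof -
    have "(\<exists>z. \<exists>s \<in> finals M. (dpda_step M)\<^sup>*\<^sup>* (w, [start_sym M], start M) ([], z, s)) \<longleftrightarrow>
      foldl \<delta> d w \<in> F \<and> (\<Sum>a\<leftarrow>w. \<omega> a) = 0" if w: "w \<in> lists A" for w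
    proof -
      have allowed: "reads_allowed (\<lambda>_ _. True) \<delta> q w" for q by (induction w arbitrary: q) auto
      have step: "dpda_step M (counter_config w k q) c \<longleftrightarrow> (\<exists>a v. w = a # v \<and> a \<in> A \<and>
        True \<and> c = counter_config v (k + \<omega> a) (\<delta> q a))" if "q < n" for w k q c
        using counter_step_iff[OF that \<omega>, of M A \<delta>] by (simp add: M_def)
      have start: "(w, [start_sym M], start M) = counter_config w 0 d"
        by (simp add: M_def counter_config_def)
      have "(dpda_step M)\<^sup>*\<^sup>* (counter_config w 0 d) ([], z, s) \<longleftrightarrow>
        z = counter_stack (\<Sum>a\<leftarrow>w. \<omega> a) \<and> s = with_flag (foldl \<delta> d w) ((\<Sum>a\<leftarrow>w. \<omega> a) = 0)" for z s
        using counter_run_iff[of n "dpda_step M" A "\<lambda>_ _. True" \<omega> \<delta> d w 0, OF step assms(4,2) w]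
        by (simp add: allowed)
      then show ?thesis unfolding start by (auto simp: M_def)
    qed
    then show ?thesis unfolding final_state_language_def by (auto simp: M_def)
  qed
  ultimately show ?thesis unfolding dpda_language_def by (auto intro!: exI[of _ M] simp: M_def)
qed

section \<open>Two-tape machines\<close>

text \<open>The two-tape machines built here read the whole first tape before the second one.\<close>

definition tape_phase :: "(nat \<Rightarrow> 'a tape_letter \<Rightarrow> nat) \<Rightarrow> nat \<Rightarrow> 'a tape_letter \<Rightarrow> nat" where
  "tape_phase \<delta> q x = with_flag (\<delta> (q div 2) x) (odd q \<or> x = Inl Endmark)"

text \<open>The parity of a control state is the phase kept by \<open>tape_phase\<close>: even until
  the endmark of the first tape has been read, odd from then on.\<close>

definition tape_allowed :: "nat \<Rightarrow> 'a tape_letter \<Rightarrow> bool" where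
  "tape_allowed q x \<longleftrightarrow> (even q \<longleftrightarrow> isl x)"

lemma odd_with_flag [simp]: "odd (with_flag q z) \<longleftrightarrow> z" "even (with_flag q z) \<longleftrightarrow> \<not> z"
  unfolding with_flag_def by auto

lemma reads_allowed_second:
  "reads_allowed tape_allowed (tape_phase \<delta>) (with_flag q True) (map Inr v)"
  by (induction v arbitrary: q) (auto simp: tape_allowed_def tape_phase_def)

text \<open>In the even phase only letters of the first tape may be read, and the phase changes only
  at its endmark. So the first tape has to be exhausted before the second one is touched.\<close>

lemma reads_allowed_shuffle:
  assumes "w \<in> shuffles (map Inl (end_marked u)) (map Inr v)"
    "reads_allowed tape_allowed (tape_phase \<delta>) (with_flag q False) w"
  shows "w = map Inl (end_marked u) @ map Inr v"
  using assms
proof (induction u arbitrary: q w)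
  case Nil
  then obtain x w' where w: "w = x # w'" by (cases w) (auto simp: end_marked_def)
  with Nil have "isl x" by (auto simp: tape_allowed_def)
  with w Nil have "x = Inl Endmark" "w' \<in> shuffles [] (map Inr v)"
    by (auto simp: end_marked_def Cons_in_shuffles_iff hd_map)
  with w show ?case by (simp add: end_marked_def)
next
  case (Cons a u)
  then obtain x w' where w: "w = x # w'" by (cases w) (auto simp: end_marked_def)
  with Cons have "isl x" by (auto simp: tape_allowed_def)
  with w Cons.prems have *: "x = Inl (Letter a)" "w' \<in> shuffles (map Inl (end_marked u)) (map Inr v)"
    by (auto simp: end_marked_def Cons_in_shuffles_iff hd_map)
  moreover have "reads_allowed tape_allowed (tape_phase \<delta>) (with_flag (\<delta> q x) False) w'"
    using Cons.prems(2) w * by (simp add: tape_phase_def[of \<delta> "with_flag q False"])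
  ultimately show ?case using Cons.IH w by (simp add: end_marked_def)
qed

lemma reads_allowed_tapes:
  "reads_allowed tape_allowed (tape_phase \<delta>) (with_flag q False) (map Inl (end_marked u) @ map Inr v)"
  by (induction u arbitrary: q)
    (auto simp: end_marked_def tape_allowed_def tape_phase_def reads_allowed_second)

lemma foldl_tape_phase_second:
  "foldl (tape_phase \<delta>) (with_flag q True) w = with_flag (foldl \<delta> q w) True"
  by (induction w arbitrary: q) (auto simp: tape_phase_def)

lemma foldl_tape_phase:
  "foldl (tape_phase \<delta>) (with_flag q False) (map Inl (end_marked u) @ w) =
     with_flag (foldl \<delta> q (map Inl (end_marked u) @ w)) True"
  by (induction u arbitrary: q)
    (auto simp: end_marked_def tape_phase_def foldl_tape_phase_second simp del: foldl_append)

lemma append_in_shuffles: "xs @ ys \<in> shuffles xs ys"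
  by (induction xs) (auto simp: Cons_in_shuffles_leftI)

lemma Collect_pairs_cong:
  assumes "\<And>u v. u \<in> lists A \<Longrightarrow> v \<in> lists A \<Longrightarrow> P u v \<longleftrightarrow> Q u v"
  shows "{(u, v) \<in> lists A \<times> lists A. P u v} = {(u, v) \<in> lists A \<times> lists A. Q u v}"
  using assms by blast

text \<open>The tape discipline permits only one shuffle, the concatenation, so the existential
  quantifier over shuffles disappears. The zero weight gives regular conditions, a constant
  transition function gives linear ones.\<close>

lemma two_tape_language_counter:
  fixes n :: nat and \<omega> :: "'a tape_letter \<Rightarrow> int"
  assumes "finite A" "d < n" "F \<subseteq> {..<n}"
    and \<delta>: "\<And>q a. q < n \<Longrightarrow> a \<in> Sum_Type.Plus (marked_set A) (marked_set A) \<Longrightarrow> \<delta> q a < n"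
    and \<omega>: "\<And>a. \<omega> a \<in> {- 1, 0, 1}"
  shows "two_tape_language A {(u, v) \<in> lists A \<times> lists A.
    foldl \<delta> d (map Inl (end_marked u) @ map Inr (end_marked v)) \<in> F \<and>
    (\<Sum>a\<leftarrow>map Inl (end_marked u) @ map Inr (end_marked v). \<omega> a) = 0}" (is "two_tape_language _ ?R")
proof -
  let ?A = "Sum_Type.Plus (marked_set A) (marked_set A)"
  define F' where "F' = (\<lambda>q. with_flag q True) ` F"
  \<comment> \<open>Two bits are put on top of the \<open>n\<close> control states: the inner flag
    is the phase, the outer one the zero test. Hence \<open>s div 2\<close> decides between sharp
    and flat states.\<close>
  define T :: "('a, nat, nat) two_tape_pda" where
    "T = \<lparr>states = {..<2 * (2 * n)}, inputs = ?A, stack_syms = {..<5},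
      delta = counter_delta ?A (2 * n) (tape_phase \<delta>) \<omega>,
      start = with_flag (with_flag d False) True, start_sym = 0, finals = (\<lambda>q. with_flag q True) ` F',
      sharp_states = {s. s < 2 * (2 * n) \<and> even (s div 2)},
      flat_states = {s. s < 2 * (2 * n) \<and> odd (s div 2)}\<rparr>"
  have \<delta>': "tape_phase \<delta> q a < 2 * n" if "q < 2 * n" "a \<in> ?A" for q a
  proof -
    have "q div 2 < n" using that(1) by arith
    then show ?thesis using that \<delta>[of "q div 2" a] by (simp add: tape_phase_def)
  qed
  have d: "with_flag d False < 2 * n" using assms(2) by simp
  have "finite ?A" using assms(1) by (simp add: marked_set_def)
  moreover have "F' \<subseteq> {..<2 * n}" using assms(3) by (auto simp: F'_def)
  ultimately have "is_dpda T"
    by (rule is_dpda_counter[OF _ d _ \<delta>']) (simp_all add: T_def)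
  then have T: "is_two_tape_pda A T" unfolding is_two_tape_pda_def by (auto simp: T_def)
  have start: "(w, [start_sym T], start T) = counter_config w 0 (with_flag d False)"
    for w :: "'a tape_letter list"
    by (simp add: T_def counter_config_def)
  have step: "two_tape_step T (counter_config w k q) c \<longleftrightarrow> (\<exists>a v. w = a # v \<and> a \<in> ?A \<and>
    tape_allowed q a \<and> c = counter_config v (k + \<omega> a) (tape_phase \<delta> q a))" if "q < 2 * n" for w k q c
  proof -
    have "delta T = counter_delta ?A (2 * n) (tape_phase \<delta>) \<omega>" by (simp add: T_def)
    note st = counter_step_iff[OF that \<omega> this, of w k c]
    have "(\<forall>x. a = Inl x \<longrightarrow> even q) \<and> (\<forall>x. a = Inr x \<longrightarrow> odd q) \<longleftrightarrow> tape_allowed q a"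
      for a :: "'a tape_letter" by (cases a) (auto simp: tape_allowed_def)
    moreover have "with_flag q z < 4 * n" for z using that unfolding with_flag_def by (cases z) auto
    then have "snd (snd (counter_config w k q)) \<in> sharp_states T \<longleftrightarrow> even q"
      "snd (snd (counter_config w k q)) \<in> flat_states T \<longleftrightarrow> odd q"
      using that by (simp_all add: counter_config_def T_def)
    moreover have "fst (counter_config w k q) = w" "fst (counter_config v l p) = v"
      for v :: "'a tape_letter list" and l p by (simp_all add: counter_config_def)
    ultimately show ?thesis unfolding two_tape_step_def st by auto
  qed
  have run: "(two_tape_step T)\<^sup>*\<^sup>* (counter_config w 0 (with_flag d False)) ([], z, s) \<longleftrightarrow>
    reads_allowed tape_allowed (tape_phase \<delta>) (with_flag d False) w \<and>
    z = counter_stack (\<Sum>a\<leftarrow>w. \<omega> a) \<and>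
    s = with_flag (foldl (tape_phase \<delta>) (with_flag d False) w) ((\<Sum>a\<leftarrow>w. \<omega> a) = 0)"
    if "w \<in> lists ?A" for w z s
    using counter_run_iff[of "2 * n" "two_tape_step T" ?A tape_allowed \<omega> "tape_phase \<delta>", OF step \<delta>' d that, of 0]
    by simp
  have shuf: "w \<in> lists ?A" if "u \<in> lists A" "v \<in> lists A" "w \<in> tape_shuffles u v" for u v w
  proof -
    have "set w = set (map Inl (end_marked u)) \<union> set (map Inr (end_marked v))"
      using that(3) unfolding tape_shuffles_def by (rule set_shuffles)
    then show ?thesis using that by (auto simp: end_marked_def marked_set_def)
  qed
  have "two_tape_final_state_language A T = ?R"
  proof -
    have acc: "(\<exists>w \<in> tape_shuffles u v. \<exists>z. \<exists>s \<in> finals T.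
        (two_tape_step T)\<^sup>*\<^sup>* (w, [start_sym T], start T) ([], z, s)) \<longleftrightarrow>
      foldl \<delta> d (map Inl (end_marked u) @ map Inr (end_marked v)) \<in> F \<and>
      (\<Sum>a\<leftarrow>map Inl (end_marked u) @ map Inr (end_marked v). \<omega> a) = 0"
      if uv: "u \<in> lists A" "v \<in> lists A" for u v
    proof -
      let ?w = "map Inl (end_marked u) @ map Inr (end_marked v)"
      let ?fin = "\<lambda>w. with_flag (foldl (tape_phase \<delta>) (with_flag d False) w) ((\<Sum>a\<leftarrow>w. \<omega> a) = 0) \<in> finals T"
      have acc: "(\<exists>z. \<exists>s \<in> finals T.
          (two_tape_step T)\<^sup>*\<^sup>* (w, [start_sym T], start T) ([], z, s)) \<longleftrightarrow>
        reads_allowed tape_allowed (tape_phase \<delta>) (with_flag d False) w \<and> ?fin w"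
        if "w \<in> tape_shuffles u v" for w
        unfolding start run[OF shuf[OF uv that]] by blast
      have allowed: "reads_allowed tape_allowed (tape_phase \<delta>) (with_flag d False) w \<longleftrightarrow> w = ?w"
        if "w \<in> tape_shuffles u v" for w
        using reads_allowed_shuffle[OF that[unfolded tape_shuffles_def]] reads_allowed_tapes by metis
      have mem: "?w \<in> tape_shuffles u v" unfolding tape_shuffles_def by (rule append_in_shuffles)
      have "(\<exists>w \<in> tape_shuffles u v. \<exists>z. \<exists>s \<in> finals T.
          (two_tape_step T)\<^sup>*\<^sup>* (w, [start_sym T], start T) ([], z, s)) \<longleftrightarrow>
        (\<exists>w \<in> tape_shuffles u v. w = ?w \<and> ?fin w)"
        using acc allowed by (intro bex_cong) simp_all
      also have "\<dots> \<longleftrightarrow> ?fin ?w" using mem by blast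
      also have "\<dots> \<longleftrightarrow> foldl \<delta> d ?w \<in> F \<and> (\<Sum>a\<leftarrow>?w. \<omega> a) = 0"
        unfolding foldl_tape_phase by (auto simp: T_def F'_def)
      finally show ?thesis .
    qed
    show ?thesis unfolding two_tape_final_state_language_def by (rule Collect_pairs_cong[OF acc])
  qed
  from this[symmetric] show ?thesis
    unfolding two_tape_language_def by (intro exI[of _ T] conjI disjI1 T)
qed

section \<open>Normal forms in the unitriangular group\<close>

text \<open>\<open>a div 2\<close> is the position of a generator, shared by a letter and its
  inverse. A normal word repeats one of these two letters and then moves on to a later
  position.\<close>

definition pair_less :: "nat \<Rightarrow> nat \<Rightarrow> bool" where
  "pair_less a b \<longleftrightarrow> a = b \<or> a div 2 < b div 2"

definition normal_words :: "nat set \<Rightarrow> nat list set" where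
  "normal_words A = {w \<in> lists A. successively pair_less w}"

text \<open>Transitivity of \<open>pair_less\<close> turns the condition on neighbours, which finite
  control can check, into a global one under which letter counts determine the word.\<close>

lemma successively_pair_less_iff:
  "successively pair_less w \<longleftrightarrow>
     sorted w \<and> (\<forall>a \<in> set w. \<forall>b \<in> set w. a div 2 = b div 2 \<longrightarrow> a = b)"
proof -
  have "transp pair_less" by (auto intro!: transpI simp: pair_less_def)
  then have "successively pair_less w \<longleftrightarrow> sorted_wrt pair_less w"
    by (rule successively_conv_sorted_wrt)
  also have "\<dots> \<longleftrightarrow> sorted w \<and> (\<forall>a \<in> set w. \<forall>b \<in> set w. a div 2 = b div 2 \<longrightarrow> a = b)"
  proof (induction w)
    case (Cons a w)
    have "pair_less a b \<longleftrightarrow> a \<le> b \<and> (a div 2 = b div 2 \<longrightarrow> a = b)" for b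
    proof -
      have "a \<le> b" if "a div 2 < b div 2" using that div_le_mono[of b a 2] by linarith
      moreover have "a div 2 \<le> b div 2" if "a \<le> b" using that by (rule div_le_mono)
      ultimately show ?thesis unfolding pair_less_def by force
    qed
    then have "(\<forall>b \<in> set w. pair_less a b) \<longleftrightarrow>
        (\<forall>b \<in> set w. a \<le> b) \<and> (\<forall>b \<in> set w. a div 2 = b div 2 \<longrightarrow> a = b)"
      by blast
    moreover have "(\<forall>x \<in> set (a # w). \<forall>b \<in> set (a # w). x div 2 = b div 2 \<longrightarrow> x = b) \<longleftrightarrow>
        (\<forall>b \<in> set w. a div 2 = b div 2 \<longrightarrow> a = b) \<and>
        (\<forall>x \<in> set w. \<forall>b \<in> set w. x div 2 = b div 2 \<longrightarrow> x = b)"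
      unfolding list.set by (metis insert_iff)
    ultimately show ?case using Cons unfolding sorted_wrt.simps by argo
  qed simp
  finally show ?thesis .
qed

text \<open>State \<open>0\<close> is initial, state \<open>1\<close> is the dead state, state \<open>a + 2\<close> records the last letter \<open>a\<close>.\<close>

definition normal_step :: "nat \<Rightarrow> nat \<Rightarrow> nat" where
  "normal_step q a = (if q = 0 \<or> q \<noteq> 1 \<and> pair_less (q - 2) a then a + 2 else 1)"

lemma normal_step_dead: "foldl normal_step 1 w = 1"
  by (induction w) (auto simp: normal_step_def)

lemma normal_step_run: "foldl normal_step (b + 2) w \<noteq> 1 \<longleftrightarrow> successively pair_less (b # w)"
proof (induction w arbitrary: b)
  case (Cons a w)
  have "normal_step (b + 2) a = (if pair_less b a then a + 2 else 1)" by (simp add: normal_step_def)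
  then show ?case using Cons normal_step_dead by (simp del: add_2_eq_Suc')
qed simp

lemma normal_step_start: "foldl normal_step 0 w \<noteq> 1 \<longleftrightarrow> successively pair_less w"
proof (cases w)
  case (Cons a v)
  have "normal_step 0 a = a + 2" by (simp add: normal_step_def)
  then show ?thesis using Cons normal_step_run[of a v] by (simp del: add_2_eq_Suc')
qed simp

lemma foldl_less:
  fixes n :: nat
  shows "(\<And>q a. q < n \<Longrightarrow> a \<in> A \<Longrightarrow> \<delta> q a < n) \<Longrightarrow> q < n \<Longrightarrow> w \<in> lists A \<Longrightarrow> foldl \<delta> q w < n"
  by (induction w arbitrary: q) auto

lemma normal_step_bound:
  assumes "finite A"
  obtains n where "0 < n" "\<And>q a. a \<in> A \<Longrightarrow> normal_step q a < n" "1 < n"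
proof -
  obtain m where "\<And>a. a \<in> A \<Longrightarrow> a < m"
    using assms by (metis finite_nat_set_iff_bounded)
  then show ?thesis by (intro that[of "m + 2"]) (auto simp: normal_step_def)
qed

lemma dpda_language_normal_words:
  assumes "finite A"
  shows "dpda_language A (normal_words A)"
proof -
  obtain n where n: "0 < n" "\<And>q a. a \<in> A \<Longrightarrow> normal_step q a < n" "1 < n"
    using normal_step_bound[OF assms] by blast
  have "foldl normal_step 0 w \<in> {..<n} - {1} \<longleftrightarrow> successively pair_less w" if "w \<in> lists A" for w
    using foldl_less[of n A normal_step 0 w] n that normal_step_start by auto
  then have "normal_words A =
      {w \<in> lists A. foldl normal_step 0 w \<in> {..<n} - {1} \<and> (\<Sum>a\<leftarrow>w. (\<lambda>_. 0 :: int) a) = 0}"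
    unfolding normal_words_def by auto
  then show ?thesis
    using dpda_language_counter[OF assms n(1), of "{..<n} - {1}" normal_step "\<lambda>_. 0"] n(2) by auto
qed

section \<open>Regular and linear conditions on pairs of words\<close>

fun on_first :: "('q \<Rightarrow> 'a \<Rightarrow> 'q) \<Rightarrow> 'q \<Rightarrow> 'a tape_letter \<Rightarrow> 'q" where
  "on_first \<delta> q (Inl (Letter a)) = \<delta> q a"
| "on_first \<delta> q _ = q"

fun on_second :: "('q \<Rightarrow> 'a \<Rightarrow> 'q) \<Rightarrow> 'q \<Rightarrow> 'a tape_letter \<Rightarrow> 'q" where
  "on_second \<delta> q (Inr (Letter a)) = \<delta> q a"
| "on_second \<delta> q _ = q"

lemma foldl_on_first:
  "foldl (on_first \<delta>) q (map Inl (end_marked u) @ map Inr (end_marked v)) = foldl \<delta> q u"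
proof -
  have "foldl (on_first \<delta>) q (map Inr v) = q" for v q by (induction v) auto
  moreover have "foldl (on_first \<delta>) q (map Inl (end_marked u)) = foldl \<delta> q u" for q
    by (induction u arbitrary: q) (auto simp: end_marked_def)
  ultimately show ?thesis by simp
qed

lemma foldl_on_second:
  "foldl (on_second \<delta>) q (map Inl (end_marked u) @ map Inr (end_marked v)) = foldl \<delta> q v"
proof -
  have "foldl (on_second \<delta>) q (map Inl u) = q" for u q by (induction u) auto
  moreover have "foldl (on_second \<delta>) q (map Inr (end_marked v)) = foldl \<delta> q v" for q
    by (induction v arbitrary: q) (auto simp: end_marked_def)
  ultimately show ?thesis by simp
qed

lemma two_tape_language_normal_words:
  assumes "finite A"
  shows "two_tape_language A {(u, v) \<in> lists A \<times> lists A. u \<in> normal_words A}"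
    and "two_tape_language A {(u, v) \<in> lists A \<times> lists A. v \<in> normal_words A}"
proof -
  obtain n where n: "0 < n" "\<And>q a. a \<in> A \<Longrightarrow> normal_step q a < n" "1 < n"
    using normal_step_bound[OF assms] by blast
  have w: "foldl normal_step 0 w \<in> {..<n} - {1} \<longleftrightarrow> w \<in> normal_words A" if "w \<in> lists A" for w
    using foldl_less[of n A normal_step 0 w] n that normal_step_start by (auto simp: normal_words_def)
  have "on_first normal_step q a < n" "on_second normal_step q a < n"
    if "q < n" "a \<in> Sum_Type.Plus (marked_set A) (marked_set A)" for q a
    using that n by (auto simp: marked_set_def)
  then have "two_tape_language A {(u, v) \<in> lists A \<times> lists A. foldl normal_step 0 u \<in> {..<n} - {1}}"
    "two_tape_language A {(u, v) \<in> lists A \<times> lists A. foldl normal_step 0 v \<in> {..<n} - {1}}"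
    using two_tape_language_counter[OF assms n(1), of "{..<n} - {1}" "on_first normal_step" "\<lambda>_. 0"]
      two_tape_language_counter[OF assms n(1), of "{..<n} - {1}" "on_second normal_step" "\<lambda>_. 0"]
    unfolding foldl_on_first foldl_on_second by (simp_all add: o_def)
  then show "two_tape_language A {(u, v) \<in> lists A \<times> lists A. u \<in> normal_words A}"
    "two_tape_language A {(u, v) \<in> lists A \<times> lists A. v \<in> normal_words A}"
    using Collect_pairs_cong[of A "\<lambda>u v. foldl normal_step 0 u \<in> {..<n} - {1}" "\<lambda>u v. u \<in> normal_words A"]
      Collect_pairs_cong[of A "\<lambda>u v. foldl normal_step 0 v \<in> {..<n} - {1}" "\<lambda>u v. v \<in> normal_words A"] w
    by simp_all
qed

text \<open>The counter adds \<alpha> along the first tape and subtracts \<beta> along the second.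
  The constant \<open>c\<close> is added when the endmark of the first tape is read, which explains
  its bound.\<close>

lemma two_tape_language_linear:
  fixes \<alpha> \<beta> :: "'a \<Rightarrow> int"
  assumes "finite A" "\<And>a. \<alpha> a \<in> {- 1, 0, 1}" "\<And>a. \<beta> a \<in> {- 1, 0, 1}" "c \<in> {- 1, 0, 1}"
  shows "two_tape_language A
    {(u, v) \<in> lists A \<times> lists A. (\<Sum>a\<leftarrow>u. \<alpha> a) + c = (\<Sum>a\<leftarrow>v. \<beta> a)}"
proof -
  define \<omega> where "\<omega> = case_sum (case_marked \<alpha> c) (case_marked (\<lambda>a. - \<beta> a) 0)"
  have \<omega>: "\<omega> a \<in> {- 1, 0, 1}" for a
    using assms(2-4) by (cases a) (auto simp: \<omega>_def split: marked.splits)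
  have foldl0: "foldl (\<lambda>_ _. 0 :: nat) 0 w = 0" for w :: "'a tape_letter list" by (induction w) auto
  have "(\<Sum>a\<leftarrow>map Inl (end_marked u) @ map Inr (end_marked v). \<omega> a) =
      (\<Sum>a\<leftarrow>u. \<alpha> a) + c - (\<Sum>a\<leftarrow>v. \<beta> a)" for u v
    by (simp add: \<omega>_def end_marked_def o_def uminus_sum_list_map)
  then show ?thesis
    using two_tape_language_counter[OF assms(1), of 0 1 "{0}" "\<lambda>_ _. 0" \<omega>] \<omega> foldl0
    by simp
qed

section \<open>Unitriangular matrices and transvections\<close>

abbreviation U :: "nat \<Rightarrow> int mat set" where
  "U n \<equiv> carrier (unitriangular_group n)"

lemma U_iff:
  "M \<in> U n \<longleftrightarrow> M \<in> carrier_mat n n \<and> (\<forall>k<n. \<forall>l<k. M $$ (k, l) = 0) \<and> (\<forall>k<n. M $$ (k, k) = 1)"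
  by (auto simp: unitriangular_group_def)

lemma unitriangular_group_simps [simp]:
  "M \<otimes>\<^bsub>unitriangular_group n\<^esub> N = M * N" "\<one>\<^bsub>unitriangular_group n\<^esub> = 1\<^sub>m n"
  by (simp_all add: unitriangular_group_def)

lemma U_carrier: "M \<in> U n \<Longrightarrow> M \<in> carrier_mat n n"
  by (simp add: U_iff)

lemma mult_mat_entry:
  "M \<in> carrier_mat n n \<Longrightarrow> N \<in> carrier_mat n n \<Longrightarrow> k < n \<Longrightarrow> l < n \<Longrightarrow>
    (M * N) $$ (k, l) = (\<Sum>m<n. M $$ (k, m) * N $$ (m, l))"
  by (simp add: scalar_prod_def lessThan_atLeast0)

lemma U_mult_closed:
  assumes "M \<in> U n" "N \<in> U n"
  shows "M * N \<in> U n"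
proof -
  have M: "M \<in> carrier_mat n n" and N: "N \<in> carrier_mat n n" using assms U_carrier by auto
  have zero: "M $$ (k, m) * N $$ (m, l) = 0" if "k < n" "l < n" "m < n" "l \<le> k" "m \<noteq> k \<or> l \<noteq> k" for k l m
    using that assms unfolding U_iff by (cases "m < k") auto
  have "(M * N) $$ (k, l) = 0" if "k < n" "l < k" for k l
    using that zero by (subst mult_mat_entry[OF M N]) (auto intro!: sum.neutral)
  moreover have "(M * N) $$ (k, k) = 1" if "k < n" for k
  proof -
    have "(\<Sum>m<n. M $$ (k, m) * N $$ (m, k)) = (\<Sum>m\<in>{k}. M $$ (k, m) * N $$ (m, k))"
      using that zero by (intro sum.mono_neutral_right) auto
    then show ?thesis using that assms by (simp add: mult_mat_entry[OF M N] U_iff)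
  qed
  ultimately show ?thesis using M N unfolding U_iff by auto
qed

lemma one_in_U: "1\<^sub>m n \<in> U n"
  by (auto simp: U_iff)

lemma monoid_unitriangular: "monoid (unitriangular_group n)"
  by (rule monoidI)
    (simp_all add: U_mult_closed one_in_U assoc_mult_mat[OF U_carrier U_carrier U_carrier]
      left_mult_one_mat[OF U_carrier] right_mult_one_mat[OF U_carrier])

definition transvection :: "nat \<Rightarrow> nat \<Rightarrow> nat \<Rightarrow> int \<Rightarrow> int mat" where
  "transvection n i j c = mat n n (\<lambda>(k, l). if k = l then 1 else if k = i \<and> l = j then c else 0)"

lemma transvection_carrier [simp]: "transvection n i j c \<in> carrier_mat n n"
  by (simp add: transvection_def)

lemma transvection_in_U: "i < j \<Longrightarrow> transvection n i j c \<in> U n"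
  by (auto simp: U_iff transvection_def)

lemma transvection_mult:
  assumes "M \<in> carrier_mat n n" "i \<noteq> j" "j < n" "k < n" "l < n"
  shows "(transvection n i j c * M) $$ (k, l) = M $$ (k, l) + (if k = i then c * M $$ (j, l) else 0)"
proof -
  have "(transvection n i j c * M) $$ (k, l) = (\<Sum>m<n. transvection n i j c $$ (k, m) * M $$ (m, l))"
    using assms by (intro mult_mat_entry) auto
  also have "\<dots> = (\<Sum>m<n. (if m = k then M $$ (k, l) else 0) + (if m = j then if k = i then c * M $$ (j, l) else 0 else 0))"
    using assms by (intro sum.cong) (auto simp: transvection_def)
  also have "\<dots> = M $$ (k, l) + (if k = i then c * M $$ (j, l) else 0)"
    using assms by (simp add: sum.distrib)
  finally show ?thesis .
qed

lemma mult_transvection: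
  assumes "M \<in> carrier_mat n n" "i \<noteq> j" "i < n" "k < n" "l < n"
  shows "(M * transvection n i j c) $$ (k, l) = M $$ (k, l) + (if l = j then M $$ (k, i) * c else 0)"
proof -
  have "(M * transvection n i j c) $$ (k, l) = (\<Sum>m<n. M $$ (k, m) * transvection n i j c $$ (m, l))"
    using assms by (intro mult_mat_entry) auto
  also have "\<dots> = (\<Sum>m<n. (if m = l then M $$ (k, l) else 0) + (if m = i then if l = j then M $$ (k, i) * c else 0 else 0))"
    using assms by (intro sum.cong) (auto simp: transvection_def)
  also have "\<dots> = M $$ (k, l) + (if l = j then M $$ (k, i) * c else 0)"
    using assms by (simp add: sum.distrib)
  finally show ?thesis .
qed

lemma transvection_inverse:
  assumes "i \<noteq> j" "j < n"
  shows "transvection n i j (- c) * transvection n i j c = 1\<^sub>m n"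
proof (rule eq_matI)
  fix k l assume "k < dim_row (1\<^sub>m n :: int mat)" "l < dim_col (1\<^sub>m n :: int mat)"
  then have "k < n" "l < n" by auto
  then show "(transvection n i j (- c) * transvection n i j c) $$ (k, l) = 1\<^sub>m n $$ (k, l)"
    using assms by (subst transvection_mult) (auto simp: transvection_def)
qed (auto simp: transvection_def)

section \<open>Letters, their positions and exponent sums\<close>

text \<open>The letters \<open>2 p\<close> and \<open>2 p + 1\<close> stand for a transvection and its inverse. The positions are
  numbered by \<open>p\<close> from the last row to the first, so that in the product along a normal word a row
  operation only ever adds a row that is still a row of the identity matrix.\<close>

definition letter_row :: "nat \<Rightarrow> nat \<Rightarrow> nat" where
  "letter_row n a = n - 1 - a div 2 div n"

definition letter_col :: "nat \<Rightarrow> nat \<Rightarrow> nat" where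
  "letter_col n a = a div 2 mod n"

definition letter_sign :: "nat \<Rightarrow> int" where
  "letter_sign a = (if even a then 1 else - 1)"

definition letters :: "nat \<Rightarrow> nat set" where
  "letters n = {a. a < 2 * (n * n) \<and> letter_row n a < letter_col n a}"

definition letter_mat :: "nat \<Rightarrow> nat \<Rightarrow> int mat" where
  "letter_mat n a = transvection n (letter_row n a) (letter_col n a) (letter_sign a)"

text \<open>Summed along a word it gives the exponent sum of the transvection at
  \<open>(k, l)\<close>, in steps that a counter can follow.\<close>

definition letter_weight :: "nat \<Rightarrow> nat \<Rightarrow> nat \<Rightarrow> nat \<Rightarrow> int" where
  "letter_weight n k l a = (if letter_row n a = k \<and> letter_col n a = l then letter_sign a else 0)"

lemma finite_letters: "finite (letters n)"
  by (rule finite_subset[of _ "{..<2 * (n * n)}"]) (auto simp: letters_def)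

lemma letters_bounds:
  assumes "a \<in> letters n"
  shows "letter_row n a < letter_col n a" "letter_col n a < n" "letter_row n a < n"
proof -
  show *: "letter_row n a < letter_col n a" using assms by (simp add: letters_def)
  have "n > 0" using assms by (auto simp: letters_def intro: Nat.gr0I)
  then show "letter_col n a < n" by (simp add: letter_col_def)
  with * show "letter_row n a < n" by simp
qed

lemma letter_position_inj:
  assumes "a \<in> letters n" "b \<in> letters n" "letter_row n a = letter_row n b"
    "letter_col n a = letter_col n b"
  shows "a div 2 = b div 2"
proof -
  \<comment> \<open>Rows are numbered backwards by truncated subtraction from \<open>n - 1\<close>,
    which is injective only below \<open>n\<close>.\<close>
  have "c div 2 div n < n" if "c \<in> letters n" for c
  proof -
    have "c div 2 < n * n" using that by (auto simp: letters_def)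
    then show ?thesis by (simp add: less_mult_imp_div_less)
  qed
  from this[OF assms(1)] this[OF assms(2)] have "a div 2 div n = b div 2 div n"
    using assms(3) by (simp add: letter_row_def)
  with assms(4) show ?thesis unfolding letter_col_def by (metis div_mult_mod_eq)
qed

lemma letter_row_antimono: "a \<le> b \<Longrightarrow> letter_row n b \<le> letter_row n a"
  unfolding letter_row_def by (intro diff_le_mono2 div_le_mono)

text \<open>Inverse of the numbering: the letter of the transvection at \<open>(k, l)\<close>; its
  successor is the letter of the inverse.\<close>

definition letter_at :: "nat \<Rightarrow> nat \<Rightarrow> nat \<Rightarrow> nat" where
  "letter_at n k l = 2 * ((n - 1 - k) * n + l)"

lemma letter_at:
  assumes "k < l" "l < n" "s < 2"
  shows "letter_at n k l + s \<in> letters n" "letter_row n (letter_at n k l + s) = k"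
    "letter_col n (letter_at n k l + s) = l" "letter_sign (letter_at n k l + s) = (if s = 0 then 1 else - 1)"
proof -
  have d: "(letter_at n k l + s) div 2 = (n - 1 - k) * n + l" using assms(3) by (simp add: letter_at_def)
  have "((n - 1 - k) * n + l) div n = n - 1 - k" using assms by simp
  then show row: "letter_row n (letter_at n k l + s) = k"
    unfolding letter_row_def d using assms by simp
  show col: "letter_col n (letter_at n k l + s) = l"
    unfolding letter_col_def d using assms by simp
  have "(n - 1 - k) * n + l < (n - 1 - k) * n + n" using assms by simp
  also have "\<dots> = (n - k) * n"
  proof -
    have "n - k = Suc (n - 1 - k)" using assms by simp
    then show ?thesis by simp
  qed
  also have "\<dots> \<le> n * n" by simp
  finally have "letter_at n k l + s < 2 * (n * n)"
    using assms(3) by (simp add: letter_at_def)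
  then show "letter_at n k l + s \<in> letters n" unfolding letters_def using row col assms by simp
  show "letter_sign (letter_at n k l + s) = (if s = 0 then 1 else - 1)"
    using assms(3) by (auto simp: letter_sign_def letter_at_def less_2_cases_iff)
qed

lemma letter_mat_in_U: "a \<in> letters n \<Longrightarrow> letter_mat n a \<in> U n"
  unfolding letter_mat_def using letters_bounds by (intro transvection_in_U)

abbreviation mat_value :: "nat \<Rightarrow> nat list \<Rightarrow> int mat" where
  "mat_value n \<equiv> word_value (unitriangular_group n) (letter_mat n)"

lemma mat_value_simps [simp]:
  "mat_value n [] = 1\<^sub>m n" "mat_value n (a # w) = letter_mat n a * mat_value n w"
  by (simp_all add: word_value_def)

lemma mat_value_in_U: "w \<in> lists (letters n) \<Longrightarrow> mat_value n w \<in> U n"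
  by (induction w) (auto intro!: one_in_U U_mult_closed letter_mat_in_U)

lemma mat_value_append:
  assumes "v \<in> lists (letters n)"
  shows "u \<in> lists (letters n) \<Longrightarrow> mat_value n (u @ v) = mat_value n u * mat_value n v"
proof (induction u)
  case Nil
  then show ?case by (simp add: left_mult_one_mat[OF U_carrier[OF mat_value_in_U[OF assms]]])
next
  case (Cons a u)
  then show ?case using assms
    by (auto intro!: assoc_mult_mat[symmetric] U_carrier mat_value_in_U letter_mat_in_U)
qed

text \<open>Multiplying on the left by the first letter, at position (i, j), adds a multiple of row
  j to row i. The remaining letters are larger, so their rows are at most i < j, and row j of their
  product is still a row of the identity. Thus only the entry (i, j) changes.\<close>

lemma mat_value_sorted:
  assumes "w \<in> lists (letters n)" "sorted w" "k < n" "l < n"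
  shows "mat_value n w $$ (k, l) = (if k = l then 1 else \<Sum>a\<leftarrow>w. letter_weight n k l a)"
  using assms
proof (induction w arbitrary: k l)
  case (Cons a w)
  let ?i = "letter_row n a" and ?j = "letter_col n a"
  note a = letters_bounds[OF Cons.hyps(1)]
  have V: "mat_value n w \<in> carrier_mat n n" using Cons.hyps by (intro U_carrier mat_value_in_U) auto
  have IH: "mat_value n w $$ (k, l) = (if k = l then 1 else \<Sum>a\<leftarrow>w. letter_weight n k l a)"
    if "k < n" "l < n" for k l using Cons that by auto
  have "letter_weight n ?j l b = 0" if "b \<in> set w" for b
    using letter_row_antimono[of a b n] that Cons.prems(1) a by (auto simp: letter_weight_def)
  then have "(\<Sum>b\<leftarrow>w. letter_weight n ?j l b) = 0"
    by (simp cong: map_cong)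
  then have "mat_value n w $$ (?j, l) = (if ?j = l then 1 else 0)"
    using IH[of ?j l] a Cons.prems by simp
  moreover have "mat_value n (a # w) $$ (k, l) =
      mat_value n w $$ (k, l) + (if k = ?i then letter_sign a * mat_value n w $$ (?j, l) else 0)"
    using Cons.prems(2,3) a V
    unfolding mat_value_simps letter_mat_def[of n a] by (intro transvection_mult) auto
  ultimately show ?case
    using Cons.prems(2,3) a IH[of k l]
    by (auto simp: letter_weight_def simp del: mat_value_simps)
qed auto

lemma letter_weight_zero: "a \<in> letters n \<Longrightarrow> l \<le> k \<Longrightarrow> letter_weight n k l a = 0"
  using letters_bounds[of a n] by (auto simp: letter_weight_def)

lemma sum_letter_weight:
  assumes "w \<in> lists (letters n)" "k < l" "l < n"
  shows "(\<Sum>a\<leftarrow>w. letter_weight n k l a) =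
    int (count_list w (letter_at n k l)) - int (count_list w (letter_at n k l + 1))"
  using assms(1)
proof (induction w)
  case (Cons a w)
  let ?p = "letter_at n k l"
  note p0 = letter_at[OF assms(2,3), of 0] and p1 = letter_at[OF assms(2,3), of 1]
  have "letter_weight n k l a = (if a = ?p then 1 else if a = ?p + 1 then - 1 else 0)"
  proof (cases "letter_row n a = k \<and> letter_col n a = l")
    case True
    have "a div 2 = ?p div 2"
      using letter_position_inj[OF Cons.hyps(1), of ?p] p0 True by simp
    then have "a = ?p \<or> a = ?p + 1" unfolding letter_at_def by presburger
    then show ?thesis using True p0 p1 by (auto simp: letter_weight_def)
  next
    case False
    then show ?thesis using p0 p1 by (auto simp: letter_weight_def)
  qed
  then show ?case using Cons by auto
qed simp

section \<open>Existence and uniqueness of normal forms\<close>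

lemma mat_value_normal:
  assumes "w \<in> normal_words (letters n)" "k < n" "l < n"
  shows "mat_value n w $$ (k, l) = (if k = l then 1 else \<Sum>a\<leftarrow>w. letter_weight n k l a)"
  using assms mat_value_sorted[of w n k l] by (auto simp: normal_words_def successively_pair_less_iff)

lemma letter_eq_letter_at:
  assumes "a \<in> letters n"
  shows "a = letter_at n (letter_row n a) (letter_col n a) + a mod 2"
proof -
  note b = letters_bounds[OF assms]
  have "a div 2 = letter_at n (letter_row n a) (letter_col n a) div 2"
    using letter_position_inj[OF assms, of "letter_at n (letter_row n a) (letter_col n a)"]
      letter_at[OF b(1,2), of 0] by auto
  then show ?thesis unfolding letter_at_def by presburger
qed

text \<open>An exponent sum is the difference of the counts of a letter and its inverse. One of
  these counts is zero in a normal word, so the sums determine all counts, and a sorted word is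
  determined by its counts.\<close>

lemma normal_words_eqI:
  assumes "v \<in> normal_words (letters n)" "w \<in> normal_words (letters n)"
    "\<And>k l. k < l \<Longrightarrow> l < n \<Longrightarrow>
      (\<Sum>a\<leftarrow>v. letter_weight n k l a) = (\<Sum>a\<leftarrow>w. letter_weight n k l a)"
  shows "v = w"
proof -
  have L: "v \<in> lists (letters n)" "w \<in> lists (letters n)" "sorted v" "sorted w"
    using assms by (auto simp: normal_words_def successively_pair_less_iff)
  have excl: "count_list u (letter_at n k l) = 0 \<or> count_list u (letter_at n k l + 1) = 0"
    if "u \<in> normal_words (letters n)" for u k l
  proof (rule ccontr)
    assume "\<not> ?thesis"
    then have "letter_at n k l \<in> set u" "letter_at n k l + 1 \<in> set u"
      by (auto simp: count_list_0_iff)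
    moreover have "letter_at n k l div 2 = (letter_at n k l + 1) div 2" by (simp add: letter_at_def)
    ultimately show False
      using that unfolding normal_words_def successively_pair_less_iff by fastforce
  qed
  have "count_list v a = count_list w a" for a
  proof (cases "a \<in> letters n")
    case True
    let ?k = "letter_row n a" and ?l = "letter_col n a"
    note b = letters_bounds[OF True]
    have "count_list v (letter_at n ?k ?l) = count_list w (letter_at n ?k ?l)"
      "count_list v (letter_at n ?k ?l + 1) = count_list w (letter_at n ?k ?l + 1)"
      using excl[OF assms(1), of ?k ?l] excl[OF assms(2), of ?k ?l] assms(3)[OF b(1,2)]
      unfolding sum_letter_weight[OF L(1) b(1,2)] sum_letter_weight[OF L(2) b(1,2)] by auto
    moreover have "a = letter_at n ?k ?l \<or> a = letter_at n ?k ?l + 1"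
      using letter_eq_letter_at[OF True] by presburger
    ultimately show ?thesis by metis
  next
    case False
    then show ?thesis using L(1,2) by (metis count_notin in_lists_conv_set)
  qed
  then have "mset v = mset w" by (intro multiset_eqI) (simp add: count_mset)
  with L show ?thesis by (metis properties_for_sort)
qed

lemma U_eqI:
  assumes "M \<in> U n" "N \<in> U n" "\<And>k l. k < l \<Longrightarrow> l < n \<Longrightarrow> M $$ (k, l) = N $$ (k, l)"
  shows "M = N"
proof (rule eq_matI)
  fix k l assume "k < dim_row N" "l < dim_col N"
  then show "M $$ (k, l) = N $$ (k, l)"
    using assms unfolding U_iff by (cases k l rule: linorder_cases) auto
qed (use assms in \<open>auto simp: U_iff\<close>)

lemma normal_word_exists:
  assumes "M \<in> U n"
  obtains w where "w \<in> normal_words (letters n)" "mat_value n w = M"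
proof -
  \<comment> \<open>\<open>nat\<close> sends negative numbers to 0, so of the two letters at a
    position only the one with the sign of the matrix entry is used, as often as its absolute
    value.\<close>
  define c where "c a = (if a \<in> letters n
    then nat (letter_sign a * M $$ (letter_row n a, letter_col n a)) else 0)" for a
  define word where "word N = concat (map (\<lambda>a. replicate (c a) a) [0..<N])" for N
  have set_word: "set (word N) = {a. a < N \<and> c a > 0}" for N by (auto simp: word_def)
  have sorted: "sorted (word N)" for N
  proof (induction N)
    case (Suc N)
    then show ?case using set_word[of N] by (auto simp: word_def sorted_append)
  qed (simp add: word_def)
  have count: "count_list (word N) a = (if a < N then c a else 0)" for N a
  proof (induction N)
    case (Suc N)
    have "count_list (replicate m b) a = (if a = b then m else 0)" for m b by (induction m) auto
    then show ?case using Suc by (auto simp: word_def)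
  qed (simp add: word_def)
  define w where "w = word (2 * (n * n))"
  have L: "w \<in> lists (letters n)" unfolding w_def by (auto simp: set_word c_def split: if_splits)
  have "a = b" if "c a > 0" "c b > 0" "a div 2 = b div 2" for a b
  proof -
    have ab: "a \<in> letters n" "b \<in> letters n" using that by (auto simp: c_def split: if_splits)
    have "letter_row n a = letter_row n b" "letter_col n a = letter_col n b"
      using that(3) by (auto simp: letter_row_def letter_col_def)
    with that ab have "letter_sign a = letter_sign b" by (auto simp: c_def letter_sign_def split: if_splits)
    then have "even a \<longleftrightarrow> even b" by (auto simp: letter_sign_def split: if_splits)
    with that(3) show ?thesis by presburger
  qed
  with L sorted have w: "w \<in> normal_words (letters n)"
    unfolding normal_words_def successively_pair_less_iff by (auto simp: w_def set_word)
  have "mat_value n w = M"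
  proof (rule U_eqI[OF mat_value_in_U[OF L] assms])
    fix k l assume kl: "k < l" "l < n"
    note p = letter_at[OF kl, of 0] letter_at[OF kl, of 1]
    have "letter_at n k l < 2 * (n * n)" "letter_at n k l + 1 < 2 * (n * n)"
      using p(1,5) by (auto simp: letters_def)
    then have "(\<Sum>a\<leftarrow>w. letter_weight n k l a) = M $$ (k, l)"
      unfolding sum_letter_weight[OF L kl] unfolding w_def count using p by (auto simp: c_def)
    then show "mat_value n w $$ (k, l) = M $$ (k, l)"
      using mat_value_normal[OF w, of k l] kl by simp
  qed
  from that[OF w this] show ?thesis .
qed

lemma bij_betw_mat_value: "bij_betw (mat_value n) (normal_words (letters n)) (U n)"
proof (rule bij_betwI')
  fix v w assume vw: "v \<in> normal_words (letters n)" "w \<in> normal_words (letters n)"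
  show "mat_value n v = mat_value n w \<longleftrightarrow> v = w"
  proof
    assume eq: "mat_value n v = mat_value n w"
    have "(\<Sum>a\<leftarrow>v. letter_weight n k l a) = (\<Sum>a\<leftarrow>w. letter_weight n k l a)" if "k < l" "l < n" for k l
      using eq mat_value_normal[OF vw(1), of k l] mat_value_normal[OF vw(2), of k l] that by simp
    then show "v = w" by (rule normal_words_eqI[OF vw])
  qed simp
next
  fix w assume "w \<in> normal_words (letters n)"
  then show "mat_value n w \<in> U n" by (intro mat_value_in_U) (simp add: normal_words_def)
next
  fix M assume "M \<in> U n"
  then show "\<exists>w \<in> normal_words (letters n). M = mat_value n w" using normal_word_exists by metis
qed

text \<open>Every element is the value of a word, and a left inverse of that value is assembled
  letter by letter from inverse transvections; no matrix has to be inverted entrywise.\<close>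

lemma group_unitriangular: "group (unitriangular_group n)"
proof -
  interpret monoid "unitriangular_group n" by (rule monoid_unitriangular)
  have "\<exists>N \<in> U n. N * mat_value n w = 1\<^sub>m n" if "w \<in> lists (letters n)" for w
    using that
  proof (induction w)
    case Nil
    have "1\<^sub>m n * 1\<^sub>m n = (1\<^sub>m n :: int mat)" by simp
    then show ?case using one_in_U[of n] by (intro bexI[of _ "1\<^sub>m n"]) simp_all
  next
    case (Cons a w)
    then obtain N where N: "N \<in> U n" "N * mat_value n w = 1\<^sub>m n" by auto
    let ?T = "transvection n (letter_row n a) (letter_col n a) (- letter_sign a)"
    have a: "a \<in> letters n" "w \<in> lists (letters n)" using Cons.hyps by auto
    note b = letters_bounds[OF a(1)]
    have T: "?T \<in> U n" "letter_mat n a \<in> U n" using b letter_mat_in_U[OF a(1)] by (auto intro: transvection_in_U)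
    have "?T * letter_mat n a = 1\<^sub>m n"
      unfolding letter_mat_def using b by (intro transvection_inverse) auto
    moreover have V: "mat_value n w \<in> U n" using a(2) by (rule mat_value_in_U)
    note carr = U_carrier[OF T(1)] U_carrier[OF T(2)] U_carrier[OF V] U_carrier[OF N(1)]
    ultimately have "?T * (letter_mat n a * mat_value n w) = mat_value n w"
      by (simp add: left_mult_one_mat[OF carr(3)] flip: assoc_mult_mat[OF carr(1-3)])
    then have "N * ?T * mat_value n (a # w) = 1\<^sub>m n"
      using N(2) assoc_mult_mat[OF carr(4,1) mult_carrier_mat[OF carr(2,3)]] by simp
    then show ?case using N T U_mult_closed by blast
  qed
  then have "\<exists>N \<in> U n. N * M = 1\<^sub>m n" if "M \<in> U n" for M
    using normal_word_exists[OF that] unfolding normal_words_def by (metis (no_types, lifting) mem_Collect_eq)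
  then show ?thesis
    by (intro groupI) (auto simp: m_assoc[simplified] l_one[simplified] intro: U_mult_closed one_in_U)
qed

section \<open>Right multiplication by a letter\<close>

text \<open>With i and j the row and column of \<open>a\<close>, right multiplication adds plus or
  minus column i to column j. Above the diagonal entries are exponent sums; the diagonal 1 in column
  i contributes the constant at position (i, j).\<close>

lemma normal_words_multiplication:
  assumes "a \<in> letters n"
  shows "{(v, w) \<in> normal_words (letters n) \<times> normal_words (letters n).
      mat_value n w = mat_value n (v @ [a])} =
    {(v, w) \<in> lists (letters n) \<times> lists (letters n). v \<in> normal_words (letters n)} \<inter>
    {(v, w) \<in> lists (letters n) \<times> lists (letters n). w \<in> normal_words (letters n)} \<inter>
    (\<Inter>(k, l) \<in> {(k, l). k < l \<and> l < n}. {(v, w) \<in> lists (letters n) \<times> lists (letters n).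
      (\<Sum>b\<leftarrow>v. letter_weight n k l b + (if l = letter_col n a
          then letter_sign a * letter_weight n k (letter_row n a) b else 0)) +
        (if l = letter_col n a \<and> k = letter_row n a then letter_sign a else 0) =
      (\<Sum>b\<leftarrow>w. letter_weight n k l b)})" (is "?L = ?R")
proof -
  let ?i = "letter_row n a" and ?j = "letter_col n a"
  note b = letters_bounds[OF assms]
  have "mat_value n w = mat_value n (v @ [a]) \<longleftrightarrow>
    (\<forall>k l. k < l \<and> l < n \<longrightarrow>
      (\<Sum>b\<leftarrow>v. letter_weight n k l b + (if l = ?j then letter_sign a * letter_weight n k ?i b else 0)) +
        (if l = ?j \<and> k = ?i then letter_sign a else 0) = (\<Sum>b\<leftarrow>w. letter_weight n k l b))"
    if vw: "v \<in> normal_words (letters n)" "w \<in> normal_words (letters n)" for v w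
  proof -
    have L: "v \<in> lists (letters n)" "w \<in> lists (letters n)" "[a] \<in> lists (letters n)"
      "v @ [a] \<in> lists (letters n)"
      using vw assms by (auto simp: normal_words_def)
    have "mat_value n (v @ [a]) = mat_value n v * letter_mat n a"
      using mat_value_append[OF L(3,1)] right_mult_one_mat[OF U_carrier[OF letter_mat_in_U[OF assms]]]
      by simp
    then have va: "mat_value n (v @ [a]) $$ (k, l) =
      (\<Sum>b\<leftarrow>v. letter_weight n k l b + (if l = ?j then letter_sign a * letter_weight n k ?i b else 0)) +
        (if l = ?j \<and> k = ?i then letter_sign a else 0)" if "k < l" "l < n" for k l
    proof -
      assume eq: "mat_value n (v @ [a]) = mat_value n v * letter_mat n a"
      \<comment> \<open>Diagonal weights vanish, so one formula, a constant plus an exponent sum,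
        also covers \<open>k = ?i\<close>.\<close>
      have "(\<Sum>b\<leftarrow>v. letter_weight n k k b) = 0"
        using L(1) letter_weight_zero[of _ n k k] by (induction v) auto
      then have "mat_value n v $$ (k, ?i) = (if k = ?i then 1 else 0) + (\<Sum>b\<leftarrow>v. letter_weight n k ?i b)"
        using mat_value_normal[OF vw(1), of k ?i] that b by auto
      moreover have "mat_value n v $$ (k, l) = (\<Sum>b\<leftarrow>v. letter_weight n k l b)"
        using mat_value_normal[OF vw(1), of k l] that by auto
      moreover have "(mat_value n v * letter_mat n a) $$ (k, l) =
          mat_value n v $$ (k, l) + (if l = ?j then mat_value n v $$ (k, ?i) * letter_sign a else 0)"
        using that b mat_value_in_U[OF L(1), THEN U_carrier]
        unfolding letter_mat_def[of n a] by (intro mult_transvection) auto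
      ultimately show ?thesis
        unfolding eq by (auto simp: sum_list_addf sum_list_const_mult algebra_simps)
    qed
    have w: "mat_value n w $$ (k, l) = (\<Sum>b\<leftarrow>w. letter_weight n k l b)" if "k < l" "l < n" for k l
      using mat_value_normal[OF vw(2), of k l] that by auto
    have "mat_value n w = mat_value n (v @ [a]) \<longleftrightarrow>
      (\<forall>k l. k < l \<and> l < n \<longrightarrow> mat_value n (v @ [a]) $$ (k, l) = mat_value n w $$ (k, l))"
      using U_eqI[OF mat_value_in_U[OF L(2)] mat_value_in_U[OF L(4)]] by (auto simp del: mat_value_simps)
    then show ?thesis using va w by simp
  qed
  note * = this
  have eq: "(v, w) \<in> ?L \<longleftrightarrow> (v, w) \<in> ?R" for v w
  proof (cases "v \<in> normal_words (letters n) \<and> w \<in> normal_words (letters n)")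
    case True
    then have "v \<in> lists (letters n)" "w \<in> lists (letters n)" by (auto simp: normal_words_def)
    then show ?thesis using True *[of v w] by auto
  qed auto
  show ?thesis unfolding set_eq_iff split_paired_All by (intro allI eq)
qed

theorem poly_pushdown_group_unitriangular: "poly_pushdown_group (unitriangular_group n)"
proof -
  let ?A = "letters n" and ?L = "normal_words (letters n)"
  have surj: "mat_value n ` lists ?A = U n"
  proof
    show "mat_value n ` lists ?A \<subseteq> U n" using mat_value_in_U by blast
    show "U n \<subseteq> mat_value n ` lists ?A"
    proof
      fix M assume "M \<in> U n"
      then obtain w where "w \<in> ?L" "mat_value n w = M" by (rule normal_word_exists)
      then show "M \<in> mat_value n ` lists ?A" unfolding normal_words_def by auto
    qed
  qed
  have "poly_pushdown ?A ?L"
    unfolding poly_pushdown_def using dpda_language_normal_words[OF finite_letters]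
    by (intro exI[of _ "{?L}"]) auto
  moreover have "at_poly_pushdown ?A {(v, w) \<in> ?L \<times> ?L. mat_value n w = mat_value n (v @ [a])}"
    if "a \<in> ?A" for a
  proof -
    let ?i = "letter_row n a" and ?j = "letter_col n a"
    let ?P = "{(k, l). k < l \<and> l < n}"
    let ?R1 = "{(v, w) \<in> lists ?A \<times> lists ?A. v \<in> ?L}"
    let ?R2 = "{(v, w) \<in> lists ?A \<times> lists ?A. w \<in> ?L}"
    let ?C = "\<lambda>(k, l). {(v, w) \<in> lists ?A \<times> lists ?A.
      (\<Sum>b\<leftarrow>v. letter_weight n k l b + (if l = ?j then letter_sign a * letter_weight n k ?i b else 0)) +
        (if l = ?j \<and> k = ?i then letter_sign a else 0) = (\<Sum>b\<leftarrow>w. letter_weight n k l b)}"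
    have "two_tape_language ?A (?C p)" for p
    proof (cases p)
      case (Pair k l)
      \<comment> \<open>A letter has a single position, so because of \<open>?i \<noteq> ?j\<close>
        at most one of the two added weights is nonzero, and the combined weight stays in the range
        of the counter.\<close>
      have "?i \<noteq> ?j" using letters_bounds[OF that] by simp
      then show ?thesis unfolding Pair prod.case
        by (intro two_tape_language_linear[OF finite_letters]) (auto simp: letter_weight_def letter_sign_def)
    qed
    moreover have "finite ?P" by (rule finite_subset[of _ "{..<n} \<times> {..<n}"]) auto
    moreover note two_tape_language_normal_words[OF finite_letters, of n]
    ultimately show ?thesis
      unfolding at_poly_pushdown_def
      unfolding normal_words_multiplication[OF that]
      by (intro exI[of _ "insert ?R1 (insert ?R2 (?C ` ?P))"] conjI ballI)
        (simp, simp, blast, simp only: Inter_insert Int_assoc)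
  qed
  ultimately have "poly_pushdown_structure (unitriangular_group n) ?A (letter_mat n) ?L"
    unfolding poly_pushdown_structure_def using bij_betw_mat_value by (auto simp: normal_words_def)
  moreover have "letter_mat n \<in> ?A \<rightarrow> U n" using letter_mat_in_U by auto
  ultimately show ?thesis
    unfolding poly_pushdown_group_def using surj
    by (intro conjI exI[of _ ?A] exI[of _ "letter_mat n"] exI[of _ ?L] group_unitriangular finite_letters)
qed

section \<open>Commutators and the lower central series\<close>

definition commutator :: "('g, 'm) monoid_scheme \<Rightarrow> 'g \<Rightarrow> 'g \<Rightarrow> 'g" where
  "commutator G x y = x \<otimes>\<^bsub>G\<^esub> y \<otimes>\<^bsub>G\<^esub> inv\<^bsub>G\<^esub> x \<otimes>\<^bsub>G\<^esub> inv\<^bsub>G\<^esub> y"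

context group begin

text \<open>A description free of inverses: in the matrix group inverses are known only abstractly,
  and commutators are verified by multiplying out.\<close>

lemma commutator_eq_iff:
  assumes "x \<in> carrier G" "y \<in> carrier G" "c \<in> carrier G"
  shows "c = commutator G x y \<longleftrightarrow> c \<otimes> (y \<otimes> x) = x \<otimes> y"
proof -
  have "commutator G x y = x \<otimes> y \<otimes> inv (y \<otimes> x)"
    using assms by (simp add: commutator_def inv_mult_group m_assoc)
  then show ?thesis using assms by (metis inv_closed inv_solve_right m_closed)
qed

lemma commutator_closed [simp]:
  "x \<in> carrier G \<Longrightarrow> y \<in> carrier G \<Longrightarrow> commutator G x y \<in> carrier G"
  by (simp add: commutator_def)

lemma commutator_mult:
  "x \<in> carrier G \<Longrightarrow> y \<in> carrier G \<Longrightarrow> commutator G x y \<otimes> (y \<otimes> x) = x \<otimes> y"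
  using commutator_eq_iff[of x y "commutator G x y"] by simp

lemma conj_eq_commutator_mult:
  "x \<in> carrier G \<Longrightarrow> y \<in> carrier G \<Longrightarrow> x \<otimes> y \<otimes> inv x = commutator G x y \<otimes> y"
  by (simp add: commutator_def m_assoc)

lemma inv_commutator:
  "x \<in> carrier G \<Longrightarrow> y \<in> carrier G \<Longrightarrow> inv (commutator G x y) = commutator G y x"
  by (simp add: commutator_def inv_mult_group m_assoc)

lemma normal_if_commutators:
  assumes "subgroup N G" "\<And>x g. x \<in> N \<Longrightarrow> g \<in> carrier G \<Longrightarrow> commutator G g x \<in> N"
  shows "N \<lhd> G"
  using assms subgroup.mem_carrier[OF assms(1)]
  by (intro normal_invI) (simp_all add: conj_eq_commutator_mult subgroup.m_closed)

lemma commutator_in_normal: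
  assumes "N \<lhd> G" "x \<in> N" "y \<in> carrier G"
  shows "commutator G x y \<in> N" "commutator G y x \<in> N"
proof -
  interpret normal N G by (rule assms(1))
  have x: "x \<in> carrier G" using assms(2) by (rule mem_carrier)
  show *: "commutator G y x \<in> N"
    unfolding commutator_def by (rule m_closed[OF inv_op_closed2[OF assms(3,2)] m_inv_closed[OF assms(2)]])
  then show "commutator G x y \<in> N" using inv_commutator[OF assms(3) x] m_inv_closed by metis
qed

lemma lower_central_Suc:
  "lower_central G (Suc i) = generate G {commutator G x y | x y. x \<in> lower_central G i \<and> y \<in> carrier G}"
  by (simp add: commutator_def)

declare lower_central.simps(2) [simp del]

lemma subgroup_lower_central: "subgroup (lower_central G i) G"
proof (induction i)
  case (Suc i)
  then show ?case unfolding lower_central_Suc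
    by (intro generate_is_subgroup) (auto dest: subgroup.mem_carrier)
qed (simp add: subgroup_self)

lemma commutator_in_lower_central:
  "x \<in> lower_central G i \<Longrightarrow> y \<in> carrier G \<Longrightarrow> commutator G x y \<in> lower_central G (Suc i)"
  unfolding lower_central_Suc by (rule generate.incl) blast

lemma lower_central_antimono_Suc: "lower_central G (Suc i) \<subseteq> lower_central G i"
proof (induction i)
  case 0
  then show ?case using subgroup.subset[OF subgroup_lower_central[of 1]] by simp
next
  case (Suc i)
  then show ?case unfolding lower_central_Suc[of "Suc i"]
    by (subst lower_central_Suc[of i]) (intro mono_generate, blast)
qed

lemma lower_central_antimono: "i \<le> j \<Longrightarrow> lower_central G j \<subseteq> lower_central G i"
  by (rule lift_Suc_antimono_le[of "lower_central G", OF lower_central_antimono_Suc])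

lemma commutator_in_lower_central':
  assumes "x \<in> lower_central G i" "y \<in> carrier G"
  shows "commutator G y x \<in> lower_central G (Suc i)"
  using commutator_in_lower_central[OF assms] inv_commutator[of x y]
    subgroup.m_inv_closed[OF subgroup_lower_central[of "Suc i"]]
    subgroup.mem_carrier[OF subgroup_lower_central assms(1)] assms(2) by metis

lemma normal_lower_central: "lower_central G i \<lhd> G"
  using commutator_in_lower_central' lower_central_antimono_Suc
  by (intro normal_if_commutators subgroup_lower_central) blast

end

lemma (in group_hom) hom_commutator_eq_one_iff:
  assumes "x \<in> carrier G" "y \<in> carrier G"
  shows "h (commutator G x y) = \<one>\<^bsub>H\<^esub> \<longleftrightarrow> h x \<otimes>\<^bsub>H\<^esub> h y = h y \<otimes>\<^bsub>H\<^esub> h x"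
proof -
  have "h (commutator G x y) = commutator H (h x) (h y)"
    using assms by (simp add: commutator_def)
  moreover have "\<one>\<^bsub>H\<^esub> = commutator H (h x) (h y) \<longleftrightarrow> h y \<otimes>\<^bsub>H\<^esub> h x = h x \<otimes>\<^bsub>H\<^esub> h y"
    using assms H.commutator_eq_iff[of "h x" "h y" "\<one>\<^bsub>H\<^esub>"] by simp
  ultimately show ?thesis by metis
qed

text \<open>The preimage of a centraliser. Applied to a quotient map it shows that commuting with a
  fixed element modulo a normal subgroup is inherited from generators.\<close>

lemma (in group_hom) subgroup_commuting:
  assumes "y \<in> carrier H"
  shows "subgroup {x \<in> carrier G. h x \<otimes>\<^bsub>H\<^esub> y = y \<otimes>\<^bsub>H\<^esub> h x} G" (is "subgroup ?C G")
proof (rule G.subgroupI)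
  have "\<one> \<in> ?C" using assms by simp
  then show "?C \<noteq> {}" by blast
next
  fix a assume "a \<in> ?C"
  then have a: "a \<in> carrier G" "h a \<otimes>\<^bsub>H\<^esub> y = y \<otimes>\<^bsub>H\<^esub> h a" by auto
  have "inv\<^bsub>H\<^esub> h a \<otimes>\<^bsub>H\<^esub> (h a \<otimes>\<^bsub>H\<^esub> y) \<otimes>\<^bsub>H\<^esub> inv\<^bsub>H\<^esub> h a =
      inv\<^bsub>H\<^esub> h a \<otimes>\<^bsub>H\<^esub> (y \<otimes>\<^bsub>H\<^esub> h a) \<otimes>\<^bsub>H\<^esub> inv\<^bsub>H\<^esub> h a" by (simp only: a(2))
  moreover have "inv\<^bsub>H\<^esub> h a \<otimes>\<^bsub>H\<^esub> (h a \<otimes>\<^bsub>H\<^esub> y) = y" using a(1) assms by (simp flip: H.m_assoc)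
  moreover have "inv\<^bsub>H\<^esub> h a \<otimes>\<^bsub>H\<^esub> (y \<otimes>\<^bsub>H\<^esub> h a) \<otimes>\<^bsub>H\<^esub> inv\<^bsub>H\<^esub> h a = inv\<^bsub>H\<^esub> h a \<otimes>\<^bsub>H\<^esub> y"
    using a(1) assms by (simp add: H.m_assoc)
  ultimately have "y \<otimes>\<^bsub>H\<^esub> inv\<^bsub>H\<^esub> h a = inv\<^bsub>H\<^esub> h a \<otimes>\<^bsub>H\<^esub> y" by simp
  then show "inv a \<in> ?C" using a(1) by simp
next
  fix a b assume "a \<in> ?C" "b \<in> ?C"
  then have ab: "a \<in> carrier G" "b \<in> carrier G"
    "h a \<otimes>\<^bsub>H\<^esub> y = y \<otimes>\<^bsub>H\<^esub> h a" "h b \<otimes>\<^bsub>H\<^esub> y = y \<otimes>\<^bsub>H\<^esub> h b" by auto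
  have "h a \<otimes>\<^bsub>H\<^esub> h b \<otimes>\<^bsub>H\<^esub> y = h a \<otimes>\<^bsub>H\<^esub> (y \<otimes>\<^bsub>H\<^esub> h b)"
    using ab assms by (simp add: H.m_assoc)
  also have "\<dots> = (y \<otimes>\<^bsub>H\<^esub> h a) \<otimes>\<^bsub>H\<^esub> h b"
    using ab(1,2) assms by (simp add: ab(3) flip: H.m_assoc)
  also have "\<dots> = y \<otimes>\<^bsub>H\<^esub> (h a \<otimes>\<^bsub>H\<^esub> h b)"
    using ab(1,2) assms by (simp add: H.m_assoc)
  finally show "a \<otimes> b \<in> ?C" using ab by simp
qed auto

section \<open>Centrality modulo a normal subgroup\<close>

text \<open>Hides the cosets: calculations modulo \<open>K\<close> become calculations in an
  abstract group, and the kernel leads back.\<close>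

lemma (in group) quotient_map:
  assumes "K \<lhd> G"
  obtains Q :: "'a set monoid" and \<pi>
  where "group_hom G Q \<pi>" "\<And>x. x \<in> carrier G \<Longrightarrow> \<pi> x = \<one>\<^bsub>Q\<^esub> \<longleftrightarrow> x \<in> K"
proof
  interpret normal K G by (rule assms)
  show "group_hom G (G Mod K) (\<lambda>x. K #> x)"
    using r_coset_hom_Mod factorgroup_is_group is_group by (simp add: group_hom_def group_hom_axioms_def)
  show "K #> x = \<one>\<^bsub>G Mod K\<^esub> \<longleftrightarrow> x \<in> K" if "x \<in> carrier G" for x
    unfolding one_FactGroup using coset_join1[OF _ that is_subgroup] coset_join2[OF that is_subgroup] by blast
qed

context group begin

lemma subgroup_commuting_mod:
  assumes "K \<lhd> G" "y \<in> carrier G"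
  shows "subgroup {x \<in> carrier G. commutator G x y \<in> K} G"
proof -
  obtain Q :: "'a set monoid" and \<pi> where hom: "group_hom G Q \<pi>"
    and ker: "\<And>x. x \<in> carrier G \<Longrightarrow> \<pi> x = \<one>\<^bsub>Q\<^esub> \<longleftrightarrow> x \<in> K"
    using quotient_map[OF assms(1)] by metis
  interpret h: group_hom G Q \<pi> by (rule hom)
  have "commutator G x y \<in> K \<longleftrightarrow> \<pi> x \<otimes>\<^bsub>Q\<^esub> \<pi> y = \<pi> y \<otimes>\<^bsub>Q\<^esub> \<pi> x" if "x \<in> carrier G" for x
    using h.hom_commutator_eq_one_iff[OF that assms(2)] ker[OF commutator_closed[OF that assms(2)]] by simp
  then have "{x \<in> carrier G. commutator G x y \<in> K} =
      {x \<in> carrier G. \<pi> x \<otimes>\<^bsub>Q\<^esub> \<pi> y = \<pi> y \<otimes>\<^bsub>Q\<^esub> \<pi> x}" by auto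
  then show ?thesis using h.subgroup_commuting[OF h.hom_closed[OF assms(2)]] by simp
qed

lemma commutator_in_normal_sym:
  assumes "K \<lhd> G" "x \<in> carrier G" "y \<in> carrier G" "commutator G x y \<in> K"
  shows "commutator G y x \<in> K"
  using inv_commutator[OF assms(2,3)] subgroup.m_inv_closed[OF normal_imp_subgroup[OF assms(1)] assms(4)]
  by simp

text \<open>For normal \<open>K\<close> this is the preimage of the centre of G/K.\<close>

definition central_mod :: "'a set \<Rightarrow> 'a set" where
  "central_mod K = {x \<in> carrier G. \<forall>y \<in> carrier G. commutator G x y \<in> K}"

lemma central_mod_subset: "central_mod K \<subseteq> carrier G"
  by (simp add: central_mod_def)

lemma subgroup_central_mod:
  assumes "K \<lhd> G"
  shows "subgroup (central_mod K) G"
proof -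
  have "central_mod K = (\<Inter>y \<in> carrier G. {x \<in> carrier G. commutator G x y \<in> K})"
    unfolding central_mod_def using one_closed by blast
  moreover have "subgroup (\<Inter>y \<in> carrier G. {x \<in> carrier G. commutator G x y \<in> K}) G"
    using subgroup_commuting_mod[OF assms] by (intro subgroups_Inter) auto
  ultimately show ?thesis by simp
qed

lemma subset_central_mod:
  assumes "K \<lhd> G"
  shows "K \<subseteq> central_mod K"
  using commutator_in_normal(1)[OF assms] subgroup.mem_carrier[OF normal_imp_subgroup[OF assms]]
  unfolding central_mod_def by (intro subsetI CollectI conjI ballI)

text \<open>A subgroup of the centre of G/K is normal there, and so is its preimage.\<close>

lemma normal_if_central_mod:
  assumes "K \<lhd> G" "subgroup M G" "K \<subseteq> M" "M \<subseteq> central_mod K"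
  shows "M \<lhd> G"
proof (rule normal_if_commutators[OF assms(2)])
  fix x g assume "x \<in> M" "g \<in> carrier G"
  then have "x \<in> carrier G" "commutator G x g \<in> K" using assms(4) by (auto simp: central_mod_def)
  then show "commutator G g x \<in> M"
    using commutator_in_normal_sym[OF assms(1)] \<open>g \<in> carrier G\<close> assms(3) by blast
qed

lemma normal_central_mod: "K \<lhd> G \<Longrightarrow> central_mod K \<lhd> G"
  by (rule normal_if_central_mod[OF _ subgroup_central_mod subset_central_mod subset_refl])

section \<open>Subgroups of finitely generated nilpotent groups\<close>

definition adjoin :: "'a set \<Rightarrow> 'a \<Rightarrow> 'a set" where
  "adjoin K x = {k \<otimes> x [^] (n::int) | k n. k \<in> K}"

lemma adjoinI: "k \<in> K \<Longrightarrow> k \<otimes> x [^] (n::int) \<in> adjoin K x"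
  unfolding adjoin_def by blast

end

text \<open>\<open>adjoin K x\<close> is the preimage of the cyclic group generated by the image of
  \<open>x\<close>.\<close>

lemma (in group_hom) mem_adjoin_iff:
  assumes ker: "\<And>x. x \<in> carrier G \<Longrightarrow> h x = \<one>\<^bsub>H\<^esub> \<longleftrightarrow> x \<in> K"
    and "K \<subseteq> carrier G" "x \<in> carrier G" "g \<in> carrier G"
  shows "g \<in> G.adjoin K x \<longleftrightarrow> (\<exists>n::int. h g = h x [^]\<^bsub>H\<^esub> n)"
proof -
  have "h g = h x [^]\<^bsub>H\<^esub> n \<longleftrightarrow> (\<exists>k \<in> K. g = k \<otimes> x [^] n)" for n :: int
  proof
    let ?k = "g \<otimes> inv (x [^] n)"
    assume "h g = h x [^]\<^bsub>H\<^esub> n"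
    then have "h ?k = \<one>\<^bsub>H\<^esub>" using assms(3,4) by (simp add: hom_int_pow)
    then have "?k \<in> K" using ker[of ?k] assms(3,4) G.m_closed G.inv_closed G.int_pow_closed by metis
    moreover have "g = ?k \<otimes> x [^] n" using assms(3,4) by (simp add: G.m_assoc)
    ultimately show "\<exists>k \<in> K. g = k \<otimes> x [^] n" by blast
  next
    assume "\<exists>k \<in> K. g = k \<otimes> x [^] n"
    then obtain k where k: "k \<in> K" "g = k \<otimes> x [^] n" by blast
    then have "k \<in> carrier G" "h k = \<one>\<^bsub>H\<^esub>" using assms by auto
    then show "h g = h x [^]\<^bsub>H\<^esub> n" unfolding k(2) using assms(3) by (simp add: hom_int_pow)
  qed
  then show ?thesis unfolding G.adjoin_def by blast
qed

lemma (in group_hom) subgroup_cyclic_preimage: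
  assumes "y \<in> carrier H"
  shows "subgroup {g \<in> carrier G. \<exists>n::int. h g = y [^]\<^bsub>H\<^esub> n} G" (is "subgroup ?C G")
proof (rule G.subgroupI)
  have "h \<one> = y [^]\<^bsub>H\<^esub> (0::int)" by simp
  then have "\<one> \<in> ?C" using G.one_closed by blast
  then show "?C \<noteq> {}" by blast
next
  fix a assume "a \<in> ?C"
  then obtain n :: int where n: "a \<in> carrier G" "h a = y [^]\<^bsub>H\<^esub> n" by blast
  then have "h (inv a) = y [^]\<^bsub>H\<^esub> (- n)" using assms by (simp add: H.int_pow_neg)
  then show "inv a \<in> ?C" using n(1) by blast
next
  fix a b assume "a \<in> ?C" "b \<in> ?C"
  then obtain m n :: int where n: "a \<in> carrier G" "h a = y [^]\<^bsub>H\<^esub> m"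
    "b \<in> carrier G" "h b = y [^]\<^bsub>H\<^esub> n" by blast
  then have "h (a \<otimes> b) = y [^]\<^bsub>H\<^esub> (m + n)" using assms by (simp add: H.int_pow_mult)
  then show "a \<otimes> b \<in> ?C" using n(1,3) by blast
qed auto

context group begin

lemma subgroup_adjoin:
  assumes "K \<lhd> G" "x \<in> carrier G"
  shows "subgroup (adjoin K x) G"
proof -
  have K: "K \<subseteq> carrier G" using normal_imp_subgroup[OF assms(1)] by (rule subgroup.subset)
  obtain Q :: "'a set monoid" and \<pi> where hom: "group_hom G Q \<pi>"
    and ker: "\<And>x. x \<in> carrier G \<Longrightarrow> \<pi> x = \<one>\<^bsub>Q\<^esub> \<longleftrightarrow> x \<in> K"
    using quotient_map[OF assms(1)] by metis
  interpret h: group_hom G Q \<pi> by (rule hom)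
  have "adjoin K x \<subseteq> carrier G" using K assms(2) by (auto simp: adjoin_def)
  then have "adjoin K x = {g \<in> carrier G. \<exists>n::int. \<pi> g = \<pi> x [^]\<^bsub>Q\<^esub> n}"
    using h.mem_adjoin_iff[OF ker K assms(2)] by blast
  then show ?thesis using h.subgroup_cyclic_preimage[OF h.hom_closed[OF assms(2)]] by simp
qed

lemma adjoin_superset:
  assumes "K \<lhd> G" "x \<in> carrier G"
  shows "K \<subseteq> adjoin K x" "x \<in> adjoin K x"
proof -
  have K: "subgroup K G" using assms(1) by (rule normal_imp_subgroup)
  show "K \<subseteq> adjoin K x"
  proof
    fix k assume "k \<in> K"
    then show "k \<in> adjoin K x"
      using adjoinI[of k K x 0] subgroup.mem_carrier[OF K] by simp
  qed
  show "x \<in> adjoin K x" using adjoinI[OF subgroup.one_closed[OF K], of x 1] assms(2) by simp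
qed

lemma adjoin_least:
  assumes "subgroup M G" "K \<subseteq> M" "x \<in> M"
  shows "adjoin K x \<subseteq> M"
  using assms subgroup_int_pow_closed[OF assms(1,3)] by (auto simp: adjoin_def intro: subgroup.m_closed)

section \<open>Finite generation of subgroups and the maximal condition\<close>

definition noetherian_subgroup :: "'a set \<Rightarrow> bool" where
  "noetherian_subgroup K \<longleftrightarrow>
     (\<forall>M. subgroup M G \<and> M \<subseteq> K \<longrightarrow> (\<exists>S. finite S \<and> S \<subseteq> M \<and> generate G S = M))"

lemma noetherian_subgroupE:
  assumes "noetherian_subgroup K" "subgroup M G" "M \<subseteq> K"
  obtains S where "finite S" "S \<subseteq> M" "generate G S = M"
proof -
  have "\<exists>S. finite S \<and> S \<subseteq> M \<and> generate G S = M"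
    by (rule assms(1)[unfolded noetherian_subgroup_def, rule_format, OF conjI[OF assms(2,3)]])
  then show ?thesis using that by (elim exE conjE)
qed

lemma noetherian_subgroup_mono: "noetherian_subgroup K \<Longrightarrow> L \<subseteq> K \<Longrightarrow> noetherian_subgroup L"
  unfolding noetherian_subgroup_def by (meson order_trans)

text \<open>Modulo \<open>K\<close> the elements of \<open>M\<close> are powers of \<open>x\<close>.
  An element \<open>y\<close> of \<open>M\<close> with least positive exponent \<open>d\<close>
  exists unless \<open>M\<close> lies in \<open>K\<close>; division with remainder shows that
  \<open>y\<close> and generators of the intersection of \<open>M\<close> and \<open>K\<close>
  generate \<open>M\<close>.\<close>

lemma noetherian_adjoin:
  assumes K: "K \<lhd> G" "noetherian_subgroup K" and x: "x \<in> carrier G"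
  shows "noetherian_subgroup (adjoin K x)"
  unfolding noetherian_subgroup_def
proof (intro allI impI)
  fix M assume "subgroup M G \<and> M \<subseteq> adjoin K x"
  then have M: "subgroup M G" "M \<subseteq> adjoin K x" by auto
  have KG: "K \<subseteq> carrier G" using normal_imp_subgroup[OF K(1)] by (rule subgroup.subset)
  obtain Q :: "'a set monoid" and \<pi> where hom: "group_hom G Q \<pi>"
    and ker: "\<And>x. x \<in> carrier G \<Longrightarrow> \<pi> x = \<one>\<^bsub>Q\<^esub> \<longleftrightarrow> x \<in> K"
    using quotient_map[OF K(1)] by metis
  interpret h: group_hom G Q \<pi> by (rule hom)
  have xK: "\<pi> x \<in> carrier (Q)" using x by (rule h.hom_closed)
  have MG: "M \<subseteq> carrier G" using subgroup.subset[OF M(1)] .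
  have "subgroup (M \<inter> K) G" using M(1) normal_imp_subgroup[OF K(1)] by (rule subgroups_Inter_pair)
  then obtain S where S: "finite S" "S \<subseteq> M \<inter> K" "generate G S = M \<inter> K"
    by (rule noetherian_subgroupE[OF K(2) _ Int_lower2])
  define P where "P n \<longleftrightarrow> (\<exists>g \<in> M. \<pi> g = (\<pi> x) [^]\<^bsub>Q\<^esub> (n::int))" for n
  have in_K: "g \<in> M \<inter> K" if "g \<in> M" "\<pi> g = (\<pi> x) [^]\<^bsub>Q\<^esub> (0::int)" for g
    using that ker[of g] MG by auto
  have ex: "\<exists>n. \<pi> g = (\<pi> x) [^]\<^bsub>Q\<^esub> (n::int)" if "g \<in> M" for g
    using h.mem_adjoin_iff[OF ker KG x, of g] that M(2) MG by blast
  show "\<exists>S. finite S \<and> S \<subseteq> M \<and> generate G S = M"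
  proof (cases "\<exists>n > 0. P n")
    case True
    then have ex': "\<exists>n::nat. n > 0 \<and> P (int n)" by (metis of_nat_0_less_iff zero_less_imp_eq_int)
    define d where "d = (LEAST n::nat. n > 0 \<and> P (int n))"
    have d: "d > 0" "P (int d)" and least: "\<And>n. n > 0 \<Longrightarrow> P (int n) \<Longrightarrow> d \<le> n"
      using LeastI_ex[OF ex'] Least_le[of "\<lambda>n. n > 0 \<and> P (int n)"] unfolding d_def by auto
    from d(2) obtain y where y: "y \<in> M" "\<pi> y = (\<pi> x) [^]\<^bsub>Q\<^esub> int d" unfolding P_def by blast
    have sub: "subgroup (generate G (insert y S)) G" using y S MG by (intro generate_is_subgroup) auto
    have "g \<in> generate G (insert y S)" if g: "g \<in> M" for g
    proof -
      obtain n :: int where n: "\<pi> g = (\<pi> x) [^]\<^bsub>Q\<^esub> n" using ex[OF g] by blast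
      define q where "q = n div int d"
      define r where "r = g \<otimes> inv (y [^] q)"
      have yq: "y [^] q \<in> M" using subgroup_int_pow_closed[OF M(1) y(1)] .
      then have r: "r \<in> M" unfolding r_def using g M(1) by (simp add: subgroup.m_closed subgroup.m_inv_closed)
      have gy: "g \<in> carrier G" "y \<in> carrier G" using g y(1) MG by auto
      have "\<pi> r = (\<pi> g) \<otimes>\<^bsub>Q\<^esub> inv\<^bsub>Q\<^esub> ((\<pi> y) [^]\<^bsub>Q\<^esub> q)"
        unfolding r_def using gy h.hom_int_pow[OF gy(2), of q] h.hom_inv[of "y [^] q"]
          h.hom_mult[of g "inv (y [^] q)"] by simp
      also have "\<dots> = (\<pi> x) [^]\<^bsub>Q\<^esub> (n - int d * q)"
        unfolding n y(2) h.H.int_pow_pow[OF xK] h.H.int_pow_diff[OF xK] ..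
      finally have r': "\<pi> r = (\<pi> x) [^]\<^bsub>Q\<^esub> (n mod int d)"
        by (simp add: q_def minus_mult_div_eq_mod)
      have "n mod int d = 0"
      proof (rule ccontr)
        assume "n mod int d \<noteq> 0"
        moreover have "n mod int d \<ge> 0" using d(1) by simp
        ultimately have pos: "n mod int d > 0" by linarith
        moreover have "P (int (nat (n mod int d)))" unfolding P_def using r r' pos by auto
        ultimately have "d \<le> nat (n mod int d)" by (intro least) simp_all
        then have "int d \<le> n mod int d" using pos by linarith
        moreover have "n mod int d < int d" using d(1) by simp
        ultimately show False by linarith
      qed
      with r' have "r \<in> generate G S" using in_K[OF r] S(3) by simp
      then have "r \<in> generate G (insert y S)" using mono_generate[of S "insert y S"] by blast
      moreover have "y [^] q \<in> generate G (insert y S)"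
        using subgroup_int_pow_closed[OF sub generate.incl] by blast
      moreover have "g = r \<otimes> y [^] q" unfolding r_def using gy by (simp add: m_assoc)
      ultimately show ?thesis using subgroup.m_closed[OF sub] by simp
    qed
    moreover have "generate G (insert y S) \<subseteq> M"
      using y(1) S(2) by (intro generate_subgroup_incl[OF _ M(1)]) auto
    ultimately show ?thesis using S(1,2) y(1) by (intro exI[of _ "insert y S"]) auto
  next
    \<comment> \<open>Exponents occur with both signs, so without a positive one they are all zero
      and \<open>M\<close> lies in \<open>K\<close>.\<close>
    case False
    have "g \<in> K" if g: "g \<in> M" for g
    proof -
      obtain n :: int where n: "\<pi> g = (\<pi> x) [^]\<^bsub>Q\<^esub> n" using ex[OF g] by blast
      have "P n" using n g by (auto simp: P_def)
      moreover have "P (- n)"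
      proof -
        have "\<pi> (inv g) = (\<pi> x) [^]\<^bsub>Q\<^esub> (- n)"
          using g MG n h.hom_inv[of g] h.H.int_pow_neg[OF xK] by auto
        then show ?thesis unfolding P_def using g M(1) subgroup.m_inv_closed by metis
      qed
      ultimately have "n = 0" using False by (metis less_minus_iff minus_zero neqE)
      then show ?thesis using in_K[OF g] n by blast
    qed
    then have "M \<inter> K = M" by blast
    then show ?thesis using S by auto
  qed
qed

lemma generate_superset: "S \<subseteq> generate G S"
  by (rule subsetI) (rule generate.incl)

text \<open>Every intermediate group lies between \<open>K\<close> and \<open>central_mod K\<close>
  and is therefore normal, so the elements of \<open>T\<close> can be adjoined one at a
  time.\<close>

lemma noetherian_generate:
  assumes "K \<lhd> G" "noetherian_subgroup K" "finite T" "T \<subseteq> central_mod K"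
  shows "noetherian_subgroup (generate G (K \<union> T))"
  using assms(3,4)
proof (induction T)
  case empty
  have "generate G K = K"
    by (rule equalityI[OF generate_subgroup_incl[OF subset_refl normal_imp_subgroup[OF assms(1)]] generate_superset])
  then show ?case using assms(2) by simp
next
  case (insert t T)
  let ?M = "generate G (K \<union> T)"
  have T: "K \<union> T \<subseteq> central_mod K" "t \<in> central_mod K"
    using insert.prems subset_central_mod[OF assms(1)] by auto
  have "K \<union> T \<subseteq> carrier G" using T(1) central_mod_subset by (rule order_trans)
  have "t \<in> carrier G" using T(2) central_mod_subset by (rule subsetD[rotated])
  have M: "?M \<lhd> G"
  proof (rule normal_if_central_mod[OF assms(1)])
    show "subgroup ?M G" using \<open>K \<union> T \<subseteq> carrier G\<close> by (rule generate_is_subgroup)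
    show "K \<subseteq> ?M" using generate_superset[of "K \<union> T"] by simp
    show "?M \<subseteq> central_mod K"
      by (rule generate_subgroup_incl[OF T(1) subgroup_central_mod[OF assms(1)]])
  qed
  have "noetherian_subgroup (adjoin ?M t)"
    using insert \<open>t \<in> carrier G\<close> by (intro noetherian_adjoin[OF M]) auto
  moreover have "K \<union> T \<subseteq> adjoin ?M t"
    using generate_superset adjoin_superset(1)[OF M \<open>t \<in> carrier G\<close>] by (rule order_trans)
  then have "generate G (K \<union> insert t T) \<subseteq> adjoin ?M t"
    using adjoin_superset(2)[OF M \<open>t \<in> carrier G\<close>]
    by (intro generate_subgroup_incl subgroup_adjoin[OF M \<open>t \<in> carrier G\<close>]) simp
  ultimately show ?case by (rule noetherian_subgroup_mono)
qed

lemma lower_central_central_mod: "lower_central G i \<subseteq> central_mod (lower_central G (Suc i))"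
  using commutator_in_lower_central[of _ i] subgroup.mem_carrier[OF subgroup_lower_central[of i]]
  unfolding central_mod_def by (intro subsetI CollectI conjI ballI)

text \<open>Commutators of generators suffice modulo the next term: having a trivial commutator with
  a fixed element modulo a normal subgroup is a subgroup condition. It is extended first in the left
  argument, from the generators of the term \<open>i\<close>, then in the right one, from
  \<open>S\<close>.\<close>

lemma lower_central_finite_mod:
  assumes S: "finite S" "S \<subseteq> carrier G" "generate G S = carrier G"
  shows "\<exists>T. finite T \<and> T \<subseteq> lower_central G i \<and>
    lower_central G i \<subseteq> generate G (lower_central G (Suc i) \<union> T)"
proof (induction i)
  case 0
  have "carrier G \<subseteq> generate G (lower_central G (Suc 0) \<union> S)"
    using mono_generate[of S "lower_central G (Suc 0) \<union> S"] S(3) by blast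
  then show ?case using S(1,2) by auto
next
  case (Suc i)
  let ?L = "lower_central G"
  from Suc obtain T where T: "finite T" "T \<subseteq> ?L i" "?L i \<subseteq> generate G (?L (Suc i) \<union> T)" by blast
  let ?T = "(\<lambda>(t, s). commutator G t s) ` (T \<times> S)"
  have T': "?T \<subseteq> ?L (Suc i)" using T(2) S(2) by (auto intro!: commutator_in_lower_central)
  let ?M = "generate G (?L (Suc (Suc i)) \<union> ?T)"
  have LC: "?L (Suc i) \<subseteq> central_mod (?L (Suc (Suc i)))" by (rule lower_central_central_mod)
  have gens: "?L (Suc (Suc i)) \<union> ?T \<subseteq> ?L (Suc i)" using T' lower_central_antimono_Suc by blast
  have "?M \<subseteq> ?L (Suc i)" using generate_subgroup_incl[OF gens subgroup_lower_central] .
  have M: "?M \<lhd> G"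
  proof (rule normal_if_central_mod[OF normal_lower_central[of "Suc (Suc i)"]])
    show "subgroup ?M G"
      using gens subgroup.subset[OF subgroup_lower_central] by (rule generate_is_subgroup[OF order_trans])
    show "?L (Suc (Suc i)) \<subseteq> ?M" using generate_superset[of "?L (Suc (Suc i)) \<union> ?T"] by simp
    show "?M \<subseteq> central_mod (?L (Suc (Suc i)))" using \<open>?M \<subseteq> ?L (Suc i)\<close> LC by (rule order_trans)
  qed
  have TM: "commutator G x s \<in> ?M" if "x \<in> ?L i" "s \<in> S" for x s
  proof -
    have s: "s \<in> carrier G" using that S(2) by blast
    have "?L (Suc i) \<union> T \<subseteq> {x \<in> carrier G. commutator G x s \<in> ?M}"
    proof
      fix x assume x: "x \<in> ?L (Suc i) \<union> T"
      have "commutator G x s \<in> ?L (Suc (Suc i)) \<union> ?T"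
        using x that(2) commutator_in_lower_central[OF _ s, of x "Suc i"] by auto
      moreover have "x \<in> carrier G" using x T(2) subgroup.mem_carrier[OF subgroup_lower_central] by blast
      ultimately show "x \<in> {x \<in> carrier G. commutator G x s \<in> ?M}" by (simp add: generate.incl)
    qed
    from generate_subgroup_incl[OF this subgroup_commuting_mod[OF M s]] show ?thesis using T(3) that(1) by blast
  qed
  have "commutator G x y \<in> ?M" if "x \<in> ?L i" "y \<in> carrier G" for x y
  proof -
    have x: "x \<in> carrier G" using that(1) subgroup.mem_carrier[OF subgroup_lower_central] by blast
    have "S \<subseteq> {y \<in> carrier G. commutator G y x \<in> ?M}"
      using TM[OF that(1)] S(2) commutator_in_normal_sym[OF M x] by blast
    from generate_subgroup_incl[OF this subgroup_commuting_mod[OF M x]]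
    have "commutator G y x \<in> ?M" using S(3) that(2) by blast
    then show ?thesis by (rule commutator_in_normal_sym[OF M that(2) x])
  qed
  then have "{commutator G x y | x y. x \<in> ?L i \<and> y \<in> carrier G} \<subseteq> ?M" by blast
  then have "?L (Suc i) \<subseteq> ?M"
    by (subst lower_central_Suc) (rule generate_subgroup_incl[OF _ normal_imp_subgroup[OF M]])
  then show ?case using T(1) S(1) T' by (intro exI[of _ ?T]) auto
qed

lemma noetherian_nilpotent:
  assumes "finite S" "S \<subseteq> carrier G" "generate G S = carrier G" "lower_central G c = {\<one>}"
  shows "noetherian_subgroup (carrier G)"
proof -
  have "noetherian_subgroup (lower_central G (c - i))" if "i \<le> c" for i
    using that
  proof (induction i)
    case 0
    have "M = {\<one>}" if "subgroup M G" "M \<subseteq> {\<one>}" for M using that subgroup.one_closed by blast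
    moreover have "generate G {} = {\<one>}" by (rule generate_empty)
    ultimately show ?case using assms(4) unfolding noetherian_subgroup_def
      by (metis diff_zero empty_subsetI finite.emptyI)
  next
    case (Suc i)
    let ?i = "c - Suc i"
    have i: "Suc ?i = c - i" using Suc.prems by simp
    obtain T where T: "finite T" "T \<subseteq> lower_central G ?i"
      "lower_central G ?i \<subseteq> generate G (lower_central G (Suc ?i) \<union> T)"
      using lower_central_finite_mod[OF assms(1-3)] by blast
    have "T \<subseteq> central_mod (lower_central G (Suc ?i))"
      using T(2) lower_central_central_mod by (rule order_trans)
    then have "noetherian_subgroup (generate G (lower_central G (Suc ?i) \<union> T))"
      using Suc i by (intro noetherian_generate normal_lower_central T(1)) auto
    then show ?case using T(3) by (rule noetherian_subgroup_mono)
  qed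
  from this[of c] show ?thesis by simp
qed

text \<open>The union of a chain has finitely many generators, which already lie in one member; so
  the union is that member and Zorn's lemma applies.\<close>

lemma noetherian_maximal:
  assumes "noetherian_subgroup (carrier G)" "fam \<noteq> {}" "\<And>M. M \<in> fam \<Longrightarrow> subgroup M G"
  shows "\<exists>M \<in> fam. \<forall>N \<in> fam. M \<subseteq> N \<longrightarrow> N = M"
proof (rule subset_Zorn_nonempty[OF assms(2)])
  fix ch assume C: "ch \<noteq> {}" "subset.chain fam ch"
  then have CA: "ch \<subseteq> fam" and lin: "\<And>N N'. N \<in> ch \<Longrightarrow> N' \<in> ch \<Longrightarrow> N \<subseteq> N' \<or> N' \<subseteq> N"
    by (auto simp: subset_chain_def)
  have sub: "subgroup N G" if "N \<in> ch" for N using that CA assms(3) by blast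
  have "subgroup (\<Union>ch) G"
  proof (rule subgroupI)
    show "\<Union>ch \<subseteq> carrier G" using sub subgroup.subset by blast
    show "\<Union>ch \<noteq> {}" using C(1) sub subgroup.one_closed by blast
    show "inv a \<in> \<Union>ch" if "a \<in> \<Union>ch" for a
      using that by (elim UnionE) (rule UnionI, assumption, rule subgroup.m_inv_closed[OF sub])
    show "a \<otimes> b \<in> \<Union>ch" if "a \<in> \<Union>ch" "b \<in> \<Union>ch" for a b
    proof -
      from that obtain N N' where NN: "N \<in> ch" "N' \<in> ch" "a \<in> N" "b \<in> N'" by blast
      then consider "a \<in> N'" | "b \<in> N" using lin by blast
      then show ?thesis
      proof cases
        case 1
        then show ?thesis by (rule UnionI[OF NN(2) subgroup.m_closed[OF sub[OF NN(2)] _ NN(4)]])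
      next
        case 2
        then show ?thesis by (rule UnionI[OF NN(1) subgroup.m_closed[OF sub[OF NN(1)] NN(3)]])
      qed
    qed
  qed
  moreover from this have "\<Union>ch \<subseteq> carrier G" by (rule subgroup.subset)
  ultimately obtain S where S: "finite S" "S \<subseteq> \<Union>ch" "generate G S = \<Union>ch"
    by (rule noetherian_subgroupE[OF assms(1)])
  obtain N where N: "N \<in> ch" "S \<subseteq> N"
    using finite_subset_Union_chain[OF S(1,2) C] by blast
  have "\<Union>ch \<subseteq> N" using generate_subgroup_incl[OF N(2) sub[OF N(1)]] S(3) by simp
  then have "\<Union>ch = N" using N(1) by blast
  then show "\<Union>ch \<in> fam" using N(1) CA by auto
qed

end

section \<open>The lower central series of the unitriangular group\<close>

text \<open>The first \<open>i\<close> superdiagonals vanish, so \<open>band n 0\<close> is the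
  whole group.\<close>

definition band :: "nat \<Rightarrow> nat \<Rightarrow> int mat set" where
  "band n i = {M \<in> U n. \<forall>k l. k < l \<longrightarrow> l < n \<longrightarrow> l \<le> k + i \<longrightarrow> M $$ (k, l) = 0}"

lemma U_mult_entry:
  assumes "M \<in> U n" "N \<in> U n" "k < l" "l < n"
    "\<And>m. k < m \<Longrightarrow> m < l \<Longrightarrow> M $$ (k, m) * N $$ (m, l) = 0"
  shows "(M * N) $$ (k, l) = M $$ (k, l) + N $$ (k, l)"
proof -
  have "(M * N) $$ (k, l) = (\<Sum>m<n. M $$ (k, m) * N $$ (m, l))"
    using assms U_carrier by (intro mult_mat_entry) auto
  also have "\<dots> = (\<Sum>m\<in>{k, l}. M $$ (k, m) * N $$ (m, l))"
  proof (rule sum.mono_neutral_right)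
    show "\<forall>m\<in>{..<n} - {k, l}. M $$ (k, m) * N $$ (m, l) = 0"
    proof
      fix m assume m: "m \<in> {..<n} - {k, l}"
      then consider "m < k" | "k < m" "m < l" | "l < m" by fastforce
      then show "M $$ (k, m) * N $$ (m, l) = 0"
        using m assms unfolding U_iff by cases auto
    qed
  qed (use assms in auto)
  also have "\<dots> = M $$ (k, l) + N $$ (k, l)" using assms unfolding U_iff by simp
  finally show ?thesis .
qed

text \<open>Induction on the column: the cross terms of C Z at \<open>(k, l)\<close> contain entries
  of \<open>C\<close> in row \<open>k\<close> strictly between the diagonal and column
  \<open>l\<close>, which vanish already. What remains is the sum of the two entries at
  \<open>(k, l)\<close>.\<close>

lemma band_if_mult_agrees:
  assumes "C \<in> U n" "Z \<in> U n"
    and agree: "\<And>k l. k < l \<Longrightarrow> l < n \<Longrightarrow> l \<le> k + i \<Longrightarrow> (C * Z) $$ (k, l) = Z $$ (k, l)"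
  shows "C \<in> band n i"
proof -
  have "C $$ (k, l) = 0" if "k < l" "l < n" "l \<le> k + i" for k l
    using that
  proof (induction l rule: less_induct)
    case (less l)
    have "(C * Z) $$ (k, l) = C $$ (k, l) + Z $$ (k, l)"
      using assms(1,2) less by (intro U_mult_entry) auto
    then show ?case using agree[OF less.prems] by simp
  qed
  with assms(1) show ?thesis by (auto simp: band_def)
qed

lemma subgroup_band: "subgroup (band n i) (unitriangular_group n)"
proof -
  interpret group "unitriangular_group n" by (rule group_unitriangular)
  show ?thesis
  proof (rule subgroupI)
    show "band n i \<noteq> {}" using one_in_U[of n] by (auto simp: band_def)
  next
    fix M assume M: "M \<in> band n i"
    then have MU: "M \<in> U n" by (simp add: band_def)
    show "inv\<^bsub>unitriangular_group n\<^esub> M \<in> band n i"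
    proof (rule band_if_mult_agrees[OF inv_closed[OF MU] MU])
      fix k l assume "k < l" "l < n" "l \<le> k + i"
      then show "(inv\<^bsub>unitriangular_group n\<^esub> M * M) $$ (k, l) = M $$ (k, l)"
        using M l_inv[OF MU] by (simp add: band_def)
    qed
  next
    fix M N assume "M \<in> band n i" "N \<in> band n i"
    then show "M \<otimes>\<^bsub>unitriangular_group n\<^esub> N \<in> band n i"
      by (auto simp: band_def U_mult_closed U_mult_entry)
  qed (auto simp: band_def)
qed

text \<open>Up to superdiagonal \<open>i + 1\<close> the cross terms of both M N and N M contain an
  entry of \<open>M\<close> on one of its first \<open>i\<close> superdiagonals and vanish, so both
  products have the same entries there.\<close>

lemma commutator_in_band:
  assumes M: "M \<in> band n i" and N: "N \<in> U n" and C: "C \<in> U n" "C * (N * M) = M * N"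
  shows "C \<in> band n (Suc i)"
proof -
  have MU: "M \<in> U n" using M by (simp add: band_def)
  show ?thesis
  proof (rule band_if_mult_agrees[OF C(1) U_mult_closed[OF N MU]])
    fix k l assume kl: "k < l" "l < n" "l \<le> k + Suc i"
    have "(M * N) $$ (k, l) = M $$ (k, l) + N $$ (k, l)"
      using kl M by (intro U_mult_entry[OF MU N]) (auto simp: band_def)
    moreover have "(N * M) $$ (k, l) = N $$ (k, l) + M $$ (k, l)"
      using kl M by (intro U_mult_entry[OF N MU]) (auto simp: band_def)
    ultimately show "(C * (N * M)) $$ (k, l) = (N * M) $$ (k, l)" using C(2) by simp
  qed
qed

lemma lower_central_unitriangular: "lower_central (unitriangular_group n) i \<subseteq> band n i"
proof (induction i)
  case 0
  then show ?case by (auto simp: band_def)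
next
  case (Suc i)
  interpret group "unitriangular_group n" by (rule group_unitriangular)
  show ?case unfolding lower_central_Suc
  proof (rule generate_subgroup_incl[OF _ subgroup_band], safe)
    fix M N assume MN: "M \<in> lower_central (unitriangular_group n) i" "N \<in> U n"
    then have M: "M \<in> band n i" "M \<in> U n" using Suc by (auto simp: band_def)
    let ?C = "commutator (unitriangular_group n) M N"
    have "?C * (N * M) = M * N" using commutator_mult[OF M(2) MN(2)] by simp
    then show "?C \<in> band n (Suc i)"
      by (rule commutator_in_band[OF M(1) MN(2) commutator_closed[OF M(2) MN(2)]])
  qed
qed

text \<open>The commutator of the elementary matrices at (0, i+1) and (i+1, i+2) is the one at (0,
  i+2). As the series is counted from zero, column \<open>i + 1\<close> belongs to term
  \<open>i\<close>.\<close>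

lemma transvection_in_lower_central:
  "Suc i < n \<Longrightarrow> transvection n 0 (Suc i) 1 \<in> lower_central (unitriangular_group n) i"
proof (induction i)
  case 0
  then show ?case by (simp add: transvection_in_U)
next
  case (Suc i)
  interpret group "unitriangular_group n" by (rule group_unitriangular)
  let ?x = "transvection n 0 (Suc i) 1" and ?y = "transvection n (Suc i) (Suc (Suc i)) 1"
    and ?c = "transvection n 0 (Suc (Suc i)) 1"
  have U: "?x \<in> U n" "?y \<in> U n" "?c \<in> U n" by (simp_all add: transvection_in_U)
  have "?c * (?y * ?x) = ?x * ?y"
  proof (rule eq_matI)
    fix k l assume "k < dim_row (?x * ?y)" "l < dim_col (?x * ?y)"
    then have "k < n" "l < n" by (auto simp: transvection_def)
    then show "(?c * (?y * ?x)) $$ (k, l) = (?x * ?y) $$ (k, l)"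
      using Suc.prems U_carrier[OF U(1)] U_carrier[OF U(2)] mult_carrier_mat[OF U_carrier[OF U(2)] U_carrier[OF U(1)]]
      by (auto simp: transvection_mult simp del: index_mult_mat) (auto simp: transvection_def)
  qed (auto simp: transvection_def)
  then have "?c = commutator (unitriangular_group n) ?x ?y"
    using commutator_eq_iff[OF U] by simp
  moreover have "?x \<in> lower_central (unitriangular_group n) i" using Suc by simp
  ultimately show ?case using commutator_in_lower_central[OF _ U(2)] by simp
qed

text \<open>All superdiagonals have vanished at term \<open>c\<close>, while a corner transvection
  survives in each earlier term. Size \<open>c + 1\<close> realises every class, including
  0.\<close>

lemma nilpotent_unitriangular:
  "nilpotent_group (unitriangular_group (Suc c))" "nilpotency_class (unitriangular_group (Suc c)) = c"
proof -
  let ?G = "unitriangular_group (Suc c)"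
  have "band (Suc c) c \<subseteq> {\<one>\<^bsub>?G\<^esub>}"
    by (auto simp: band_def intro!: U_eqI[of _ "Suc c"] one_in_U)
  moreover have "\<one>\<^bsub>?G\<^esub> \<in> lower_central ?G i" for i
    by (rule subgroup.one_closed[OF group.subgroup_lower_central[OF group_unitriangular]])
  ultimately have triv: "lower_central ?G c = {\<one>\<^bsub>?G\<^esub>}"
    using lower_central_unitriangular[of "Suc c" c] by blast
  then show "nilpotent_group ?G" unfolding nilpotent_group_def using group_unitriangular by blast
  have "c \<le> i" if "lower_central ?G i = {\<one>\<^bsub>?G\<^esub>}" for i
  proof (rule ccontr)
    assume "\<not> c \<le> i"
    then have "transvection (Suc c) 0 (Suc i) 1 = 1\<^sub>m (Suc c)"
      using transvection_in_lower_central[of i "Suc c"] that by simp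
    then have "transvection (Suc c) 0 (Suc i) 1 $$ (0, Suc i) = 1\<^sub>m (Suc c) $$ (0, Suc i)" by simp
    with \<open>\<not> c \<le> i\<close> show False by (simp add: transvection_def)
  qed
  with triv show "nilpotency_class ?G = c" unfolding nilpotency_class_def by (rule Least_equality)
qed

section \<open>Central series with infinite cyclic factors\<close>

lemma (in group) int_pow_commute:
  assumes "a \<in> carrier G" "b \<in> carrier G" "a \<otimes> b = b \<otimes> a"
  shows "a [^] (m::int) \<otimes> b [^] (n::int) = b [^] n \<otimes> a [^] m"
proof -
  have "group_hom G G (\<lambda>x. x)"
    by (intro group_hom.intro group_hom_axioms.intro is_group) (simp add: hom_def)
  note sub = group_hom.subgroup_commuting[OF this]
  have "a \<in> {x \<in> carrier G. x \<otimes> b = b \<otimes> x}" using assms by simp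
  then have am: "a [^] m \<in> {x \<in> carrier G. x \<otimes> b = b \<otimes> x}"
    by (rule subgroup_int_pow_closed[OF sub[OF assms(2)]])
  then have amG: "a [^] m \<in> carrier G" by simp
  have "b \<in> {x \<in> carrier G. x \<otimes> a [^] m = a [^] m \<otimes> x}" using am assms(2) by simp
  then have "b [^] n \<in> {x \<in> carrier G. x \<otimes> a [^] m = a [^] m \<otimes> x}"
    by (rule subgroup_int_pow_closed[OF sub[OF amG]])
  then show ?thesis by simp
qed

text \<open>If \<open>b\<close> is a rational power of \<open>a\<close>, Bezout's identity makes \<open>a\<close> and \<open>b\<close> powers of one
  element.\<close>

lemma (in group) common_root:
  assumes ab: "a \<in> carrier G" "b \<in> carrier G" "a \<otimes> b = b \<otimes> a"
    and tf: "\<And>(m::int) (n::int) (d::int). d > 0 \<Longrightarrow> (b [^] m \<otimes> a [^] n) [^] d = \<one> \<Longrightarrow> b [^] m \<otimes> a [^] n = \<one>"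
    and eq: "b [^] (k::int) = a [^] (j::int)" and k: "k > 0"
  obtains p q m n :: int where "(a [^] p \<otimes> b [^] q) [^] m = a" "(a [^] p \<otimes> b [^] q) [^] n = b"
proof -
  \<comment> \<open>The assumption on torsion allows the relation to be divided by the gcd. With p
    k' + q j' = 1 the common root is c = a^p b^q: then c^k' = a and c^j' = b.\<close>
  define d k' j' where "d = gcd k j" and "k' = k div d" and "j' = j div d"
  have d: "d > 0" "k = k' * d" "j = j' * d" using k by (auto simp: d_def k'_def j'_def)
  have "coprime k' j'" unfolding d_def k'_def j'_def using k by (intro div_gcd_coprime) simp
  then obtain p q where pq: "p * k' + q * j' = 1" using bezout_int[of k' j'] by auto
  note comm = int_pow_commute[OF ab]
  have "(b [^] k' \<otimes> a [^] (- j')) [^] d = b [^] k \<otimes> a [^] (- j)"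
    using ab comm by (subst int_pow_mult_distrib) (simp_all add: int_pow_pow d)
  also have "\<dots> = \<one>" using ab by (simp add: eq int_pow_neg)
  finally have "b [^] k' \<otimes> a [^] (- j') = \<one>" by (rule tf[OF d(1)])
  then have root: "b [^] k' = a [^] j'"
    using ab by (simp add: int_pow_neg) (metis int_pow_closed inv_equality inv_inv inv_closed)
  have pow: "(a [^] p \<otimes> b [^] q) [^] m = a [^] (p * m) \<otimes> b [^] (q * m)" for m
    using ab comm by (subst int_pow_mult_distrib) (simp_all add: int_pow_pow)
  have "b [^] (q * k') = a [^] (q * j')"
    using root ab int_pow_pow[OF ab(2), of k' q] int_pow_pow[OF ab(1), of j' q] by (simp add: mult.commute)
  then have "(a [^] p \<otimes> b [^] q) [^] k' = a [^] (p * k' + q * j')"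
    unfolding pow using ab by (simp add: int_pow_mult)
  moreover have "a [^] (p * j') = b [^] (p * k')"
    using root ab int_pow_pow[OF ab(2), of k' p] int_pow_pow[OF ab(1), of j' p] by (simp add: mult.commute)
  then have "(a [^] p \<otimes> b [^] q) [^] j' = b [^] (p * k' + q * j')"
    unfolding pow using ab by (simp add: int_pow_mult)
  ultimately show ?thesis using that[of p q k' j'] ab pq by simp
qed

text \<open>The rule [a^k, b] = [a, b]^k for a commutator that commutes with \<open>a\<close>,
  written without inverses.\<close>

lemma (in group) pow_commutator:
  assumes "a \<in> carrier G" "b \<in> carrier G" "u \<in> carrier G" "u \<otimes> (b \<otimes> a) = a \<otimes> b" "u \<otimes> a = a \<otimes> u"
  shows "a [^] (k::nat) \<otimes> b = u [^] k \<otimes> (b \<otimes> a [^] k)"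
proof (induction k)
  case (Suc k)
  have c: "a [^] k \<otimes> u = u \<otimes> a [^] k" using assms by (intro group_commutes_pow) simp_all
  have "a [^] Suc k \<otimes> b = a [^] k \<otimes> (u \<otimes> (b \<otimes> a))" using assms by (simp add: m_assoc)
  also have "\<dots> = (u \<otimes> a [^] k) \<otimes> (b \<otimes> a)" using assms(1-3) by (simp add: c flip: m_assoc)
  also have "\<dots> = u \<otimes> (a [^] k \<otimes> b) \<otimes> a" using assms(1-3) by (simp add: m_assoc)
  also have "\<dots> = u \<otimes> (u [^] k \<otimes> (b \<otimes> a [^] k)) \<otimes> a" by (simp add: Suc)
  also have "\<dots> = (u \<otimes> u [^] k) \<otimes> (b \<otimes> a [^] Suc k)" using assms(1-3) by (simp add: m_assoc)
  also have "u \<otimes> u [^] k = u [^] Suc k" using assms(3) by (simp add: nat_pow_comm[of u 1 k, simplified])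
  finally show ?case .
qed (use assms in simp)

section \<open>Isolated subgroups and upper central series\<close>

context group begin

text \<open>For normal \<open>K\<close> it means that G/K is torsion-free.\<close>

definition isolated :: "'a set \<Rightarrow> bool" where
  "isolated K \<longleftrightarrow> (\<forall>x \<in> carrier G. \<forall>k::nat. k > 0 \<longrightarrow> x [^] k \<in> K \<longrightarrow> x \<in> K)"

text \<open>The preimages of the upper central series of G/K.\<close>

primrec upper_central_mod :: "'a set \<Rightarrow> nat \<Rightarrow> 'a set" where
  "upper_central_mod K 0 = K"
| "upper_central_mod K (Suc i) = central_mod (upper_central_mod K i)"

lemma normal_upper_central_mod: "K \<lhd> G \<Longrightarrow> upper_central_mod K i \<lhd> G"
  by (induction i) (simp_all add: normal_central_mod)

lemma central_mod_mono: "K \<subseteq> L \<Longrightarrow> central_mod K \<subseteq> central_mod L"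
  unfolding central_mod_def by (intro subsetI CollectI) (simp add: subsetD)

lemma upper_central_mod_eq_carrier:
  assumes "K \<lhd> G" "lower_central G c = {\<one>}"
  shows "upper_central_mod K c = carrier G"
proof
  show "upper_central_mod K c \<subseteq> carrier G"
    using normal_imp_subgroup[OF normal_upper_central_mod[OF assms(1)]] by (rule subgroup.subset)
  have "lower_central G (c - i) \<subseteq> upper_central_mod K i" if "i \<le> c" for i
    using that
  proof (induction i)
    case 0
    show ?case using assms(2) subgroup.one_closed[OF normal_imp_subgroup[OF assms(1)]] by simp
  next
    case (Suc i)
    have i: "Suc (c - Suc i) = c - i" using Suc.prems by simp
    have "lower_central G (c - Suc i) \<subseteq> central_mod (lower_central G (c - i))"
      using lower_central_central_mod[of "c - Suc i"] unfolding i .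
    also have "\<dots> \<subseteq> central_mod (upper_central_mod K i)" using Suc by (intro central_mod_mono) simp
    finally show ?case by simp
  qed
  from this[of c] show "carrier G \<subseteq> upper_central_mod K c" by simp
qed

text \<open>Let Z_i be the terms of the series, \<open>x\<close> in Z_(i+2) and x^k in Z_(i+1). Each
  u = [x, y] lies in Z_(i+1), hence is central modulo Z_i, and u^k = [x^k, y] = 1 modulo Z_i. By
  induction u lies in Z_i, so \<open>x\<close> lies in Z_(i+1).\<close>

lemma upper_central_mod_root:
  assumes K: "K \<lhd> G" "isolated K" and k: "k > 0"
  shows "x \<in> upper_central_mod K (Suc i) \<Longrightarrow> x [^] (k::nat) \<in> upper_central_mod K i \<Longrightarrow>
    x \<in> upper_central_mod K i"
proof (induction i arbitrary: x)
  case 0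
  then have "x \<in> carrier G" using central_mod_subset by auto
  then show ?case using K(2) k 0(2) unfolding isolated_def by simp
next
  case (Suc i)
  let ?Z = "upper_central_mod K i"
  have x: "x \<in> carrier G" using Suc.prems(1) central_mod_subset by auto
  obtain Q :: "'a set monoid" and \<pi> where hom: "group_hom G Q \<pi>"
    and ker: "\<And>x. x \<in> carrier G \<Longrightarrow> \<pi> x = \<one>\<^bsub>Q\<^esub> \<longleftrightarrow> x \<in> ?Z"
    using quotient_map[OF normal_upper_central_mod[OF K(1), of i]] by metis
  interpret h: group_hom G Q \<pi> by (rule hom)
  have commute: "\<pi> v \<otimes>\<^bsub>Q\<^esub> \<pi> w = \<pi> w \<otimes>\<^bsub>Q\<^esub> \<pi> v"
    if "v \<in> upper_central_mod K (Suc i)" "w \<in> carrier G" for v w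
  proof -
    have "v \<in> carrier G" "commutator G v w \<in> ?Z" using that by (auto simp: central_mod_def)
    then show ?thesis
      using h.hom_commutator_eq_one_iff[OF _ that(2), of v] ker[of "commutator G v w"] that(2) by simp
  qed
  have "commutator G x y \<in> ?Z" if y: "y \<in> carrier G" for y
  proof -
    let ?u = "commutator G x y"
    have u: "?u \<in> carrier G" using x y by simp
    have uZ: "?u \<in> upper_central_mod K (Suc i)"
      using Suc.prems(1) y by (simp add: central_mod_def)
    have "\<pi> ?u \<otimes>\<^bsub>Q\<^esub> (\<pi> y \<otimes>\<^bsub>Q\<^esub> \<pi> x) = \<pi> x \<otimes>\<^bsub>Q\<^esub> \<pi> y"
      using x y u commutator_mult[OF x y] by (metis h.hom_mult m_closed)
    then have "\<pi> x [^]\<^bsub>Q\<^esub> k \<otimes>\<^bsub>Q\<^esub> \<pi> y = \<pi> ?u [^]\<^bsub>Q\<^esub> k \<otimes>\<^bsub>Q\<^esub> (\<pi> y \<otimes>\<^bsub>Q\<^esub> \<pi> x [^]\<^bsub>Q\<^esub> k)"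
      using x y u commute[OF uZ x] by (intro h.H.pow_commutator) simp_all
    moreover have "\<pi> x [^]\<^bsub>Q\<^esub> k \<otimes>\<^bsub>Q\<^esub> \<pi> y = \<pi> y \<otimes>\<^bsub>Q\<^esub> \<pi> x [^]\<^bsub>Q\<^esub> k"
      using commute[OF Suc.prems(2) y] x by (simp add: h.hom_nat_pow)
    ultimately have "\<pi> ?u [^]\<^bsub>Q\<^esub> k \<otimes>\<^bsub>Q\<^esub> (\<pi> y \<otimes>\<^bsub>Q\<^esub> \<pi> x [^]\<^bsub>Q\<^esub> k) = \<pi> y \<otimes>\<^bsub>Q\<^esub> \<pi> x [^]\<^bsub>Q\<^esub> k"
      by simp
    then have "\<pi> ?u [^]\<^bsub>Q\<^esub> k = \<one>\<^bsub>Q\<^esub>"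
      using x y u by (subst (asm) h.H.r_cancel_one) simp_all
    then have "?u [^] k \<in> ?Z" using ker[of "?u [^] k"] u by (simp add: h.hom_nat_pow)
    then show ?thesis by (rule Suc.IH[OF uZ])
  qed
  then show ?case using x by (simp add: central_mod_def)
qed

text \<open>The series reaches the whole group, so a root of an element of
  \<open>central_mod K\<close> lies in some term; as the power lies in all terms from the first on,
  the root descends one term at a time.\<close>

lemma isolated_central_mod:
  assumes K: "K \<lhd> G" "isolated K" and c: "lower_central G c = {\<one>}"
  shows "isolated (central_mod K)"
  unfolding isolated_def
proof (intro ballI allI impI)
  fix x and k :: nat assume x: "x \<in> carrier G" and k: "k > 0" "x [^] k \<in> central_mod K"
  have incr: "upper_central_mod K i \<subseteq> upper_central_mod K (Suc i)" for i
    using subset_central_mod[OF normal_upper_central_mod[OF K(1)]] by simp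
  have mono: "upper_central_mod K (Suc 0) \<subseteq> upper_central_mod K (Suc i)" for i
    by (rule lift_Suc_mono_le[of "upper_central_mod K", OF incr]) simp
  have "x \<in> upper_central_mod K (Suc i) \<Longrightarrow> x \<in> central_mod K" for i
  proof (induction i)
    case (Suc i)
    have "x [^] k \<in> upper_central_mod K (Suc i)" using k(2) mono[of i] by auto
    then show ?case by (intro Suc.IH upper_central_mod_root[OF K k(1) Suc.prems])
  qed simp
  moreover have "x \<in> upper_central_mod K (Suc c)"
    using incr[of c] upper_central_mod_eq_carrier[OF K(1) c] x by auto
  ultimately show "x \<in> central_mod K" by blast
qed

text \<open>Otherwise the upper central series modulo \<open>K\<close> would be stuck at
  \<open>K\<close>.\<close>

lemma central_mod_nontrivial:
  assumes "K \<lhd> G" "lower_central G c = {\<one>}" "K \<noteq> carrier G"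
  obtains x where "x \<in> central_mod K" "x \<notin> K"
proof (cases "central_mod K \<subseteq> K")
  case True
  then have "central_mod K = K" using subset_central_mod[OF assms(1)] by (rule equalityI)
  then have "upper_central_mod K i = K" for i by (induction i) simp_all
  then show ?thesis using upper_central_mod_eq_carrier[OF assms(1,2)] assms(3) by metis
qed (use that in auto)

end

section \<open>Construction of the series\<close>

text \<open>The condition on powers of \<open>x\<close> makes each factor infinite cyclic; each
  group to which an element is adjoined is normal in the whole group.\<close>

inductive poly_Z :: "('g, 'm) monoid_scheme \<Rightarrow> 'g set \<Rightarrow> bool" for G where
  poly_Z_one: "poly_Z G {\<one>\<^bsub>G\<^esub>}"
| poly_Z_adjoin: "poly_Z G K \<Longrightarrow> K \<lhd> G \<Longrightarrow> x \<in> carrier G \<Longrightarrow> (\<And>n::int. x [^]\<^bsub>G\<^esub> n \<in> K \<Longrightarrow> n = 0) \<Longrightarrow>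
    poly_Z G (group.adjoin G K x)"

context group begin

lemma isolated_int_pow:
  assumes "isolated K" "subgroup K G" "x \<in> carrier G" "(n::int) \<noteq> 0" "x [^] n \<in> K"
  shows "x \<in> K"
proof -
  have "x [^] (nat \<bar>n\<bar>) \<in> K"
  proof (cases "n > 0")
    case True
    then show ?thesis using assms(5) int_pow_int[of G x "nat n"] by simp
  next
    case False
    then have "x [^] (- n) \<in> K" using subgroup.m_inv_closed[OF assms(2,5)] assms(3) by (simp add: int_pow_neg)
    then show ?thesis using False int_pow_int[of G x "nat (- n)"] by simp
  qed
  moreover have "nat \<bar>n\<bar> > 0" using assms(4) by simp
  ultimately show ?thesis using assms(1,3) unfolding isolated_def by blast
qed

lemma adjoin_subset_central_mod: "K \<lhd> G \<Longrightarrow> x \<in> central_mod K \<Longrightarrow> adjoin K x \<subseteq> central_mod K"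
  by (rule adjoin_least[OF subgroup_central_mod subset_central_mod])

text \<open>If a power of \<open>y\<close> lies in K<x>, then \<open>y\<close> is central modulo
  \<open>K\<close>, and there it is a rational power of \<open>x\<close>. Hence \<open>x\<close> and
  \<open>y\<close> are powers of a common root z modulo \<open>K\<close>; maximality of K<x> gives
  K<z> = K<x>, which contains \<open>y\<close>.\<close>

lemma isolated_maximal_adjoin:
  assumes K: "K \<lhd> G" "isolated K" and c: "lower_central G c = {\<one>}"
    and x: "x \<in> central_mod K" "x \<notin> K"
    and max: "\<And>z. z \<in> central_mod K \<Longrightarrow> z \<notin> K \<Longrightarrow> adjoin K x \<subseteq> adjoin K z \<Longrightarrow> adjoin K z = adjoin K x"
  shows "isolated (adjoin K x)"
  unfolding isolated_def
proof (intro ballI allI impI)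
  fix y and k :: nat assume y: "y \<in> carrier G" and k: "k > 0" "y [^] k \<in> adjoin K x"
  have xG: "x \<in> carrier G" using x(1) central_mod_subset by auto
  have KG: "K \<subseteq> carrier G" using normal_imp_subgroup[OF K(1)] by (rule subgroup.subset)
  have "y [^] k \<in> central_mod K" using k(2) adjoin_subset_central_mod[OF K(1) x(1)] by auto
  then have yZ: "y \<in> central_mod K"
    using isolated_central_mod[OF K c] y k(1) unfolding isolated_def by simp
  obtain Q :: "'a set monoid" and \<pi> where hom: "group_hom G Q \<pi>"
    and ker: "\<And>x. x \<in> carrier G \<Longrightarrow> \<pi> x = \<one>\<^bsub>Q\<^esub> \<longleftrightarrow> x \<in> K"
    using quotient_map[OF K(1)] by metis
  interpret h: group_hom G Q \<pi> by (rule hom)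
  have mem: "g \<in> adjoin K x \<longleftrightarrow> (\<exists>n::int. \<pi> g = \<pi> x [^]\<^bsub>Q\<^esub> n)"
    if "x \<in> carrier G" "g \<in> carrier G" for x g
    using that by (intro h.mem_adjoin_iff KG ker)
  have "commutator G x y \<in> K" using x(1) y by (simp add: central_mod_def)
  then have comm: "\<pi> x \<otimes>\<^bsub>Q\<^esub> \<pi> y = \<pi> y \<otimes>\<^bsub>Q\<^esub> \<pi> x"
    using h.hom_commutator_eq_one_iff[OF xG y] ker[of "commutator G x y"] xG y by simp
  obtain j :: int where "\<pi> (y [^] k) = \<pi> x [^]\<^bsub>Q\<^esub> j"
    using mem[OF xG, of "y [^] k"] k(2) y by auto
  then have j: "\<pi> y [^]\<^bsub>Q\<^esub> (int k) = \<pi> x [^]\<^bsub>Q\<^esub> j" using y by (simp add: int_pow_int h.hom_nat_pow)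
  have tf: "\<pi> y [^]\<^bsub>Q\<^esub> m \<otimes>\<^bsub>Q\<^esub> \<pi> x [^]\<^bsub>Q\<^esub> n = \<one>\<^bsub>Q\<^esub>"
    if "d > 0" "(\<pi> y [^]\<^bsub>Q\<^esub> m \<otimes>\<^bsub>Q\<^esub> \<pi> x [^]\<^bsub>Q\<^esub> n) [^]\<^bsub>Q\<^esub> d = \<one>\<^bsub>Q\<^esub>" for m n d :: int
  proof -
    let ?g = "y [^] m \<otimes> x [^] n"
    have g: "?g \<in> carrier G" and pg: "\<pi> ?g = \<pi> y [^]\<^bsub>Q\<^esub> m \<otimes>\<^bsub>Q\<^esub> \<pi> x [^]\<^bsub>Q\<^esub> n"
      using xG y by (simp_all add: h.hom_int_pow)
    have "\<pi> (?g [^] d) = \<one>\<^bsub>Q\<^esub>" using that(2) h.hom_int_pow[OF g, of d] pg by simp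
    then have "?g [^] d \<in> K" using ker[of "?g [^] d"] g by simp
    moreover have "d \<noteq> 0" using that(1) by simp
    ultimately have "?g \<in> K" using isolated_int_pow[OF K(2) normal_imp_subgroup[OF K(1)] g] by metis
    then show ?thesis using ker[OF g] pg by simp
  qed
  have "\<exists>(p::int) (q::int) (m::int) (n::int). (\<pi> x [^]\<^bsub>Q\<^esub> p \<otimes>\<^bsub>Q\<^esub> \<pi> y [^]\<^bsub>Q\<^esub> q) [^]\<^bsub>Q\<^esub> m = \<pi> x \<and>
      (\<pi> x [^]\<^bsub>Q\<^esub> p \<otimes>\<^bsub>Q\<^esub> \<pi> y [^]\<^bsub>Q\<^esub> q) [^]\<^bsub>Q\<^esub> n = \<pi> y"
  proof (rule h.H.common_root[OF h.hom_closed[OF xG] h.hom_closed[OF y] comm _ j])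
    show "int k > 0" using k(1) by simp
    show "\<pi> y [^]\<^bsub>Q\<^esub> m \<otimes>\<^bsub>Q\<^esub> \<pi> x [^]\<^bsub>Q\<^esub> n = \<one>\<^bsub>Q\<^esub>"
      if "d > 0" "(\<pi> y [^]\<^bsub>Q\<^esub> m \<otimes>\<^bsub>Q\<^esub> \<pi> x [^]\<^bsub>Q\<^esub> n) [^]\<^bsub>Q\<^esub> d = \<one>\<^bsub>Q\<^esub>" for m n d :: int
      using that by (rule tf)
  qed ((rule exI)+, rule conjI, assumption, assumption)
  then obtain p q m n :: int where
    pq: "(\<pi> x [^]\<^bsub>Q\<^esub> p \<otimes>\<^bsub>Q\<^esub> \<pi> y [^]\<^bsub>Q\<^esub> q) [^]\<^bsub>Q\<^esub> m = \<pi> x"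
      "(\<pi> x [^]\<^bsub>Q\<^esub> p \<otimes>\<^bsub>Q\<^esub> \<pi> y [^]\<^bsub>Q\<^esub> q) [^]\<^bsub>Q\<^esub> n = \<pi> y" by (elim exE conjE)
  let ?z = "x [^] p \<otimes> y [^] q"
  have z: "?z \<in> carrier G" and pz: "\<pi> ?z = \<pi> x [^]\<^bsub>Q\<^esub> p \<otimes>\<^bsub>Q\<^esub> \<pi> y [^]\<^bsub>Q\<^esub> q"
    using xG y by (simp_all add: h.hom_int_pow)
  have zZ: "?z \<in> central_mod K"
    using subgroup_int_pow_closed[OF subgroup_central_mod[OF K(1)]] x(1) yZ
    by (intro subgroup.m_closed[OF subgroup_central_mod[OF K(1)]]) simp_all
  have xz: "x \<in> adjoin K ?z" and yz: "y \<in> adjoin K ?z"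
    using mem[OF z xG] mem[OF z y] pq unfolding pz by metis+
  have "?z \<notin> K"
  proof
    assume "?z \<in> K"
    then have "adjoin K ?z \<subseteq> K" by (intro adjoin_least normal_imp_subgroup[OF K(1)] subset_refl)
    then show False using xz x(2) by auto
  qed
  moreover have "adjoin K x \<subseteq> adjoin K ?z"
    by (rule adjoin_least[OF subgroup_adjoin[OF K(1) z] adjoin_superset(1)[OF K(1) z] xz])
  ultimately have "adjoin K ?z = adjoin K x" by (rule max[OF zZ])
  then show "y \<in> adjoin K x" using yz by simp
qed

text \<open>The maximal condition is used twice: for the largest isolated normal term
  \<open>K\<close> of such a series, and, if \<open>K\<close> is not everything, for a maximal
  cyclic extension of \<open>K\<close> inside \<open>central_mod K\<close>, which would be a larger
  term.\<close>

lemma poly_Z_carrier: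
  assumes S: "finite S" "S \<subseteq> carrier G" "generate G S = carrier G" and c: "lower_central G c = {\<one>}"
    and tf: "\<And>x k. x \<in> carrier G \<Longrightarrow> k > 0 \<Longrightarrow> x [^] (k::nat) = \<one> \<Longrightarrow> x = \<one>"
  shows "poly_Z G (carrier G)"
proof -
  note noeth = noetherian_nilpotent[OF S c]
  let ?F = "{K. K \<lhd> G \<and> isolated K \<and> poly_Z G K}"
  have "{\<one>} \<lhd> G" by (rule one_is_normal)
  moreover have "isolated {\<one>}" using tf unfolding isolated_def by simp
  ultimately have "{\<one>} \<in> ?F" by (simp add: poly_Z_one)
  then obtain K where "K \<in> ?F" and max: "\<And>L. L \<in> ?F \<Longrightarrow> K \<subseteq> L \<Longrightarrow> L = K"
    using noetherian_maximal[OF noeth, of ?F] normal_imp_subgroup by auto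
  then have K: "K \<lhd> G" "isolated K" "poly_Z G K" by auto
  have "K = carrier G"
  proof (rule ccontr)
    assume "K \<noteq> carrier G"
    then obtain x0 where x0: "x0 \<in> central_mod K" "x0 \<notin> K"
      by (rule central_mod_nontrivial[OF K(1) c])
    let ?E = "adjoin K ` (central_mod K - K)"
    have ne: "?E \<noteq> {}" using x0 by auto
    have sub: "subgroup M G" if "M \<in> ?E" for M
      using that central_mod_subset subgroup_adjoin[OF K(1)] by auto
    obtain M where M: "M \<in> ?E" and maxE: "\<And>L. L \<in> ?E \<Longrightarrow> M \<subseteq> L \<Longrightarrow> L = M"
      using noetherian_maximal[OF noeth ne sub] by auto
    from M obtain x where x: "x \<in> central_mod K" "x \<notin> K" "M = adjoin K x" by auto
    have xG: "x \<in> carrier G" using x(1) central_mod_subset by auto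
    note sup = adjoin_superset[OF K(1) xG]
    have "isolated (adjoin K x)"
      using maxE x by (intro isolated_maximal_adjoin[OF K(1,2) c]) auto
    moreover have "adjoin K x \<lhd> G"
      by (rule normal_if_central_mod[OF K(1) subgroup_adjoin[OF K(1) xG] sup(1)
            adjoin_subset_central_mod[OF K(1) x(1)]])
    moreover have "n = 0" if "x [^] n \<in> K" for n :: int
      using isolated_int_pow[OF K(2) normal_imp_subgroup[OF K(1)] xG _ that] x(2) by auto
    then have "poly_Z G (adjoin K x)" by (rule poly_Z_adjoin[OF K(3,1) xG])
    ultimately have "adjoin K x = K" by (intro max sup(1)) simp
    then show False using sup(2) x(2) by simp
  qed
  then show ?thesis using K(3) by simp
qed

end

section \<open>Polynomial functions on groups\<close>

text \<open>Off the carrier a shift changes nothing and a difference is 0. Thus a shift is the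
  function plus its difference as an equation on the whole type, as membership in lattices of
  functions requires.\<close>

definition shift :: "('g, 'm) monoid_scheme \<Rightarrow> 'g \<Rightarrow> ('g \<Rightarrow> int) \<Rightarrow> 'g \<Rightarrow> int" where
  "shift G g f = (\<lambda>y. if y \<in> carrier G then f (g \<otimes>\<^bsub>G\<^esub> y) else f y)"

definition diff :: "('g, 'm) monoid_scheme \<Rightarrow> 'g \<Rightarrow> ('g \<Rightarrow> int) \<Rightarrow> 'g \<Rightarrow> int" where
  "diff G g f = (\<lambda>y. if y \<in> carrier G then f (g \<otimes>\<^bsub>G\<^esub> y) - f y else 0)"

text \<open>Polynomial on \<open>H\<close> of degree strictly less than \<open>d\<close>; the bound
  0 leaves only functions vanishing on \<open>H\<close>.\<close>

primrec poly_below :: "('g, 'm) monoid_scheme \<Rightarrow> 'g set \<Rightarrow> nat \<Rightarrow> ('g \<Rightarrow> int) \<Rightarrow> bool" where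
  "poly_below G H 0 f \<longleftrightarrow> (\<forall>y \<in> H. f y = 0)"
| "poly_below G H (Suc d) f \<longleftrightarrow> (\<forall>g \<in> H. poly_below G H d (diff G g f))"

text \<open>A difference by an element of the \<open>j\<close>-th term of the lower central series (counted from zero)
  lowers the weighted degree by \<open>j + 1\<close>.\<close>

fun wpoly_below :: "('g, 'm) monoid_scheme \<Rightarrow> 'g set \<Rightarrow> nat \<Rightarrow> ('g \<Rightarrow> int) \<Rightarrow> bool" where
  "wpoly_below G K 0 f \<longleftrightarrow> (\<forall>y \<in> K. f y = 0)"
| "wpoly_below G K (Suc w) f \<longleftrightarrow>
     (\<forall>j. \<forall>n \<in> K \<inter> lower_central G j. wpoly_below G K (w - j) (diff G n f))"

declare wpoly_below.simps(2) [simp del]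

context group begin

lemma diff_lin: "diff G g (\<lambda>y. a * f y + b * h y) = (\<lambda>y. a * diff G g f y + b * diff G g h y)"
  by (auto simp: diff_def algebra_simps)

lemma poly_below_cong:
  assumes "subgroup H G"
  shows "(\<And>y. y \<in> H \<Longrightarrow> f y = h y) \<Longrightarrow> poly_below G H d f \<longleftrightarrow> poly_below G H d h"
proof (induction d arbitrary: f h)
  case (Suc d)
  have "diff G g f y = diff G g h y" if "g \<in> H" "y \<in> H" for g y
    using Suc.prems that subgroup.m_closed[OF assms that] by (simp add: diff_def)
  then have "poly_below G H d (diff G g f) \<longleftrightarrow> poly_below G H d (diff G g h)" if "g \<in> H" for g
    using that by (intro Suc.IH)
  then show ?case by simp
qed simp

lemma poly_below_Suc:
  assumes "subgroup H G"
  shows "poly_below G H d f \<Longrightarrow> poly_below G H (Suc d) f"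
proof (induction d arbitrary: f)
  case 0
  have "diff G g f y = 0" if "g \<in> H" "y \<in> H" for g y
    using 0 that subgroup.m_closed[OF assms that] by (simp add: diff_def)
  then show ?case by simp
next
  case (Suc d)
  show ?case unfolding poly_below.simps(2)[of _ _ "Suc d"]
    using Suc.prems by (intro ballI Suc.IH) simp
qed

lemma poly_below_mono:
  assumes "subgroup H G" "poly_below G H d f" "d \<le> e"
  shows "poly_below G H e f"
  using assms(3)
proof (induction e rule: dec_induct)
  case base
  then show ?case by (rule assms(2))
next
  case (step e)
  then show ?case by (intro poly_below_Suc[OF assms(1)])
qed

lemma poly_below_lin:
  "poly_below G H d f \<Longrightarrow> poly_below G H d h \<Longrightarrow> poly_below G H d (\<lambda>y. a * f y + b * h y)"
  by (induction d arbitrary: f h) (simp_all add: diff_lin)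

text \<open>The bound \<open>Suc w\<close> drops by \<open>j + 1\<close>. Truncated subtraction
  makes the difference vanish on \<open>K\<close> as soon as \<open>j \<ge> w\<close>.\<close>

lemma wpoly_below_SucD:
  "wpoly_below G K (Suc w) f \<Longrightarrow> n \<in> K \<Longrightarrow> n \<in> lower_central G j \<Longrightarrow> wpoly_below G K (w - j) (diff G n f)"
  by (simp add: wpoly_below.simps(2))

lemma wpoly_below_SucI:
  "(\<And>j n. n \<in> K \<Longrightarrow> n \<in> lower_central G j \<Longrightarrow> wpoly_below G K (w - j) (diff G n f)) \<Longrightarrow>
    wpoly_below G K (Suc w) f"
  by (simp add: wpoly_below.simps(2))

lemma wpoly_below_cong:
  assumes "subgroup K G"
  shows "(\<And>y. y \<in> K \<Longrightarrow> f y = h y) \<Longrightarrow> wpoly_below G K w f \<Longrightarrow> wpoly_below G K w h"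
proof (induction w arbitrary: f h rule: less_induct)
  case (less w)
  show ?case
  proof (cases w)
    case 0
    then show ?thesis using less.prems by simp
  next
    case (Suc v)
    show ?thesis unfolding Suc
    proof (rule wpoly_below_SucI)
      fix j n assume n: "n \<in> K" "n \<in> lower_central G j"
      show "wpoly_below G K (v - j) (diff G n h)"
      proof (rule less.IH[of "v - j" "diff G n f" "diff G n h"])
        show "v - j < w" using Suc by simp
        show "diff G n f y = diff G n h y" if "y \<in> K" for y
          using less.prems(1) that subgroup.m_closed[OF assms n(1) that] by (simp add: diff_def)
        show "wpoly_below G K (v - j) (diff G n f)"
          using less.prems(2) n unfolding Suc by (intro wpoly_below_SucD)
      qed
    qed
  qed
qed

lemma wpoly_below_mono:
  assumes "subgroup K G"
  shows "wpoly_below G K v f \<Longrightarrow> v \<le> w \<Longrightarrow> wpoly_below G K w f"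
proof (induction w arbitrary: v f rule: less_induct)
  case (less w)
  show ?case
  proof (cases w)
    case 0
    then show ?thesis using less.prems by simp
  next
    case (Suc u)
    show ?thesis unfolding Suc
    proof (rule wpoly_below_SucI)
      fix j n assume n: "n \<in> K" "n \<in> lower_central G j"
      show "wpoly_below G K (u - j) (diff G n f)"
      proof (cases v)
        case 0
        then have "diff G n f y = 0" if "y \<in> K" for y
          using less.prems(1) that subgroup.m_closed[OF assms n(1) that] by (simp add: diff_def)
        then have "wpoly_below G K 0 (diff G n f)" by simp
        moreover have "u - j < w" using Suc by simp
        ultimately show ?thesis by (intro less.IH[of "u - j" 0]) simp_all
      next
        case (Suc t)
        have "wpoly_below G K (t - j) (diff G n f)"
          using less.prems(1) n unfolding Suc by (intro wpoly_below_SucD)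
        moreover have "u - j < w" "t - j \<le> u - j" using \<open>w = Suc u\<close> Suc less.prems(2) by simp_all
        ultimately show ?thesis by (intro less.IH[of "u - j" "t - j"])
      qed
    qed
  qed
qed

lemma wpoly_below_zero:
  assumes "subgroup K G" "\<And>y. y \<in> K \<Longrightarrow> f y = 0"
  shows "wpoly_below G K w f"
  by (rule wpoly_below_mono[OF assms(1), of 0]) (simp_all add: assms(2))

lemma wpoly_below_lin:
  "wpoly_below G K w f \<Longrightarrow> wpoly_below G K w h \<Longrightarrow> wpoly_below G K w (\<lambda>y. a * f y + b * h y)"
proof (induction w arbitrary: f h rule: less_induct)
  case (less w)
  show ?case
  proof (cases w)
    case 0
    then show ?thesis using less.prems by simp
  next
    case (Suc u)
    show ?thesis unfolding Suc
    proof (rule wpoly_below_SucI)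
      fix j n assume n: "n \<in> K" "n \<in> lower_central G j"
      show "wpoly_below G K (u - j) (diff G n (\<lambda>y. a * f y + b * h y))"
        unfolding diff_lin using less.prems n unfolding Suc by (intro less.IH wpoly_below_SucD) (simp_all add: Suc)
    qed
  qed
qed

lemma wpoly_below_shift:
  assumes K: "subgroup K G" and f: "wpoly_below G K w f" and m: "m \<in> K"
  shows "wpoly_below G K w (shift G m f)"
proof (cases w)
  case 0
  have "y \<in> carrier G" "m \<otimes> y \<in> K" if "y \<in> K" for y
    using that subgroup.mem_carrier[OF K that] subgroup.m_closed[OF K m that] by simp_all
  then show ?thesis using f unfolding 0 by (simp add: shift_def)
next
  case (Suc u)
  have "wpoly_below G K (u - 0) (diff G m f)"
    using f m subgroup.mem_carrier[OF K m] unfolding Suc by (intro wpoly_below_SucD) simp_all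
  then have "wpoly_below G K w (diff G m f)" unfolding Suc by (rule wpoly_below_mono[OF K]) simp
  from wpoly_below_lin[OF f this, of 1 1] show ?thesis
    by (rule wpoly_below_cong[OF K, rotated]) (simp add: shift_def diff_def)
qed

section \<open>Conjugation and weighted degree\<close>

definition conj_fun :: "'a \<Rightarrow> ('a \<Rightarrow> int) \<Rightarrow> 'a \<Rightarrow> int" where
  "conj_fun t f = (\<lambda>y. f (t \<otimes> y \<otimes> inv t))"

lemma conj_mult:
  "t \<in> carrier G \<Longrightarrow> n \<in> carrier G \<Longrightarrow> y \<in> carrier G \<Longrightarrow>
    t \<otimes> (n \<otimes> y) \<otimes> inv t = (t \<otimes> n \<otimes> inv t) \<otimes> (t \<otimes> y \<otimes> inv t)"
  using m_assoc by (simp add: m_assoc) (simp flip: m_assoc)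

lemma conj_in_normal: "K \<lhd> G \<Longrightarrow> t \<in> carrier G \<Longrightarrow> n \<in> K \<Longrightarrow> t \<otimes> n \<otimes> inv t \<in> K"
  by (rule normal.inv_op_closed2)

text \<open>Conjugation is an automorphism preserving \<open>K\<close> and every lower central term,
  so it permutes the differences of each weight.\<close>

lemma wpoly_below_conj:
  assumes K: "K \<lhd> G" and t: "t \<in> carrier G"
  shows "wpoly_below G K w f \<Longrightarrow> wpoly_below G K w (conj_fun t f)"
proof (induction w arbitrary: f rule: less_induct)
  case (less w)
  note sub = normal_imp_subgroup[OF K]
  show ?case
  proof (cases w)
    case 0
    then show ?thesis using less.prems conj_in_normal[OF K t] by (simp add: conj_fun_def)
  next
    case (Suc u)
    show ?thesis unfolding Suc
    proof (rule wpoly_below_SucI)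
      fix j n assume n: "n \<in> K" "n \<in> lower_central G j"
      let ?n = "t \<otimes> n \<otimes> inv t"
      have nG: "n \<in> carrier G" by (rule subgroup.mem_carrier[OF sub n(1)])
      have n': "?n \<in> K" "?n \<in> lower_central G j"
        using conj_in_normal[OF K t n(1)] conj_in_normal[OF normal_lower_central t n(2)] .
      then have "wpoly_below G K (u - j) (diff G ?n f)"
        using less.prems unfolding Suc by (intro wpoly_below_SucD)
      then have "wpoly_below G K (u - j) (conj_fun t (diff G ?n f))"
        using Suc by (intro less.IH) simp_all
      then show "wpoly_below G K (u - j) (diff G n (conj_fun t f))"
      proof (rule wpoly_below_cong[OF sub, rotated])
        fix y assume "y \<in> K"
        then have y: "y \<in> carrier G" by (rule subgroup.mem_carrier[OF sub])
        show "conj_fun t (diff G ?n f) y = diff G n (conj_fun t f) y"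
          unfolding conj_fun_def diff_def conj_mult[OF t nG y] using t y by simp
      qed
    qed
  qed
qed

text \<open>Conjugation moves \<open>n\<close> by a commutator, which has larger weight than \<open>n\<close>; hence conjugation acts
  unipotently.\<close>

lemma wpoly_below_conj_diff:
  assumes K: "K \<lhd> G" and t: "t \<in> carrier G"
  shows "wpoly_below G K (Suc w) f \<Longrightarrow> wpoly_below G K w (\<lambda>y. conj_fun t f y - f y)"
proof (induction w arbitrary: f rule: less_induct)
  case (less w)
  note sub = normal_imp_subgroup[OF K]
  show ?case
  proof (cases w)
    \<comment> \<open>Weight below 1 means constant on \<open>K\<close>, because every element
      belongs to term 0 of the lower central series.\<close>
    case 0
    have "f y = f \<one>" if y: "y \<in> K" for y
    proof -
      have yG: "y \<in> carrier G" by (rule subgroup.mem_carrier[OF sub y])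
      have "wpoly_below G K (0 - 0) (diff G y f)"
        using less.prems y yG unfolding 0 by (intro wpoly_below_SucD) simp_all
      then have "diff G y f \<one> = 0" using subgroup.one_closed[OF sub] by simp
      then show ?thesis using yG by (simp add: diff_def)
    qed
    then show ?thesis using 0 conj_in_normal[OF K t] by (simp add: conj_fun_def)
  next
    case (Suc v)
    show ?thesis unfolding Suc
    proof (rule wpoly_below_SucI)
      fix j n assume n: "n \<in> K" "n \<in> lower_central G j"
      let ?m = "commutator G t n"
      have nG: "n \<in> carrier G" by (rule subgroup.mem_carrier[OF sub n(1)])
      have mG: "?m \<in> carrier G" using t nG by simp
      have m: "?m \<in> K" "?m \<in> lower_central G (Suc j)"
        using commutator_in_normal(2)[OF K n(1) t] commutator_in_lower_central'[OF n(2) t] .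
      \<comment> \<open>Let m = [t, n], let D denote differences and let a superscript t denote
        conjugation of the argument. As t n t^-1 = m n, D_n (f^t - f) is the conjugate of the
        \<open>n\<close>-shift of D_m f plus (D_n f)^t - D_n f. The element m lies one term deeper
        than \<open>n\<close>; the second summand is covered by induction.\<close>
      have "wpoly_below G K (Suc v - Suc j) (diff G ?m f)"
        using less.prems m unfolding Suc by (intro wpoly_below_SucD)
      then have 1: "wpoly_below G K (v - j) (conj_fun t (shift G n (diff G ?m f)))"
        by (intro wpoly_below_conj[OF K t] wpoly_below_shift[OF sub _ n(1)]) simp
      have dn: "wpoly_below G K (Suc v - j) (diff G n f)"
        using less.prems n unfolding Suc by (intro wpoly_below_SucD)
      have 2: "wpoly_below G K (v - j) (\<lambda>y. conj_fun t (diff G n f) y - diff G n f y)"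
      proof (cases "j \<le> v")
        case True
        then show ?thesis using dn Suc by (intro less.IH) (simp_all add: Suc_diff_le)
      next
        case False
        then have "\<forall>y \<in> K. diff G n f y = 0" using dn by simp
        then show ?thesis using conj_in_normal[OF K t]
          by (intro wpoly_below_zero[OF sub]) (simp add: conj_fun_def)
      qed
      show "wpoly_below G K (v - j) (diff G n (\<lambda>y. conj_fun t f y - f y))"
      proof (rule wpoly_below_cong[OF sub _ wpoly_below_lin[OF 1 2, of 1 1]])
        fix y assume "y \<in> K"
        then have y: "y \<in> carrier G" by (rule subgroup.mem_carrier[OF sub])
        have "t \<otimes> (n \<otimes> y) \<otimes> inv t = ?m \<otimes> (n \<otimes> (t \<otimes> y \<otimes> inv t))"
          using conj_mult[OF t nG y] conj_eq_commutator_mult[OF t nG] t nG y mG by (simp add: m_assoc)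
        then show "1 * conj_fun t (shift G n (diff G ?m f)) y + 1 * (conj_fun t (diff G n f) y - diff G n f y)
            = diff G n (\<lambda>y. conj_fun t f y - f y) y"
          using t nG y by (simp add: conj_fun_def shift_def diff_def)
      qed
    qed
  qed
qed

text \<open>A difference by an element of term \<open>j\<close> costs weight \<open>j + 1\<close>,
  and beyond \<open>j = c\<close> only the identity is left, whose differences are zero. So
  \<open>c + 1\<close> weights pay for one plain degree.\<close>

lemma wpoly_below_if_poly_below:
  assumes K: "subgroup K G" and c: "lower_central G c = {\<one>}"
  shows "poly_below G K d f \<Longrightarrow> wpoly_below G K (Suc c * d) f"
proof (induction d arbitrary: f)
  case (Suc d)
  have "wpoly_below G K (Suc (c + Suc c * d)) f"
  proof (rule wpoly_below_SucI)
    fix j n assume n: "n \<in> K" "n \<in> lower_central G j"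
    show "wpoly_below G K (c + Suc c * d - j) (diff G n f)"
    proof (cases "j \<le> c")
      case True
      have "wpoly_below G K (Suc c * d) (diff G n f)" using Suc n(1) by simp
      then show ?thesis by (rule wpoly_below_mono[OF K]) (use True in simp)
    next
      case False
      then have "n = \<one>" using n(2) lower_central_antimono[of c j] c by auto
      then show ?thesis by (intro wpoly_below_zero[OF K]) (simp add: diff_def)
    qed
  qed
  then show ?case by simp
qed simp

section \<open>Polynomial functions separate points\<close>

text \<open>The coordinate n of k x^n in K<x>, unique when no nonzero power of \<open>x\<close> lies
  in \<open>K\<close>.\<close>

definition exponent_mod :: "'a set \<Rightarrow> 'a \<Rightarrow> 'a \<Rightarrow> int" where
  "exponent_mod K x h = (THE n::int. h \<otimes> inv (x [^] n) \<in> K)"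

definition extend_fun :: "'a set \<Rightarrow> 'a \<Rightarrow> ('a \<Rightarrow> int) \<Rightarrow> 'a \<Rightarrow> int" where
  "extend_fun K x f h = f (h \<otimes> inv (x [^] exponent_mod K x h))"

context
  fixes K x
  assumes K: "K \<lhd> G" and x: "x \<in> carrier G" and free: "\<And>n::int. x [^] n \<in> K \<Longrightarrow> n = 0"
begin

lemma exponent_mod_eq:
  assumes "k \<in> K"
  shows "exponent_mod K x (k \<otimes> x [^] n) = n"
  unfolding exponent_mod_def
proof (rule the_equality)
  note sub = normal_imp_subgroup[OF K]
  have k: "k \<in> carrier G" by (rule subgroup.mem_carrier[OF sub assms])
  have eq: "k \<otimes> x [^] n \<otimes> inv (x [^] m) = k \<otimes> x [^] (n - m)" for m :: int
    using k x by (simp add: int_pow_diff m_assoc)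
  show "k \<otimes> x [^] n \<otimes> inv (x [^] n) \<in> K" unfolding eq using k assms by simp
  fix m :: int assume "k \<otimes> x [^] n \<otimes> inv (x [^] m) \<in> K"
  then have "inv k \<otimes> (k \<otimes> x [^] (n - m)) \<in> K"
    unfolding eq by (rule subgroup.m_closed[OF sub subgroup.m_inv_closed[OF sub assms]])
  then have "x [^] (n - m) \<in> K" using k x by (simp flip: m_assoc)
  then show "m = n" using free by force
qed

lemma extend_fun_eq:
  assumes "k \<in> K"
  shows "extend_fun K x f (k \<otimes> x [^] (n::int)) = f k"
proof -
  have "k \<in> carrier G" by (rule subgroup.mem_carrier[OF normal_imp_subgroup[OF K] assms])
  then show ?thesis using x by (simp add: extend_fun_def exponent_mod_eq[OF assms] m_assoc)
qed

lemma adjoin_mult: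
  assumes "k \<in> K" "l \<in> K"
  shows "k \<otimes> x [^] (m::int) \<otimes> (l \<otimes> x [^] n) =
      (k \<otimes> (x [^] m \<otimes> l \<otimes> inv (x [^] m))) \<otimes> x [^] (m + n)"
    "k \<otimes> (x [^] m \<otimes> l \<otimes> inv (x [^] m)) \<in> K"
proof -
  note sub = normal_imp_subgroup[OF K]
  have kl: "k \<in> carrier G" "l \<in> carrier G" using assms subgroup.mem_carrier[OF sub] by simp_all
  have "inv (x [^] m) \<otimes> (x [^] m \<otimes> x [^] n) = x [^] n" using x by (simp flip: m_assoc)
  then show "k \<otimes> x [^] m \<otimes> (l \<otimes> x [^] n) =
      (k \<otimes> (x [^] m \<otimes> l \<otimes> inv (x [^] m))) \<otimes> x [^] (m + n)"
    using kl x by (simp add: int_pow_mult m_assoc)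
  show "k \<otimes> (x [^] m \<otimes> l \<otimes> inv (x [^] m)) \<in> K"
    using x by (intro subgroup.m_closed[OF sub assms(1)] conj_in_normal[OF K _ assms(2)]) simp
qed

lemma adjoinE:
  assumes "h \<in> adjoin K x"
  obtains k n where "k \<in> K" "h = k \<otimes> x [^] (n::int)"
  using assms unfolding adjoin_def by auto

text \<open>Since (k x^m)(l x^n) = k (x^m l x^-m) x^(m+n), the difference of an extension by k x^m
  is again an extension. It extends (Tf)^s - Tf plus the difference of \<open>f\<close> by k, where
  s = x^m and T is the shift by k; both summands have weight bounded by one less.\<close>

lemma poly_below_extend_fun:
  "wpoly_below G K w f \<Longrightarrow> poly_below G (adjoin K x) w (extend_fun K x f)"
proof (induction w arbitrary: f)
  case 0
  show ?case unfolding poly_below.simps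
  proof
    fix h assume "h \<in> adjoin K x"
    then obtain k n where "k \<in> K" "h = k \<otimes> x [^] (n::int)" by (rule adjoinE)
    then show "extend_fun K x f h = 0" using 0 by (simp add: extend_fun_eq)
  qed
next
  case (Suc w)
  note sub = normal_imp_subgroup[OF K]
  note subH = subgroup_adjoin[OF K x]
  show ?case unfolding poly_below.simps
  proof
    fix g assume g: "g \<in> adjoin K x"
    then obtain k m where k: "k \<in> K" "g = k \<otimes> x [^] (m::int)" by (rule adjoinE)
    let ?s = "x [^] m" and ?T = "shift G k f"
    have s: "?s \<in> carrier G" using x by simp
    have kG: "k \<in> carrier G" by (rule subgroup.mem_carrier[OF sub k(1)])
    define f' where "f' = (\<lambda>y. 1 * (conj_fun ?s ?T y - ?T y) + 1 * diff G k f y)"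
    have "wpoly_below G K w (\<lambda>y. conj_fun ?s ?T y - ?T y)"
      by (rule wpoly_below_conj_diff[OF K s wpoly_below_shift[OF sub Suc.prems k(1)]])
    moreover have "wpoly_below G K (w - 0) (diff G k f)"
      using Suc.prems k(1) kG by (intro wpoly_below_SucD) simp_all
    ultimately have "wpoly_below G K w f'" unfolding f'_def by (intro wpoly_below_lin) simp_all
    then have "poly_below G (adjoin K x) w (extend_fun K x f')" by (rule Suc.IH)
    moreover have "extend_fun K x f' h = diff G g (extend_fun K x f) h" if h: "h \<in> adjoin K x" for h
    proof -
      obtain l n where l: "l \<in> K" "h = l \<otimes> x [^] (n::int)" using h by (rule adjoinE)
      have hG: "h \<in> carrier G" by (rule subgroup.mem_carrier[OF subH h])
      have lG: "l \<in> carrier G" by (rule subgroup.mem_carrier[OF sub l(1)])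
      have "diff G g (extend_fun K x f) h = extend_fun K x f (g \<otimes> h) - extend_fun K x f h"
        using hG by (simp add: diff_def)
      also have "\<dots> = f (k \<otimes> (?s \<otimes> l \<otimes> inv ?s)) - f l"
        unfolding k(2) l(2) adjoin_mult(1)[OF k(1) l(1)]
        using adjoin_mult(2)[OF k(1) l(1)] l(1) by (simp add: extend_fun_eq)
      also have "\<dots> = f' l"
        using lG s by (simp add: f'_def conj_fun_def shift_def diff_def)
      also have "\<dots> = extend_fun K x f' h" unfolding l(2) using l(1) by (simp add: extend_fun_eq)
      finally show ?thesis by simp
    qed
    ultimately show "poly_below G (adjoin K x) w (diff G g (extend_fun K x f))"
      using poly_below_cong[OF subH, of "extend_fun K x f'" "diff G g (extend_fun K x f)" w] by simp
  qed
qed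

text \<open>The exponent is a homomorphism to the integers, so its first differences are constant
  and its second ones vanish.\<close>

lemma poly_below_exponent_mod: "poly_below G (adjoin K x) 2 (exponent_mod K x)"
proof -
  note subH = subgroup_adjoin[OF K x]
  have d: "diff G g (exponent_mod K x) h = exponent_mod K x g"
    if gh: "g \<in> adjoin K x" "h \<in> adjoin K x" for g h
  proof -
    obtain k m where k: "k \<in> K" "g = k \<otimes> x [^] (m::int)" using gh(1) by (rule adjoinE)
    obtain l n where l: "l \<in> K" "h = l \<otimes> x [^] (n::int)" using gh(2) by (rule adjoinE)
    have "exponent_mod K x (g \<otimes> h) = m + n"
      unfolding k(2) l(2) adjoin_mult(1)[OF k(1) l(1)] by (rule exponent_mod_eq[OF adjoin_mult(2)[OF k(1) l(1)]])
    then show ?thesis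
      using subgroup.mem_carrier[OF subH gh(2)] k l by (simp add: diff_def exponent_mod_eq)
  qed
  have "diff G g' (diff G g (exponent_mod K x)) h = 0"
    if "g \<in> adjoin K x" "g' \<in> adjoin K x" "h \<in> adjoin K x" for g g' h
    using d[OF that(1,3)] d[OF that(1) subgroup.m_closed[OF subH that(2,3)]]
    by (simp add: diff_def[of G g'])
  then show ?thesis by (simp add: numeral_2_eq_2)
qed

end

text \<open>Elements outside \<open>K\<close> are told from the identity by the exponent of
  \<open>x\<close>, those of \<open>K\<close> by extended functions.\<close>

lemma poly_below_separates:
  assumes c: "lower_central G c = {\<one>}" and H: "poly_Z G H"
  shows "subgroup H G \<and> (\<exists>d. \<forall>z \<in> H. z \<noteq> \<one> \<longrightarrow> (\<exists>f. poly_below G H d f \<and> f z \<noteq> f \<one>))"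
  using H
proof (induction rule: poly_Z.induct)
  case poly_Z_one
  then show ?case using triv_subgroup by simp
next
  case (poly_Z_adjoin K x)
  then obtain d where d: "\<And>z. z \<in> K \<Longrightarrow> z \<noteq> \<one> \<Longrightarrow> \<exists>f. poly_below G K d f \<and> f z \<noteq> f \<one>" by metis
  note K = poly_Z_adjoin(2,3,4)
  note sub = normal_imp_subgroup[OF K(1)] and subH = subgroup_adjoin[OF K(1,2)]
  \<comment> \<open>The first bound is for extended functions, the second for the exponent.\<close>
  let ?d = "max (Suc c * d) 2"
  have one: "\<one> = \<one> \<otimes> x [^] (0::int)" by simp
  have "\<exists>f. poly_below G (adjoin K x) ?d f \<and> f z \<noteq> f \<one>" if z: "z \<in> adjoin K x" "z \<noteq> \<one>" for z
  proof -
    obtain k n where k: "k \<in> K" "z = k \<otimes> x [^] (n::int)"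
      using z(1) unfolding adjoin_def by auto
    show ?thesis
    proof (cases "n = 0")
      case True
      then have zk: "z = k" using k subgroup.mem_carrier[OF sub k(1)] by simp
      then obtain f where f: "poly_below G K d f" "f k \<noteq> f \<one>" using d[OF k(1)] z(2) by auto
      have "poly_below G (adjoin K x) (Suc c * d) (extend_fun K x f)"
        by (rule poly_below_extend_fun[OF K wpoly_below_if_poly_below[OF sub c f(1)]])
      then have "poly_below G (adjoin K x) ?d (extend_fun K x f)"
        by (rule poly_below_mono[OF subH _ max.cobounded1])
      moreover have "extend_fun K x f z = f k" unfolding k(2) by (rule extend_fun_eq[OF K k(1)])
      moreover have "extend_fun K x f \<one> = f \<one>"
        using extend_fun_eq[OF K subgroup.one_closed[OF sub], of f 0] by simp
      ultimately show ?thesis using f(2) by auto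
    next
      case False
      have "poly_below G (adjoin K x) ?d (exponent_mod K x)"
        by (rule poly_below_mono[OF subH poly_below_exponent_mod[OF K] max.cobounded2])
      moreover have "exponent_mod K x z = n" unfolding k(2) by (rule exponent_mod_eq[OF K k(1)])
      moreover have "exponent_mod K x \<one> = 0"
        using exponent_mod_eq[OF K subgroup.one_closed[OF sub], of 0] by simp
      ultimately show ?thesis using False by auto
    qed
  qed
  then show ?case using subH by blast
qed

end

section \<open>Integral lattices of polynomial functions\<close>

primrec zspan :: "('g \<Rightarrow> int) list \<Rightarrow> ('g \<Rightarrow> int) set" where
  "zspan [] = {\<lambda>_. 0}"
| "zspan (f # fs) = {\<lambda>y. a * f y + h y | a h. h \<in> zspan fs}"

text \<open>The integer valued functions in the rational span, expressed with integers only.\<close>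

definition qspan :: "('g \<Rightarrow> int) list \<Rightarrow> ('g \<Rightarrow> int) set" where
  "qspan fs = {f. \<exists>k::int. k \<noteq> 0 \<and> (\<lambda>y. k * f y) \<in> zspan fs}"

lemma zspan_ConsI: "h \<in> zspan fs \<Longrightarrow> (\<lambda>y. a * f y + h y) \<in> zspan (f # fs)"
  by auto

lemma zero_in_zspan: "(\<lambda>_. 0) \<in> zspan fs"
proof (induction fs)
  case (Cons f fs)
  from zspan_ConsI[OF this, of 0 f] show ?case by simp
qed simp

lemma zspan_lin: "f \<in> zspan fs \<Longrightarrow> h \<in> zspan fs \<Longrightarrow> (\<lambda>y. a * f y + b * h y) \<in> zspan fs"
proof (induction fs arbitrary: f h)
  case (Cons e fs)
  from Cons.prems obtain c f' d h' where f: "f = (\<lambda>y. c * e y + f' y)" "f' \<in> zspan fs"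
    and h: "h = (\<lambda>y. d * e y + h' y)" "h' \<in> zspan fs" by auto
  have "(\<lambda>y. a * f y + b * h y) = (\<lambda>y. (a * c + b * d) * e y + (a * f' y + b * h' y))"
    by (auto simp: f h algebra_simps)
  then show ?case using zspan_ConsI[OF Cons.IH[OF f(2) h(2)]] by metis
qed simp

lemma zspan_scale: "f \<in> zspan fs \<Longrightarrow> (\<lambda>y. a * f y) \<in> zspan fs"
  using zspan_lin[of f fs f a 0] by simp

lemma zspan_add: "f \<in> zspan fs \<Longrightarrow> h \<in> zspan fs \<Longrightarrow> (\<lambda>y. f y + h y) \<in> zspan fs"
  using zspan_lin[of f fs h 1 1] by simp

lemma zspan_Cons_mono: "zspan fs \<subseteq> zspan (f # fs)"
proof
  fix h assume "h \<in> zspan fs"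
  from zspan_ConsI[OF this, of 0 f] show "h \<in> zspan (f # fs)" by simp
qed

lemma zspan_head: "f \<in> zspan (f # fs)"
  using zspan_ConsI[OF zero_in_zspan, of 1 f fs] by simp

lemma qspanI: "k \<noteq> 0 \<Longrightarrow> (\<lambda>y. k * f y) \<in> zspan fs \<Longrightarrow> f \<in> qspan fs"
  by (auto simp: qspan_def)

lemma qspanE:
  assumes "f \<in> qspan fs"
  obtains k where "k \<noteq> 0" "(\<lambda>y. k * f y) \<in> zspan fs"
  using assms by (auto simp: qspan_def)

lemma zspan_subset_qspan: "zspan fs \<subseteq> qspan fs"
  by (auto intro: qspanI[of 1])

lemma qspan_lin:
  assumes "f \<in> qspan fs" "h \<in> qspan fs"
  shows "(\<lambda>y. a * f y + b * h y) \<in> qspan fs"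
proof -
  obtain k l where k: "k \<noteq> 0" "(\<lambda>y. k * f y) \<in> zspan fs" and l: "l \<noteq> 0" "(\<lambda>y. l * h y) \<in> zspan fs"
    using assms by (elim qspanE)
  have "(\<lambda>y. (k * l) * (a * f y + b * h y)) = (\<lambda>y. (l * a) * (k * f y) + (k * b) * (l * h y))"
    by (auto simp: algebra_simps)
  then have "(\<lambda>y. (k * l) * (a * f y + b * h y)) \<in> zspan fs"
    using zspan_lin[OF k(2) l(2)] by metis
  then show ?thesis using k(1) l(1) by (intro qspanI[of "k * l"]) simp_all
qed

lemma qspan_unscale:
  assumes "k \<noteq> 0" "(\<lambda>y. k * f y) \<in> qspan fs"
  shows "f \<in> qspan fs"
proof -
  obtain l where l: "l \<noteq> 0" "(\<lambda>y. l * (k * f y)) \<in> zspan fs" using assms(2) by (rule qspanE)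
  then show ?thesis using assms(1) by (intro qspanI[of "l * k"]) (simp_all add: mult.assoc)
qed

lemma zspan_subset_if:
  assumes "\<And>f. f \<in> set T \<Longrightarrow> f \<in> qspan fs"
  shows "zspan T \<subseteq> qspan fs"
  using assms
proof (induction T)
  case Nil
  then show ?case using zero_in_zspan[of fs] zspan_subset_qspan by auto
next
  case (Cons t T)
  show ?case
  proof
    fix f assume "f \<in> zspan (t # T)"
    then obtain a h where f: "f = (\<lambda>y. a * t y + h y)" "h \<in> zspan T" by auto
    have "t \<in> qspan fs" "h \<in> qspan fs" using Cons f(2) by auto
    from qspan_lin[OF this, of a 1] show "f \<in> qspan fs" by (simp add: f(1))
  qed
qed

lemma qspan_subset_if:
  assumes "\<And>f. f \<in> set T \<Longrightarrow> f \<in> qspan fs"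
  shows "qspan T \<subseteq> qspan fs"
proof
  fix f assume "f \<in> qspan T"
  then obtain k where k: "k \<noteq> 0" "(\<lambda>y. k * f y) \<in> zspan T" by (rule qspanE)
  then have "(\<lambda>y. k * f y) \<in> qspan fs" using zspan_subset_if[OF assms] by blast
  with k(1) show "f \<in> qspan fs" by (rule qspan_unscale)
qed

lemma qspan_Cons_mono: "qspan fs \<subseteq> qspan (f # fs)"
  using zspan_Cons_mono unfolding qspan_def by blast

lemma common_denominator:
  assumes "finite A" "A \<subseteq> qspan fs"
  obtains m where "m \<noteq> 0" "\<And>f. f \<in> A \<Longrightarrow> (\<lambda>y. m * f y) \<in> zspan fs"
proof -
  have "\<exists>m. m \<noteq> 0 \<and> (\<forall>f \<in> A. (\<lambda>y. m * f y) \<in> zspan fs)"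
    using assms
  proof (induction A)
    case empty
    show ?case by (intro exI[of _ 1]) simp
  next
    case (insert e A)
    then obtain m where m: "m \<noteq> 0" "\<forall>f \<in> A. (\<lambda>y. m * f y) \<in> zspan fs" by auto
    from insert.prems have "e \<in> qspan fs" by simp
    then obtain k where k: "k \<noteq> 0" "(\<lambda>y. k * e y) \<in> zspan fs" by (rule qspanE)
    have "(\<lambda>y. (k * m) * f y) \<in> zspan fs" if "f \<in> insert e A" for f
    proof (cases "f = e")
      case True
      show ?thesis using zspan_scale[OF k(2), of m] by (simp add: True mult.assoc mult.left_commute)
    next
      case False
      then have "(\<lambda>y. m * f y) \<in> zspan fs" using that m(2) by blast
      from zspan_scale[OF this, of k] show ?thesis by (simp add: mult.assoc)
    qed
    then show ?case using k(1) m(1) by (intro exI[of _ "k * m"]) simp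
  qed
  then show ?thesis using that by metis
qed

text \<open>Elimination without division: with \<open>t e \<noteq> 0\<close>, the combination t(e) f
  - f(e) t vanishes at \<open>e\<close>, so one function is needed per point of \<open>E\<close> at
  most.\<close>

lemma finite_rank:
  assumes "finite E"
    and "\<And>f h a b. f \<in> W \<Longrightarrow> h \<in> W \<Longrightarrow> (\<lambda>y. a * f y + b * h y :: int) \<in> W"
    and "\<And>f. f \<in> W \<Longrightarrow> (\<And>x. x \<in> E \<Longrightarrow> f x = 0) \<Longrightarrow> f = (\<lambda>_. 0)"
  shows "\<exists>T. set T \<subseteq> W \<and> W \<subseteq> qspan T"
  using assms
proof (induction E arbitrary: W)
  case empty
  have "f = (\<lambda>_. 0)" if "f \<in> W" for f by (rule empty.prems(2)[OF that]) simp
  then have "W \<subseteq> qspan []" by (auto intro: qspanI[of 1])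
  then show ?case by (intro exI[of _ "[]"]) simp
next
  case (insert e E)
  let ?W = "{f \<in> W. f e = 0}"
  have "\<exists>T. set T \<subseteq> ?W \<and> ?W \<subseteq> qspan T"
  proof (rule insert.IH)
    fix f h :: "'a \<Rightarrow> int" and a b assume "f \<in> ?W" "h \<in> ?W"
    then show "(\<lambda>y. a * f y + b * h y) \<in> ?W" using insert.prems(1)[of f h a b] by simp
  next
    fix f assume f: "f \<in> ?W" "\<And>x. x \<in> E \<Longrightarrow> f x = 0"
    then have "f \<in> W" "f e = 0" by simp_all
    show "f = (\<lambda>_. 0)"
      by (rule insert.prems(2)[OF \<open>f \<in> W\<close>]) (use f(2) \<open>f e = 0\<close> in auto)
  qed
  then obtain T where T: "set T \<subseteq> ?W" "?W \<subseteq> qspan T" by (elim exE conjE)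
  show ?case
  proof (cases "\<exists>f \<in> W. f e \<noteq> 0")
    case False
    then have "?W = W" by auto
    then show ?thesis using T by (intro exI[of _ T]) simp
  next
    case True
    then obtain t where t: "t \<in> W" "t e \<noteq> 0" by auto
    have "f \<in> qspan (t # T)" if f: "f \<in> W" for f
    proof -
      have "(\<lambda>y. t e * f y + (- f e) * t y) \<in> ?W"
        using insert.prems(1)[OF f t(1), of "t e" "- f e"] by simp
      from subsetD[OF T(2) this]
      obtain k where k: "k \<noteq> 0" "(\<lambda>y. k * (t e * f y + (- f e) * t y)) \<in> zspan T"
        by (rule qspanE)
      have "(\<lambda>y. (k * f e) * t y + k * (t e * f y + (- f e) * t y)) = (\<lambda>y. (k * t e) * f y)"
        by (auto simp: algebra_simps)
      then have "(\<lambda>y. (k * t e) * f y) \<in> zspan (t # T)" using zspan_ConsI[OF k(2), of "k * f e" t] by simp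
      then show ?thesis using k(1) t(2) by (intro qspanI[of "k * t e"]) simp_all
    qed
    then have "W \<subseteq> qspan (t # T)" by (rule subsetI)
    moreover have "set (t # T) \<subseteq> W" using T(1) t(1) by auto
    ultimately show ?thesis by (intro exI[of _ "t # T"] conjI)
  qed
qed

section \<open>Flags of lattices stable under translation\<close>

text \<open>The head is the function added last: independent of the rest, and fixed by all
  translations modulo the lattice of the rest. In list order the matrices of translations are then
  upper unitriangular.\<close>

primrec flag :: "('g, 'm) monoid_scheme \<Rightarrow> ('g \<Rightarrow> int) list \<Rightarrow> bool" where
  "flag G [] \<longleftrightarrow> True"
| "flag G (f # fs) \<longleftrightarrow> flag G fs \<and> f \<notin> qspan fs \<and> (\<forall>g \<in> carrier G. diff G g f \<in> zspan fs)"

context group begin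

lemma shift_eq: "shift G g f = (\<lambda>y. f y + diff G g f y)"
  by (auto simp: shift_def diff_def)

lemma diff_one: "diff G \<one> f = (\<lambda>_. 0)"
  by (auto simp: diff_def)

lemma diff_mult:
  assumes "g \<in> carrier G" "h \<in> carrier G"
  shows "diff G (g \<otimes> h) f = (\<lambda>y. shift G h (diff G g f) y + diff G h f y)"
  using assms by (auto simp: shift_def diff_def m_assoc)

lemma shift_mult:
  assumes "g \<in> carrier G" "h \<in> carrier G"
  shows "shift G (g \<otimes> h) f = shift G h (shift G g f)"
  using assms by (auto simp: shift_def m_assoc)

lemma shift_zspan:
  assumes "flag G fs" "g \<in> carrier G"
  shows "h \<in> zspan fs \<Longrightarrow> shift G g h \<in> zspan fs"
  using assms(1)
proof (induction fs arbitrary: h)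
  case Nil
  then have "shift G g h = (\<lambda>_. 0)" by (auto simp: shift_def)
  then show ?case by simp
next
  case (Cons f fs)
  then obtain a h' where h: "h = (\<lambda>y. a * f y + h' y)" "h' \<in> zspan fs" by auto
  have "(\<lambda>y. a * diff G g f y) \<in> zspan fs" using Cons.prems(2) assms(2) by (intro zspan_scale) simp
  moreover have "shift G g h' \<in> zspan fs" using Cons h(2) by simp
  ultimately have *: "(\<lambda>y. a * diff G g f y + shift G g h' y) \<in> zspan fs" by (rule zspan_add)
  have "shift G g h = (\<lambda>y. a * f y + (a * diff G g f y + shift G g h' y))"
    unfolding h by (auto simp: shift_def diff_def algebra_simps)
  then show ?case using zspan_ConsI[OF *] by metis
qed

text \<open>A common denominator for the differences by generators and their inverses works for all
  group elements: the difference by g h is the \<open>h\<close>-shift of the difference by g plus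
  the difference by h, and shifts preserve the lattice.\<close>

lemma flag_scale_Cons:
  assumes S: "finite S" "S \<subseteq> carrier G" "generate G S = carrier G"
    and fs: "flag G fs" and f: "f \<notin> qspan fs" "\<And>g. g \<in> carrier G \<Longrightarrow> diff G g f \<in> qspan fs"
  obtains m where "m \<noteq> 0" "flag G ((\<lambda>y. m * f y) # fs)"
proof -
  let ?A = "(\<lambda>s. diff G s f) ` (S \<union> m_inv G ` S)"
  have "S \<union> m_inv G ` S \<subseteq> carrier G" using S(2) by auto
  then have "?A \<subseteq> qspan fs" using f(2) by blast
  moreover have "finite ?A" using S(1) by simp
  ultimately obtain m where m: "m \<noteq> 0" "\<And>h. h \<in> ?A \<Longrightarrow> (\<lambda>y. m * h y) \<in> zspan fs"
    using common_denominator[of ?A fs] by metis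
  let ?f = "\<lambda>y. m * f y"
  have scale: "diff G g ?f = (\<lambda>y. m * diff G g f y)" for g by (auto simp: diff_def algebra_simps)
  have "diff G g ?f \<in> zspan fs" if "g \<in> generate G S" for g
    using that
  proof (induction rule: generate.induct)
    case one
    then show ?case by (simp add: diff_one zero_in_zspan)
  next
    case (incl s)
    then show ?case unfolding scale by (intro m(2)) simp
  next
    case (inv s)
    then show ?case unfolding scale by (intro m(2)) simp
  next
    case (eng g h)
    then have gh: "g \<in> carrier G" "h \<in> carrier G" using S(3) by simp_all
    show ?case unfolding diff_mult[OF gh] by (intro zspan_add shift_zspan[OF fs gh(2)] eng.IH)
  qed
  moreover have "?f \<notin> qspan fs" using f(1) qspan_unscale[OF m(1)] by blast
  ultimately have "flag G (?f # fs)" using fs S(3) by simp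
  with m(1) show ?thesis by (rule that)
qed

text \<open>The value 0 off the carrier lets polynomial functions be compared as functions on the
  whole type.\<close>

definition poly_funs :: "nat \<Rightarrow> ('a \<Rightarrow> int) set" where
  "poly_funs d = {f. poly_below G (carrier G) d f \<and> (\<forall>y. y \<notin> carrier G \<longrightarrow> f y = 0)}"

lemma poly_funs_lin: "f \<in> poly_funs d \<Longrightarrow> h \<in> poly_funs d \<Longrightarrow> (\<lambda>y. a * f y + b * h y) \<in> poly_funs d"
  by (simp add: poly_funs_def poly_below_lin)

lemma diff_poly_funs: "f \<in> poly_funs (Suc d) \<Longrightarrow> g \<in> carrier G \<Longrightarrow> diff G g f \<in> poly_funs d"
  by (simp add: poly_funs_def diff_def)

lemma poly_funs_Suc: "poly_funs d \<subseteq> poly_funs (Suc d)"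
  using poly_below_Suc[OF subgroup_self] unfolding poly_funs_def by blast

text \<open>If the differences by all generators vanish, the function is invariant under the group
  and hence constant. These differences have smaller degree, so finitely many values decide whether
  they vanish.\<close>

lemma poly_funs_determined:
  assumes S: "finite S" "S \<subseteq> carrier G" "generate G S = carrier G"
  shows "\<exists>E. finite E \<and> E \<subseteq> carrier G \<and> (\<forall>f \<in> poly_funs d. (\<forall>x \<in> E. f x = 0) \<longrightarrow> f = (\<lambda>_. 0))"
proof (induction d)
  case 0
  have "f = (\<lambda>_. 0)" if "f \<in> poly_funs 0" for f
    using that unfolding poly_funs_def by (intro ext) (simp, metis)
  then show ?case by (intro exI[of _ "{}"]) simp
next
  case (Suc d)
  then obtain E where E: "finite E" "E \<subseteq> carrier G"
    "\<And>f. f \<in> poly_funs d \<Longrightarrow> (\<And>x. x \<in> E \<Longrightarrow> f x = 0) \<Longrightarrow> f = (\<lambda>_. 0)" by metis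
  \<comment> \<open>Values on \<open>E\<close> and on its translates by \<open>S\<close> determine
    the differences on \<open>E\<close>; the value at \<one> determines the remaining
    constant.\<close>
  let ?E = "insert \<one> (E \<union> (\<lambda>(s, x). s \<otimes> x) ` (S \<times> E))"
  have "f = (\<lambda>_. 0)" if f: "f \<in> poly_funs (Suc d)" "\<forall>x \<in> ?E. f x = 0" for f
  proof -
    have zero: "diff G s f = (\<lambda>_. 0)" if s: "s \<in> S" for s
    proof (rule E(3))
      show "diff G s f \<in> poly_funs d" using f(1) s S(2) by (intro diff_poly_funs) auto
      fix x assume "x \<in> E"
      then have "s \<otimes> x \<in> ?E" "x \<in> ?E" using s by auto
      then have "f (s \<otimes> x) = 0" "f x = 0" using f(2) by blast+
      then show "diff G s f x = 0" by (simp add: diff_def)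
    qed
    have inv: "f (s \<otimes> y) = f y" if "s \<in> S" "y \<in> carrier G" for s y
      using fun_cong[OF zero[OF that(1)], of y] that(2) by (simp add: diff_def)
    have "\<forall>y \<in> carrier G. f (g \<otimes> y) = f y" if "g \<in> generate G S" for g
      using that
    proof (induction rule: generate.induct)
      case (incl s)
      then show ?case using inv by simp
    next
      case (inv s)
      then have s: "s \<in> carrier G" using S(2) by auto
      show ?case
      proof
        fix y assume y: "y \<in> carrier G"
        then have "f (s \<otimes> (inv s \<otimes> y)) = f (inv s \<otimes> y)"
          using \<open>\<And>y s. s \<in> S \<Longrightarrow> y \<in> carrier G \<Longrightarrow> f (s \<otimes> y) = f y\<close> inv s by simp
        then show "f (inv s \<otimes> y) = f y" using s y by (simp flip: m_assoc)
      qed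
    next
      case (eng g h)
      then have "g \<in> carrier G" "h \<in> carrier G" using S(3) by simp_all
      then show ?case using eng.IH by (simp add: m_assoc)
    qed simp
    then have "f g = f \<one>" if "g \<in> carrier G" for g using that S(3) by (metis one_closed r_one)
    moreover have "f \<one> = 0" using f(2) by simp
    ultimately show ?thesis using f(1) unfolding poly_funs_def by (intro ext) (simp, metis)
  qed
  moreover have "finite ?E" using E(1) S(1) by simp
  moreover have "?E \<subseteq> carrier G" using E(2) S(2) by auto
  ultimately show ?case by blast
qed

text \<open>Differences of functions in the new degree lie in the rational span of the flag for the
  old degree. So each function of a finite rational spanning list that is still missing can be put
  on top after scaling, in any order.\<close>

lemma flag_exists:
  assumes S: "finite S" "S \<subseteq> carrier G" "generate G S = carrier G"
  shows "\<exists>fs. flag G fs \<and> set fs \<subseteq> poly_funs d \<and> poly_funs d \<subseteq> qspan fs"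
proof (induction d)
  case 0
  have "f = (\<lambda>_. 0)" if "f \<in> poly_funs 0" for f
    using that unfolding poly_funs_def by (intro ext) (simp, metis)
  then have "poly_funs 0 \<subseteq> qspan []" by (auto intro: qspanI[of 1])
  then show ?case by (intro exI[of _ "[]"]) simp
next
  case (Suc d)
  then obtain fs where fs: "flag G fs" "set fs \<subseteq> poly_funs d" "poly_funs d \<subseteq> qspan fs" by metis
  obtain E where E: "finite E"
    "\<And>f. f \<in> poly_funs (Suc d) \<Longrightarrow> (\<And>x. x \<in> E \<Longrightarrow> f x = 0) \<Longrightarrow> f = (\<lambda>_. 0)"
    using poly_funs_determined[OF S, of "Suc d"] by metis
  obtain T where T: "set T \<subseteq> poly_funs (Suc d)" "poly_funs (Suc d) \<subseteq> qspan T"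
    using finite_rank[OF E(1) poly_funs_lin E(2)] by metis
  have "\<exists>es. flag G es \<and> set es \<subseteq> poly_funs (Suc d) \<and> poly_funs d \<subseteq> qspan es \<and> set R \<subseteq> qspan es"
    if "set R \<subseteq> poly_funs (Suc d)" for R
    using that
  proof (induction R)
    case Nil
    have "set fs \<subseteq> poly_funs (Suc d)" using fs(2) poly_funs_Suc by (rule order_trans)
    then show ?case using fs(1,3) by (intro exI[of _ fs]) simp
  next
    case (Cons t R)
    then obtain es where es: "flag G es" "set es \<subseteq> poly_funs (Suc d)" "poly_funs d \<subseteq> qspan es"
      "set R \<subseteq> qspan es" by auto
    have t: "t \<in> poly_funs (Suc d)" using Cons.prems by simp
    show ?case
    proof (cases "t \<in> qspan es")
      case True
      then show ?thesis using es by (intro exI[of _ es]) simp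
    next
      case False
      have "diff G g t \<in> qspan es" if "g \<in> carrier G" for g
        using diff_poly_funs[OF t that] es(3) by blast
      from flag_scale_Cons[OF S es(1) False this]
      obtain m where m: "m \<noteq> 0" "flag G ((\<lambda>y. m * t y) # es)" by metis
      let ?es = "(\<lambda>y. m * t y) # es"
      have "(\<lambda>y. m * t y) \<in> poly_funs (Suc d)" using poly_funs_lin[OF t t, of m 0] by simp
      moreover have "t \<in> qspan ?es" by (rule qspanI[OF m(1) zspan_head])
      moreover have "qspan es \<subseteq> qspan ?es" by (rule qspan_Cons_mono)
      ultimately show ?thesis using es m(2) by (intro exI[of _ ?es]) auto
    qed
  qed
  from this[OF T(1)] obtain es where es: "flag G es" "set es \<subseteq> poly_funs (Suc d)" "set T \<subseteq> qspan es"
    by metis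
  have "poly_funs (Suc d) \<subseteq> qspan es"
    using T(2) qspan_subset_if[of T es] es(3) by (meson order_trans subsetD)
  then show ?case using es(1,2) by (intro exI[of _ es]) simp
qed

end

section \<open>The matrix representation on a flag\<close>

lemma zspan_sum:
  "h \<in> zspan fs \<Longrightarrow> \<exists>c. h = (\<lambda>y. \<Sum>i<length fs. c i * (fs ! i) y)"
proof (induction fs arbitrary: h)
  case Nil
  then show ?case by simp
next
  case (Cons f fs)
  then obtain a h' where h: "h = (\<lambda>y. a * f y + h' y)" "h' \<in> zspan fs" by auto
  then obtain c where c: "h' = (\<lambda>y. \<Sum>i<length fs. c i * (fs ! i) y)" using Cons.IH by metis
  have "h = (\<lambda>y. \<Sum>i<length (f # fs). case_nat a c i * ((f # fs) ! i) y)"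
    unfolding h(1) c by (simp add: sum.lessThan_Suc_shift del: sum.lessThan_Suc)
  then show ?case by (intro exI[of _ "case_nat a c"])
qed

lemma sum_in_zspan: "(\<lambda>y. \<Sum>i<length fs. c i * (fs ! i) y) \<in> zspan fs"
proof (induction fs arbitrary: c)
  case (Cons f fs)
  have "(\<lambda>y. \<Sum>i<length (f # fs). c i * ((f # fs) ! i) y) =
      (\<lambda>y. c 0 * f y + (\<Sum>i<length fs. c (Suc i) * (fs ! i) y))"
    by (simp add: sum.lessThan_Suc_shift del: sum.lessThan_Suc)
  then show ?case using zspan_ConsI[OF Cons.IH[of "\<lambda>i. c (Suc i)"], of "c 0" f] by simp
qed simp

lemma flag_independent:
  assumes "flag G fs" "\<And>y. (\<Sum>i<length fs. c i * (fs ! i) y) = 0" "i < length fs"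
  shows "c i = 0"
  using assms
proof (induction fs arbitrary: c i)
  case (Cons f fs)
  let ?h = "\<lambda>y. \<Sum>i<length fs. c (Suc i) * (fs ! i) y"
  have sum: "c 0 * f y + ?h y = 0" for y
    using Cons.prems(2)[of y] by (simp add: sum.lessThan_Suc_shift del: sum.lessThan_Suc)
  have "c 0 = 0"
  proof (rule ccontr)
    assume "c 0 \<noteq> 0"
    have "(\<lambda>y. c 0 * f y) = (\<lambda>y. (- 1) * ?h y)" using sum by (auto simp: add_eq_0_iff2)
    then have "(\<lambda>y. c 0 * f y) \<in> zspan fs"
      using zspan_scale[OF sum_in_zspan[of "\<lambda>i. c (Suc i)" fs], of "- 1"] by simp
    then have "f \<in> qspan fs" using \<open>c 0 \<noteq> 0\<close> by (intro qspanI)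
    then show False using Cons.prems(1) by simp
  qed
  moreover from this have "?h y = 0" for y using sum[of y] by simp
  ultimately show ?case
    using Cons.IH[of "\<lambda>i. c (Suc i)"] Cons.prems(1,3) by (cases i) simp_all
qed simp

text \<open>A translation changes a member of the flag only by members further down the list, so the
  coefficients start with zeros and a 1 at the member's own place.\<close>

lemma (in group) flag_shift_row:
  assumes "flag G fs" "i < length fs" "g \<in> carrier G"
  shows "\<exists>r. (\<forall>y. shift G g (fs ! i) y = (\<Sum>j<length fs. r j * (fs ! j) y)) \<and> r i = 1 \<and> (\<forall>j<i. r j = 0)"
  using assms(1,2)
proof (induction fs arbitrary: i)
  case (Cons f fs)
  show ?case
  proof (cases i)
    case 0
    have "diff G g f \<in> zspan fs" using Cons.prems(1) assms(3) by simp
    then obtain c where c: "diff G g f = (\<lambda>y. \<Sum>j<length fs. c j * (fs ! j) y)"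
      using zspan_sum by metis
    show ?thesis
      by (intro exI[of _ "case_nat 1 c"])
        (simp add: 0 shift_eq c sum.lessThan_Suc_shift del: sum.lessThan_Suc)
  next
    case (Suc k)
    then obtain r where r: "\<And>y. shift G g (fs ! k) y = (\<Sum>j<length fs. r j * (fs ! j) y)"
      "r k = 1" "\<And>j. j < k \<Longrightarrow> r j = 0" using Cons.IH[of k] Cons.prems by auto
    have "case_nat 0 r j = 0" if "j < Suc k" for j using that r(3) by (cases j) simp_all
    then show ?thesis
      by (intro exI[of _ "case_nat 0 r"])
        (simp add: Suc r(1,2) sum.lessThan_Suc_shift del: sum.lessThan_Suc)
  qed
qed simp

text \<open>Coordinates of translated functions are taken as rows. Shifting by g h is shifting by g
  and then by h, so rows give a homomorphism and not an antihomomorphism. An element of the kernel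
  agrees with \<one> under every function of the flag, which separation excludes.\<close>

lemma (in group) flag_representation:
  assumes fs: "flag G fs" and sep: "\<And>z. z \<in> carrier G \<Longrightarrow> z \<noteq> \<one> \<Longrightarrow> \<exists>f \<in> qspan fs. f z \<noteq> f \<one>"
  shows "mon G (unitriangular_group (length fs)) \<noteq> {}"
proof -
  let ?n = "length fs" and ?f = "\<lambda>i. fs ! i"
  define A where "A g i = (SOME r. (\<forall>y. shift G g (?f i) y = (\<Sum>j<?n. r j * ?f j y)) \<and>
    r i = 1 \<and> (\<forall>j<i. r j = 0))" for g i
  have row: "(\<forall>y. shift G g (?f i) y = (\<Sum>j<?n. A g i j * ?f j y)) \<and> A g i i = 1 \<and> (\<forall>j<i. A g i j = 0)"
    if "g \<in> carrier G" "i < ?n" for g i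
    unfolding A_def by (rule someI_ex[OF flag_shift_row[OF fs that(2,1)]])
  have A: "shift G g (?f i) y = (\<Sum>j<?n. A g i j * ?f j y)" if "g \<in> carrier G" "i < ?n" for g i y
    using row[OF that] by simp
  have diag: "A g i i = 1" if "g \<in> carrier G" "i < ?n" for g i using row[OF that] by simp
  have low: "A g i j = 0" if "g \<in> carrier G" "i < ?n" "j < i" for g i j using row[OF that(1,2)] that(3) by simp
  define \<rho> where "\<rho> g = mat ?n ?n (\<lambda>(i, j). A g i j)" for g
  have \<rho>_carrier: "\<rho> g \<in> carrier_mat ?n ?n" for g by (simp add: \<rho>_def)
  have \<rho>_U: "\<rho> g \<in> U ?n" if "g \<in> carrier G" for g
    using that diag low by (auto simp: U_iff \<rho>_def)
  have mult: "\<rho> (g \<otimes> h) = \<rho> g * \<rho> h" if g: "g \<in> carrier G" and h: "h \<in> carrier G" for g h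
  proof (rule eq_matI)
    fix i k assume "i < dim_row (\<rho> g * \<rho> h)" "k < dim_col (\<rho> g * \<rho> h)"
    then have ik: "i < ?n" "k < ?n" by (simp_all add: \<rho>_def)
    \<comment> \<open>The functions of a flag are linearly independent, so the two expansions of the
      doubly shifted function have equal coefficients.\<close>
    have "(\<Sum>k<?n. (A (g \<otimes> h) i k - (\<Sum>j<?n. A g i j * A h j k)) * ?f k y) = 0" for y
    proof -
      have "(\<Sum>k<?n. A (g \<otimes> h) i k * ?f k y) = shift G h (shift G g (?f i)) y"
        using A[of "g \<otimes> h" i y] g h ik(1) by (simp add: shift_mult)
      also have "\<dots> = (\<Sum>j<?n. A g i j * shift G h (?f j) y)"
        using A[OF g ik(1)] by (simp add: shift_def)
      also have "\<dots> = (\<Sum>j<?n. A g i j * (\<Sum>k<?n. A h j k * ?f k y))"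
        using A[OF h] by simp
      also have "\<dots> = (\<Sum>j<?n. \<Sum>k<?n. A g i j * A h j k * ?f k y)"
        by (simp add: sum_distrib_left mult.assoc)
      also have "\<dots> = (\<Sum>k<?n. \<Sum>j<?n. A g i j * A h j k * ?f k y)" by (rule sum.swap)
      also have "\<dots> = (\<Sum>k<?n. (\<Sum>j<?n. A g i j * A h j k) * ?f k y)"
        by (simp add: sum_distrib_right)
      finally show ?thesis by (simp add: left_diff_distrib sum_subtractf)
    qed
    from flag_independent[OF fs this ik(2)]
    show "\<rho> (g \<otimes> h) $$ (i, k) = (\<rho> g * \<rho> h) $$ (i, k)"
      using ik by (simp add: mult_mat_entry[OF \<rho>_carrier \<rho>_carrier] del: index_mult_mat) (simp add: \<rho>_def)
  qed (simp_all add: \<rho>_def)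
  have "z = \<one>" if z: "z \<in> carrier G" "\<rho> z = 1\<^sub>m ?n" for z
  proof (rule ccontr)
    assume "z \<noteq> \<one>"
    then obtain f where f: "f \<in> qspan fs" "f z \<noteq> f \<one>" using sep[OF z(1)] by blast
    \<comment> \<open>The shift by \<open>z\<close> fixes each member of the flag; evaluation at
      \<one> compares its values at \<open>z\<close> and \<one>.\<close>
    have "?f i z = ?f i \<one>" if i: "i < ?n" for i
    proof -
      have "A z i j = (if i = j then 1 else 0)" if "j < ?n" for j
        using arg_cong[OF z(2), of "\<lambda>M. M $$ (i, j)"] i that by (simp add: \<rho>_def)
      then have "(\<Sum>j<?n. A z i j * ?f j \<one>) = (\<Sum>j<?n. if i = j then ?f j \<one> else 0)"
        by (intro sum.cong) simp_all
      then have "shift G z (?f i) \<one> = ?f i \<one>" using A[OF z(1) i, of \<one>] i by simp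
      then show ?thesis using z(1) by (simp add: shift_def)
    qed
    moreover obtain k where k: "k \<noteq> 0" "(\<lambda>y. k * f y) \<in> zspan fs" using f(1) by (rule qspanE)
    moreover obtain c where "(\<lambda>y. k * f y) = (\<lambda>y. \<Sum>i<?n. c i * ?f i y)" using zspan_sum[OF k(2)] by metis
    then have "k * f y = (\<Sum>i<?n. c i * ?f i y)" for y by (rule fun_cong)
    ultimately have "k * f z = k * f \<one>" by simp
    with k(1) f(2) show False by simp
  qed
  then have "\<rho> \<in> mon G (unitriangular_group ?n)"
    using \<rho>_U mult unfolding mon_iff_hom_one[OF is_group group_unitriangular]
    by (auto simp: hom_def)
  then show ?thesis by blast
qed

theorem torsion_free_nilpotent_embeds:
  assumes "finitely_generated_group G" "torsion_free_group G" "nilpotent_group G"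
  shows "\<exists>n. mon G (unitriangular_group n) \<noteq> {}"
proof -
  interpret group G using assms(3) by (simp add: nilpotent_group_def)
  obtain S where S: "finite S" "S \<subseteq> carrier G" "generate G S = carrier G"
    using assms(1) unfolding finitely_generated_group_def by metis
  obtain c where c: "lower_central G c = {\<one>\<^bsub>G\<^esub>}" using assms(3) unfolding nilpotent_group_def by metis
  have tf: "x = \<one>\<^bsub>G\<^esub>" if "x \<in> carrier G" "k > 0" "x [^]\<^bsub>G\<^esub> (k::nat) = \<one>\<^bsub>G\<^esub>" for x k
    using assms(2) that unfolding torsion_free_group_def by metis
  have "poly_Z G (carrier G)" by (rule poly_Z_carrier[OF S c tf])
  then obtain d where d: "\<And>z. z \<in> carrier G \<Longrightarrow> z \<noteq> \<one>\<^bsub>G\<^esub> \<Longrightarrow>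
      \<exists>f. poly_below G (carrier G) d f \<and> f z \<noteq> f \<one>\<^bsub>G\<^esub>"
    using poly_below_separates[OF c] by metis
  obtain fs where fs: "flag G fs" "poly_funs d \<subseteq> qspan fs" using flag_exists[OF S] by metis
  have "\<exists>f \<in> qspan fs. f z \<noteq> f \<one>\<^bsub>G\<^esub>" if z: "z \<in> carrier G" "z \<noteq> \<one>\<^bsub>G\<^esub>" for z
  proof -
    obtain f where f: "poly_below G (carrier G) d f" "f z \<noteq> f \<one>\<^bsub>G\<^esub>" using d[OF z] by metis
    \<comment> \<open>The separating function is arbitrary off the carrier, whereas
      \<open>poly_funs\<close> prescribes 0 there.\<close>
    define h where "h y = (if y \<in> carrier G then f y else 0)" for y
    have "poly_below G (carrier G) d h"
      using f(1) poly_below_cong[OF subgroup_self, of h f d] by (simp add: h_def)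
    then have "h \<in> poly_funs d" by (simp add: poly_funs_def h_def)
    moreover have "h z \<noteq> h \<one>\<^bsub>G\<^esub>" using f(2) z(1) by (simp add: h_def)
    ultimately show ?thesis using fs(2) by blast
  qed
  then show ?thesis using flag_representation[OF fs(1)] by metis
qed

theorem theorem6p1:
  shows "(\<forall>n::nat. n \<ge> 1 \<longrightarrow> poly_pushdown_group (unitriangular_group n)) \<and>
    (\<forall>c::nat. \<exists>G :: int mat monoid.
       poly_pushdown_group G \<and> nilpotent_group G \<and> nilpotency_class G = c) \<and>
    (\<forall>G :: ('g, 'm) monoid_scheme.
       finitely_generated_group G \<and> torsion_free_group G \<and> nilpotent_group G \<longrightarrow>
       (\<exists>H :: int mat monoid. poly_pushdown_group H \<and> mon G H \<noteq> {}))"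
proof (intro conjI allI impI)
  fix n :: nat
  show "poly_pushdown_group (unitriangular_group n)" by (rule poly_pushdown_group_unitriangular)
next
  fix c :: nat
  show "\<exists>G :: int mat monoid. poly_pushdown_group G \<and> nilpotent_group G \<and> nilpotency_class G = c"
    by (intro exI[of _ "unitriangular_group (Suc c)"] conjI poly_pushdown_group_unitriangular
        nilpotent_unitriangular)
next
  fix G :: "('g, 'm) monoid_scheme"
  assume "finitely_generated_group G \<and> torsion_free_group G \<and> nilpotent_group G"
  then obtain n where "mon G (unitriangular_group n) \<noteq> {}"
    using torsion_free_nilpotent_embeds by metis
  then show "\<exists>H :: int mat monoid. poly_pushdown_group H \<and> mon G H \<noteq> {}"
    using poly_pushdown_group_unitriangular by (intro exI[of _ "unitriangular_group n"] conjI)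
qed

end
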